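(* Let $X$ be a smooth complex variety, and let $\mathcal F$ be a regular holomorphic foliation of codimension $q$ on $X$, with tangent bundle $T_{\mathcal F}\subset T_X$ and normal bundle $N_{\mathcal F}=T_X/T_{\mathcal F}$. Let $x\in X$. After replacing $X$ by a sufficiently small analytic neighbourhood of $x$, the following conditions are equivalent. (1) The foliation $\mathcal F$ admits holomorphic first integrals $f^1,\ldots,f^q$, with $df^1,\ldots,df^q$ linearly independent, such that $T_{\mathcal F}=\bigcap_i\ker df^i$. (2) There exists a flat holomorphic connection \[ \nabla:N_{\mathcal F}\longrightarrow N_{\mathcal F}\otimes\Omega_X^1 \] whose restriction along $T_{\mathcal F}$ is the Bott partial connection, and such that $N_{\mathcal F}^*$ admits a frame of closed holomorphic $1$-forms which are parallel with respect to the dual connection $\nabla^*$. Moreover, in any local conormal frame $\omega=(\omega^1,\ldots,\omega^q)$ (a local frame of $N^*_{\mathcal F}$), written as a row vector, a flat holomorphic connection $\nabla$ on $N_{\mathcal F}$ which restricts to the Bott partial connection along $T_{\mathcal F}$ and whose dual connection $\nabla^*$ admits a parallel frame of $N_{\mathcal F}^*$ consisting of closed holomorphic $1$-forms can be described by a matrix $\eta$ of holomorphic $1$-forms satisfying \[ d\omega=-\omega\wedge\eta,\qquad \nabla^*\omega=\omega\eta,\qquad d\eta+\eta\wedge\eta=0. \]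
   Context: A regular foliation of codimension $q$ is given by an involutive holomorphic subbundle $T_{\mathcal F}\subset T_X$ of corank $q$. The conormal bundle $N_{\mathcal F}^*$ is identified with the subbundle of $\Omega^1_X$ of forms annihilating $T_{\mathcal F}$. The Bott partial connection on $N_{\mathcal F}$ is $\nabla^{\mathrm{Bott}}_v([w])=[v,w]\bmod T_{\mathcal F}$ for local sections $v$ of $T_{\mathcal F}$ and vector fields $w$ with class $[w]\in N_{\mathcal F}$. *)

theory Defs
  imports
    "HOL-Analysis.Analysis"
    "HOL-Library.Function_Algebras"
    "HOL-Library.Set_Algebras"
begin

section \<open>Complex manifolds\<close>

definition cholomorphic_on :: "(complex ^ 'n \<Rightarrow> complex) \<Rightarrow> (complex ^ 'n) set \<Rightarrow> bool"
  where "cholomorphic_on f S \<longleftrightarrow>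
    (\<forall>z\<in>S. \<exists>D. (f has_derivative D) (at z) \<and> (\<forall>c v. D (c *s v) = c * D v))"

text \<open>A chart is a pair of its domain and the coordinate map; values of the coordinate map
  outside the domain are irrelevant.\<close>

record ('a, 'n) cmanifold =
  mtop :: "'a topology"
  atlas :: "('a set \<times> ('a \<Rightarrow> complex ^ 'n)) set"

definition complex_manifold :: "('a, 'n::finite) cmanifold \<Rightarrow> bool"
  where "complex_manifold M \<longleftrightarrow>
    Hausdorff_space (mtop M) \<and> second_countable (mtop M) \<and>
    \<Union>(fst ` atlas M) = topspace (mtop M) \<and>
    (\<forall>(D, \<phi>) \<in> atlas M. openin (mtop M) D \<and> open (\<phi> ` D) \<and>
       homeomorphic_map (subtopology (mtop M) D) (top_of_set (\<phi> ` D)) \<phi>) \<and>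
    (\<forall>(D, \<phi>) \<in> atlas M. \<forall>(E, \<psi>) \<in> atlas M. \<forall>i.
       cholomorphic_on (\<lambda>z. \<psi> (inv_into D \<phi> z) $ i) (\<phi> ` (D \<inter> E)))"

definition hol_fun :: "('a, 'n::finite) cmanifold \<Rightarrow> 'a set \<Rightarrow> ('a \<Rightarrow> complex) \<Rightarrow> bool"
  where "hol_fun M U f \<longleftrightarrow>
    (\<forall>(D, \<phi>) \<in> atlas M. cholomorphic_on (\<lambda>z. f (inv_into D \<phi> z)) (\<phi> ` (D \<inter> U)))"

definition hol_near :: "('a, 'n::finite) cmanifold \<Rightarrow> 'a \<Rightarrow> ('a \<Rightarrow> complex) \<Rightarrow> bool"
  where "hol_near M p f \<longleftrightarrow> (\<exists>U. openin (mtop M) U \<and> p \<in> U \<and> hol_fun M U f)"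


section \<open>Tangent vectors and vector fields\<close>

text \<open>A (holomorphic) tangent vector at \<open>p\<close> is a derivation of the ring of germs at \<open>p\<close> of
  holomorphic functions. It is encoded as an operator on all functions which only depends on the
  germ, normalised to be zero on functions that are not holomorphic near \<open>p\<close>, so that equal
  derivations are equal operators. The vector space structure is the pointwise one of
  \<^theory>\<open>HOL-Library.Function_Algebras\<close>.\<close>

type_synonym 'a tvec = "('a \<Rightarrow> complex) \<Rightarrow> complex"
type_synonym 'a covec = "'a tvec \<Rightarrow> complex"

definition tangent_space :: "('a, 'n::finite) cmanifold \<Rightarrow> 'a \<Rightarrow> 'a tvec set"
  where "tangent_space M p = {v.
    (\<forall>f. \<not> hol_near M p f \<longrightarrow> v f = 0) \<and>
    (\<forall>f g U. openin (mtop M) U \<and> p \<in> U \<and> hol_fun M U f \<and> (\<forall>r\<in>U. g r = f r) \<longrightarrow> v g = v f) \<and>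
    (\<forall>f g. hol_near M p f \<and> hol_near M p g \<longrightarrow>
       v (\<lambda>r. f r + g r) = v f + v g \<and>
       v (\<lambda>r. f r * g r) = f p * v g + g p * v f) \<and>
    (\<forall>c f. hol_near M p f \<longrightarrow> v (\<lambda>r. c * f r) = c * v f)}"

definition tscale :: "complex \<Rightarrow> 'a tvec \<Rightarrow> 'a tvec"
  where "tscale c v = (\<lambda>f. c * v f)"

definition vector_field ::
    "('a, 'n::finite) cmanifold \<Rightarrow> 'a set \<Rightarrow> ('a \<Rightarrow> 'a tvec) \<Rightarrow> bool"
  where "vector_field M U v \<longleftrightarrow>
    (\<forall>p\<in>U. v p \<in> tangent_space M p) \<and>
    (\<forall>V f. openin (mtop M) V \<and> V \<subseteq> U \<and> hol_fun M V f \<longrightarrow> hol_fun M V (\<lambda>p. v p f))"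

text \<open>The guard keeps the normalisation of tangent vectors.\<close>

definition lie_bracket ::
    "('a, 'n::finite) cmanifold \<Rightarrow> ('a \<Rightarrow> 'a tvec) \<Rightarrow> ('a \<Rightarrow> 'a tvec) \<Rightarrow> 'a \<Rightarrow> 'a tvec"
  where "lie_bracket M v w p =
    (\<lambda>f. if hol_near M p f then v p (\<lambda>r. w r f) - w p (\<lambda>r. v r f) else 0)"


section \<open>Differential forms\<close>

text \<open>Covectors are only meaningful on the tangent space in question; no values are prescribed
  elsewhere, and forms are always compared on tangent vectors only.\<close>

definition covector :: "('a, 'n::finite) cmanifold \<Rightarrow> 'a \<Rightarrow> 'a covec \<Rightarrow> bool"
  where "covector M p a \<longleftrightarrow>
    (\<forall>u\<in>tangent_space M p. \<forall>w\<in>tangent_space M p. a (u + w) = a u + a w) \<and>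
    (\<forall>c. \<forall>u\<in>tangent_space M p. a (tscale c u) = c * a u)"

definition one_form ::
    "('a, 'n::finite) cmanifold \<Rightarrow> 'a set \<Rightarrow> ('a \<Rightarrow> 'a covec) \<Rightarrow> bool"
  where "one_form M U \<alpha> \<longleftrightarrow>
    (\<forall>p\<in>U. covector M p (\<alpha> p)) \<and>
    (\<forall>V v. openin (mtop M) V \<and> V \<subseteq> U \<and> vector_field M V v \<longrightarrow>
       hol_fun M V (\<lambda>p. \<alpha> p (v p)))"

definition differential :: "('a \<Rightarrow> complex) \<Rightarrow> 'a \<Rightarrow> 'a covec"
  where "differential f p u = u f"

text \<open>Two-forms are given by their values on pairs of local holomorphic vector fields. The
  exterior derivative is Cartan's formula, with the normalisation (no factor 1/2) matching that
  of the wedge product.\<close>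

type_synonym 'a biform = "('a \<Rightarrow> 'a tvec) \<Rightarrow> ('a \<Rightarrow> 'a tvec) \<Rightarrow> 'a \<Rightarrow> complex"

definition ext_d :: "('a, 'n::finite) cmanifold \<Rightarrow> ('a \<Rightarrow> 'a covec) \<Rightarrow> 'a biform"
  where "ext_d M \<alpha> v w p =
    v p (\<lambda>r. \<alpha> r (w r)) - w p (\<lambda>r. \<alpha> r (v r)) - \<alpha> p (lie_bracket M v w p)"

definition wedge :: "('a \<Rightarrow> 'a covec) \<Rightarrow> ('a \<Rightarrow> 'a covec) \<Rightarrow> 'a biform"
  where "wedge \<alpha> \<beta> v w p = \<alpha> p (v p) * \<beta> p (w p) - \<alpha> p (w p) * \<beta> p (v p)"

definition biform_eq ::
    "('a, 'n::finite) cmanifold \<Rightarrow> 'a set \<Rightarrow> 'a biform \<Rightarrow> 'a biform \<Rightarrow> bool"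
  where "biform_eq M U B C \<longleftrightarrow>
    (\<forall>V v w. openin (mtop M) V \<and> V \<subseteq> U \<and> vector_field M V v \<and> vector_field M V w \<longrightarrow>
       (\<forall>p\<in>V. B v w p = C v w p))"

definition closed_form :: "('a, 'n::finite) cmanifold \<Rightarrow> 'a set \<Rightarrow> ('a \<Rightarrow> 'a covec) \<Rightarrow> bool"
  where "closed_form M U \<alpha> \<longleftrightarrow> biform_eq M U (ext_d M \<alpha>) (\<lambda>v w p. 0)"

definition covectors_independent ::
    "('a, 'n::finite) cmanifold \<Rightarrow> nat \<Rightarrow> 'a \<Rightarrow> (nat \<Rightarrow> 'a covec) \<Rightarrow> bool"
  where "covectors_independent M q p a \<longleftrightarrow>
    (\<forall>c. (\<forall>u\<in>tangent_space M p. (\<Sum>i<q. c i * a i u) = 0) \<longrightarrow> (\<forall>i<q. c i = 0))"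


section \<open>Regular foliations\<close>

text \<open>\<open>T p\<close> is the fibre at \<open>p\<close> of the tangent bundle of the foliation.\<close>

definition holomorphic_subbundle ::
    "('a, 'n::finite) cmanifold \<Rightarrow> nat \<Rightarrow> ('a \<Rightarrow> 'a tvec set) \<Rightarrow> bool"
  where "holomorphic_subbundle M k T \<longleftrightarrow>
    (\<forall>p\<in>topspace (mtop M). \<exists>U e. openin (mtop M) U \<and> p \<in> U \<and>
       (\<forall>i<k. vector_field M U (e i)) \<and>
       (\<forall>r\<in>U. T r = {\<Sum>i<k. tscale (c i) (e i r) | c. True} \<and>
         (\<forall>c. (\<Sum>i<k. tscale (c i) (e i r)) = 0 \<longrightarrow> (\<forall>i<k. c i = 0))))"

definition tangent_field ::
    "('a, 'n::finite) cmanifold \<Rightarrow> ('a \<Rightarrow> 'a tvec set) \<Rightarrow> 'a set \<Rightarrow> ('a \<Rightarrow> 'a tvec) \<Rightarrow> bool"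
  where "tangent_field M T U v \<longleftrightarrow> vector_field M U v \<and> (\<forall>p\<in>U. v p \<in> T p)"

definition involutive :: "('a, 'n::finite) cmanifold \<Rightarrow> ('a \<Rightarrow> 'a tvec set) \<Rightarrow> bool"
  where "involutive M T \<longleftrightarrow>
    (\<forall>U v w. openin (mtop M) U \<and> tangent_field M T U v \<and> tangent_field M T U w \<longrightarrow>
       tangent_field M T U (lie_bracket M v w))"

definition regular_foliation ::
    "('a, 'n::finite) cmanifold \<Rightarrow> nat \<Rightarrow> ('a \<Rightarrow> 'a tvec set) \<Rightarrow> bool"
  where "regular_foliation M q T \<longleftrightarrow>
    (\<exists>k. k + q = CARD('n) \<and> holomorphic_subbundle M k T) \<and> involutive M T"

definition first_integrals ::
    "('a, 'n::finite) cmanifold \<Rightarrow> nat \<Rightarrow> ('a \<Rightarrow> 'a tvec set) \<Rightarrow> 'a set \<Rightarrow>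
      (nat \<Rightarrow> 'a \<Rightarrow> complex) \<Rightarrow> bool"
  where "first_integrals M q T U f \<longleftrightarrow>
    (\<forall>i<q. hol_fun M U (f i)) \<and>
    (\<forall>p\<in>U. covectors_independent M q p (\<lambda>i. differential (f i) p)) \<and>
    (\<forall>p\<in>U. T p = {u \<in> tangent_space M p. \<forall>i<q. differential (f i) p u = 0})"


section \<open>Normal and conormal bundle\<close>

text \<open>The fibre of the normal bundle consists of the cosets \<open>w +o T p\<close>. Addition of cosets is
  addition of sets; scaling adds \<open>T p\<close> so as to be correct for the scalar zero.\<close>

definition normal_space ::
    "('a, 'n::finite) cmanifold \<Rightarrow> ('a \<Rightarrow> 'a tvec set) \<Rightarrow> 'a \<Rightarrow> 'a tvec set set"
  where "normal_space M T p = {w +o T p | w. w \<in> tangent_space M p}"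

definition nscale :: "('a \<Rightarrow> 'a tvec set) \<Rightarrow> 'a \<Rightarrow> complex \<Rightarrow> 'a tvec set \<Rightarrow> 'a tvec set"
  where "nscale T p c A = tscale c ` A + T p"

definition normal_class ::
    "('a \<Rightarrow> 'a tvec set) \<Rightarrow> ('a \<Rightarrow> 'a tvec) \<Rightarrow> 'a \<Rightarrow> 'a tvec set"
  where "normal_class T w p = w p +o T p"

definition normal_section ::
    "('a, 'n::finite) cmanifold \<Rightarrow> ('a \<Rightarrow> 'a tvec set) \<Rightarrow> 'a set \<Rightarrow> ('a \<Rightarrow> 'a tvec set) \<Rightarrow> bool"
  where "normal_section M T U s \<longleftrightarrow>
    (\<forall>p\<in>U. \<exists>V w. openin (mtop M) V \<and> p \<in> V \<and> V \<subseteq> U \<and> vector_field M V w \<and>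
       (\<forall>r\<in>V. s r = normal_class T w r))"

definition conormal_space ::
    "('a, 'n::finite) cmanifold \<Rightarrow> ('a \<Rightarrow> 'a tvec set) \<Rightarrow> 'a \<Rightarrow> 'a covec set"
  where "conormal_space M T p = {a. covector M p a \<and> (\<forall>u\<in>T p. a u = 0)}"

definition pairing :: "'a covec \<Rightarrow> 'a tvec set \<Rightarrow> complex"
  where "pairing a A = the_elem (a ` A)"

definition conormal_frame ::
    "('a, 'n::finite) cmanifold \<Rightarrow> nat \<Rightarrow> ('a \<Rightarrow> 'a tvec set) \<Rightarrow> 'a set \<Rightarrow>
      (nat \<Rightarrow> 'a \<Rightarrow> 'a covec) \<Rightarrow> bool"
  where "conormal_frame M q T U \<omega> \<longleftrightarrow>
    (\<forall>i<q. one_form M U (\<omega> i) \<and> (\<forall>p\<in>U. \<omega> i p \<in> conormal_space M T p)) \<and>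
    (\<forall>p\<in>U. covectors_independent M q p (\<lambda>i. \<omega> i p) \<and>
       (\<forall>a\<in>conormal_space M T p. \<exists>c. \<forall>u\<in>tangent_space M p. a u = (\<Sum>i<q. c i * \<omega> i p u)))"


section \<open>Connections on the normal bundle\<close>

text \<open>A one-form with values in the normal bundle, i.e. a section of the tensor product of the
  normal bundle with the cotangent bundle, as a family of linear maps from the tangent spaces to
  the normal spaces.\<close>

definition normal_valued_form ::
    "('a, 'n::finite) cmanifold \<Rightarrow> ('a \<Rightarrow> 'a tvec set) \<Rightarrow> 'a set \<Rightarrow>
      ('a \<Rightarrow> 'a tvec \<Rightarrow> 'a tvec set) \<Rightarrow> bool"
  where "normal_valued_form M T U \<Theta> \<longleftrightarrow>
    (\<forall>p\<in>U. \<forall>u\<in>tangent_space M p. \<Theta> p u \<in> normal_space M T p \<and>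
       (\<forall>w\<in>tangent_space M p. \<Theta> p (u + w) = \<Theta> p u + \<Theta> p w) \<and>
       (\<forall>c. \<Theta> p (tscale c u) = nscale T p c (\<Theta> p u))) \<and>
    (\<forall>V v. openin (mtop M) V \<and> V \<subseteq> U \<and> vector_field M V v \<longrightarrow>
       normal_section M T V (\<lambda>p. \<Theta> p (v p)))"

text \<open>\<open>nabla s p u\<close> is the covariant derivative at \<open>p\<close>, in direction \<open>u\<close>, of a section \<open>s\<close> defined near
  \<open>p\<close>. The operator acts on sections over all open subsets of \<open>U\<close>; the first
  condition says that it is compatible with restriction.\<close>

type_synonym 'a conn = "('a \<Rightarrow> 'a tvec set) \<Rightarrow> 'a \<Rightarrow> 'a tvec \<Rightarrow> 'a tvec set"

definition connection ::
    "('a, 'n::finite) cmanifold \<Rightarrow> ('a \<Rightarrow> 'a tvec set) \<Rightarrow> 'a set \<Rightarrow> 'a conn \<Rightarrow> bool"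
  where "connection M T U nabla \<longleftrightarrow>
    (\<forall>V s. openin (mtop M) V \<and> V \<subseteq> U \<and> normal_section M T V s \<longrightarrow>
       (\<forall>s'. (\<forall>p\<in>V. s' p = s p) \<longrightarrow>
          (\<forall>p\<in>V. \<forall>u\<in>tangent_space M p. nabla s' p u = nabla s p u)) \<and>
       normal_valued_form M T V (nabla s) \<and>
       (\<forall>t. normal_section M T V t \<longrightarrow>
          (\<forall>p\<in>V. \<forall>u\<in>tangent_space M p. nabla (\<lambda>r. s r + t r) p u = nabla s p u + nabla t p u)) \<and>
       (\<forall>f. hol_fun M V f \<longrightarrow>
          (\<forall>p\<in>V. \<forall>u\<in>tangent_space M p. nabla (\<lambda>r. nscale T r (f r) (s r)) p u =
             nscale T p (f p) (nabla s p u) + nscale T p (differential f p u) (s p))))"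

text \<open>Vanishing of the curvature, written without subtraction of cosets.\<close>

definition flat_connection ::
    "('a, 'n::finite) cmanifold \<Rightarrow> ('a \<Rightarrow> 'a tvec set) \<Rightarrow> 'a set \<Rightarrow> 'a conn \<Rightarrow> bool"
  where "flat_connection M T U nabla \<longleftrightarrow> connection M T U nabla \<and>
    (\<forall>V v w s. openin (mtop M) V \<and> V \<subseteq> U \<and> vector_field M V v \<and> vector_field M V w \<and>
       normal_section M T V s \<longrightarrow>
       (\<forall>p\<in>V. nabla (\<lambda>r. nabla s r (w r)) p (v p) =
          nabla (\<lambda>r. nabla s r (v r)) p (w p) + nabla s p (lie_bracket M v w p)))"

definition bott ::
    "('a, 'n::finite) cmanifold \<Rightarrow> ('a \<Rightarrow> 'a tvec set) \<Rightarrow> ('a \<Rightarrow> 'a tvec) \<Rightarrow> ('a \<Rightarrow> 'a tvec) \<Rightarrow>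
      'a \<Rightarrow> 'a tvec set"
  where "bott M T v w p = normal_class T (lie_bracket M v w) p"

definition restricts_to_bott ::
    "('a, 'n::finite) cmanifold \<Rightarrow> ('a \<Rightarrow> 'a tvec set) \<Rightarrow> 'a set \<Rightarrow> 'a conn \<Rightarrow> bool"
  where "restricts_to_bott M T U nabla \<longleftrightarrow>
    (\<forall>V v w. openin (mtop M) V \<and> V \<subseteq> U \<and> tangent_field M T V v \<and> vector_field M V w \<longrightarrow>
       (\<forall>p\<in>V. nabla (normal_class T w) p (v p) = bott M T v w p))"

text \<open>The value on a local section \<open>s\<close> of the dual covariant derivative, in direction \<open>u\<close>, of a
  conormal form \<open>\<alpha>\<close>.\<close>

definition dual_derivative ::
    "'a conn \<Rightarrow> ('a \<Rightarrow> 'a covec) \<Rightarrow> 'a \<Rightarrow> 'a tvec \<Rightarrow> ('a \<Rightarrow> 'a tvec set) \<Rightarrow> complex"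
  where "dual_derivative nabla \<alpha> p u s =
    differential (\<lambda>r. pairing (\<alpha> r) (s r)) p u - pairing (\<alpha> p) (nabla s p u)"

text \<open>The dual derivative of \<open>\<alpha>\<close> equals \<open>B\<close> over \<open>U\<close>, where \<open>B p u\<close> is the conormal covector at
  \<open>p\<close> belonging to the direction \<open>u\<close>.\<close>

definition dual_connection_eq ::
    "('a, 'n::finite) cmanifold \<Rightarrow> ('a \<Rightarrow> 'a tvec set) \<Rightarrow> 'a set \<Rightarrow> 'a conn \<Rightarrow>
      ('a \<Rightarrow> 'a covec) \<Rightarrow> ('a \<Rightarrow> 'a tvec \<Rightarrow> 'a covec) \<Rightarrow> bool"
  where "dual_connection_eq M T U nabla \<alpha> B \<longleftrightarrow>
    (\<forall>V s. openin (mtop M) V \<and> V \<subseteq> U \<and> normal_section M T V s \<longrightarrow>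
       (\<forall>p\<in>V. \<forall>u\<in>tangent_space M p. dual_derivative nabla \<alpha> p u s = pairing (B p u) (s p)))"

definition parallel ::
    "('a, 'n::finite) cmanifold \<Rightarrow> ('a \<Rightarrow> 'a tvec set) \<Rightarrow> 'a set \<Rightarrow> 'a conn \<Rightarrow>
      ('a \<Rightarrow> 'a covec) \<Rightarrow> bool"
  where "parallel M T U nabla \<alpha> \<longleftrightarrow> dual_connection_eq M T U nabla \<alpha> (\<lambda>p u w. 0)"

definition closed_parallel_frame ::
    "('a, 'n::finite) cmanifold \<Rightarrow> nat \<Rightarrow> ('a \<Rightarrow> 'a tvec set) \<Rightarrow> 'a set \<Rightarrow> 'a conn \<Rightarrow>
      (nat \<Rightarrow> 'a \<Rightarrow> 'a covec) \<Rightarrow> bool"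
  where "closed_parallel_frame M q T U nabla \<theta> \<longleftrightarrow>
    conormal_frame M q T U \<theta> \<and>
    (\<forall>i<q. closed_form M U (\<theta> i) \<and> parallel M T U nabla (\<theta> i))"

end

theory Submission
  imports Defs "HOL-Complex_Analysis.Cauchy_Integral_Formula"
begin

text \<open>
  A tangent vector is encoded as a derivation of germs, so the first task is to compute with it.
  Partial derivatives of holomorphic functions are holomorphic by Cauchy's integral formula, and
  Hadamard's lemma then shows that a derivation is a combination of the coordinate derivations
  (\<open>tvec_expansion\<close>). Hence every tangent vector extends to a holomorphic vector field, and
  pointwise independent one-forms have dual holomorphic vector fields nearby
  (\<open>independent_dual_frame\<close>).

  Suppose first that \<open>T\<close> is the common kernel of \<open>df\<^sup>1, \<dots>, df\<^sup>q\<close>. A normal class \<open>[w]\<close> is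
  determined by the numbers \<open>w(f\<^sup>i)\<close>, so the differentials identify the normal bundle with the
  trivial bundle of rank \<open>q\<close>. The trivial connection, transported through this identification, is
  flat; its Leibniz rule and its curvature are read off from the coordinates of a section. It
  extends the Bott connection: if \<open>v\<close> is tangent to the foliation then \<open>v(f\<^sup>i) = 0\<close>, so
  \<open>[v,w](f\<^sup>i) = v(w(f\<^sup>i))\<close>. The \<open>df\<^sup>i\<close> are closed, and they are parallel by construction.

  Conversely, a closed holomorphic one-form on a ball in a chart is exact (\<open>closed_form_exact\<close>).
  Primitives of a frame of closed conormal forms are first integrals: a tangent vector outside
  \<open>T p\<close> is detected by some covector which annihilates \<open>T p\<close>, hence by a member of the frame.

  Both implications shrink the neighbourhood. They still give an equivalence over one and the same
  neighbourhood inside \<open>W\<close>: either some neighbourhood inside \<open>W\<close> has first integrals, and then a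
  smaller one has first integrals and a connection; or none has, and then \<open>W\<close> itself has neither.

  For the last part, write an arbitrary conormal frame as \<open>\<omega> = \<theta> g\<close>, where \<open>\<theta>\<close> is closed and
  parallel, and put \<open>\<eta> = g\<^sup>-\<^sup>1 dg\<close>. Then \<open>\<nabla>\<^sup>*\<omega> = \<theta> dg = \<omega> \<eta>\<close> and
  \<open>d\<omega> = - \<theta> \<and> dg = - \<omega> \<and> \<eta>\<close>, while \<open>d\<eta> = dg\<^sup>-\<^sup>1 \<and> dg = - \<eta> \<and> \<eta>\<close> because
  \<open>dg\<^sup>-\<^sup>1 g = - g\<^sup>-\<^sup>1 dg\<close>.
\<close>


section \<open>Holomorphic functions of several variables\<close>

definition cdiff_at :: "(complex ^ 'n \<Rightarrow> complex) \<Rightarrow> complex ^ 'n \<Rightarrow> bool"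
  where "cdiff_at f z \<longleftrightarrow> (\<exists>D. (f has_derivative D) (at z) \<and> (\<forall>c v. D (c *s v) = c * D v))"

lemma cholomorphic_on_iff: "cholomorphic_on f S \<longleftrightarrow> (\<forall>z\<in>S. cdiff_at f z)"
  by (simp add: cholomorphic_on_def cdiff_at_def)

text \<open>On differentiable functions this is the usual partial derivative; elsewhere its value is
  arbitrary.\<close>

definition pderiv_at :: "'n \<Rightarrow> (complex ^ 'n::finite \<Rightarrow> complex) \<Rightarrow> complex ^ 'n \<Rightarrow> complex"
  where "pderiv_at i f z = frechet_derivative f (at z) (axis i 1)"

lemma cdiff_at_has_derivative:
  fixes f :: "complex ^ 'n::finite \<Rightarrow> complex"
  assumes "cdiff_at f z"
  shows "(f has_derivative (\<lambda>v. \<Sum>i\<in>UNIV. v $ i * pderiv_at i f z)) (at z)"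
proof -
  obtain D where D: "(f has_derivative D) (at z)" and lin: "\<And>c v. D (c *s v) = c * D v"
    using assms by (auto simp: cdiff_at_def)
  have "D v = (\<Sum>i\<in>UNIV. v $ i * pderiv_at i f z)" for v
  proof -
    have "D v = D (\<Sum>i\<in>UNIV. v $ i *s axis i 1)"
      by (simp add: basis_expansion)
    also have "\<dots> = (\<Sum>i\<in>UNIV. D (v $ i *s axis i 1))"
      using has_derivative_linear[OF D] by (rule linear_sum)
    also have "\<dots> = (\<Sum>i\<in>UNIV. v $ i * pderiv_at i f z)"
      by (simp only: lin pderiv_at_def frechet_derivative_at[OF D, symmetric])
    finally show ?thesis .
  qed
  then have "D = (\<lambda>v. \<Sum>i\<in>UNIV. v $ i * pderiv_at i f z)" by auto
  then show ?thesis using D by simp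
qed

lemma cdiff_atI:
  fixes f :: "complex ^ 'n::finite \<Rightarrow> complex"
  assumes "(f has_derivative (\<lambda>v. \<Sum>i\<in>UNIV. v $ i * a i)) (at z)"
  shows "cdiff_at f z" and "pderiv_at i f z = a i"
proof -
  show "cdiff_at f z"
    unfolding cdiff_at_def
    by (rule exI, rule conjI, rule assms) (simp add: sum_distrib_left mult.assoc)
  show "pderiv_at i f z = a i"
    using frechet_derivative_at[OF assms, symmetric]
    by (simp add: pderiv_at_def axis_def if_distrib[of "\<lambda>x. x * _"] cong: if_cong)
qed

lemma pderiv_at_cong:
  assumes "open S" "z \<in> S" "\<And>w. w \<in> S \<Longrightarrow> f w = g w"
  shows "pderiv_at i f z = pderiv_at i g z"
proof -
  have "(f has_derivative D) (at z) \<longleftrightarrow> (g has_derivative D) (at z)" for D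
    using assms has_derivative_transform_within_open[of f D z UNIV S g]
      has_derivative_transform_within_open[of g D z UNIV S f] by auto
  then show ?thesis by (simp add: pderiv_at_def frechet_derivative_def)
qed

lemma cdiff_at_cong:
  assumes "open S" "z \<in> S" "\<And>w. w \<in> S \<Longrightarrow> f w = g w" "cdiff_at f z"
  shows "cdiff_at g z"
  using assms has_derivative_transform_within_open[of f _ z UNIV S g]
  unfolding cdiff_at_def by blast

lemma cdiff_at_isCont: "cdiff_at f z \<Longrightarrow> isCont f z"
  by (auto simp: cdiff_at_def intro: has_derivative_continuous)

lemma cdiff_at_const [intro, simp]: "cdiff_at (\<lambda>_. c) z"
  and pderiv_at_const [simp]: "pderiv_at i (\<lambda>_. c) z = 0"
proof -
  have "((\<lambda>_. c) has_derivative (\<lambda>v. \<Sum>i\<in>UNIV. v $ i * 0)) (at z)"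
    by (simp add: has_derivative_const)
  from cdiff_atI[OF this] show "cdiff_at (\<lambda>_. c) z" "pderiv_at i (\<lambda>_. c) z = 0" by auto
qed

lemma cdiff_at_add:
  assumes "cdiff_at f z" "cdiff_at g z"
  shows "cdiff_at (\<lambda>w. f w + g w) z"
    and "pderiv_at i (\<lambda>w. f w + g w) z = pderiv_at i f z + pderiv_at i g z"
proof -
  have *: "((\<lambda>w. f w + g w) has_derivative (\<lambda>v. \<Sum>i\<in>UNIV. v $ i * (pderiv_at i f z + pderiv_at i g z))) (at z)"
    by (rule derivative_eq_intros cdiff_at_has_derivative assms refl)+
      (simp add: algebra_simps sum.distrib)
  from cdiff_atI[OF *] show "cdiff_at (\<lambda>w. f w + g w) z"
    and "pderiv_at i (\<lambda>w. f w + g w) z = pderiv_at i f z + pderiv_at i g z" by auto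
qed

lemma cdiff_at_mult:
  assumes "cdiff_at f z" "cdiff_at g z"
  shows "cdiff_at (\<lambda>w. f w * g w) z"
    and "pderiv_at i (\<lambda>w. f w * g w) z = f z * pderiv_at i g z + g z * pderiv_at i f z"
proof -
  have *: "((\<lambda>w. f w * g w) has_derivative
      (\<lambda>v. \<Sum>i\<in>UNIV. v $ i * (f z * pderiv_at i g z + g z * pderiv_at i f z))) (at z)"
    by (rule derivative_eq_intros cdiff_at_has_derivative assms refl)+
      (simp add: algebra_simps sum.distrib sum_distrib_left)
  from cdiff_atI[OF *] show "cdiff_at (\<lambda>w. f w * g w) z"
    and "pderiv_at i (\<lambda>w. f w * g w) z = f z * pderiv_at i g z + g z * pderiv_at i f z" by auto
qed



lemma cdiff_at_inverse:
  fixes f :: "complex ^ 'n::finite \<Rightarrow> complex"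
  assumes "cdiff_at f z" "f z \<noteq> 0"
  shows "cdiff_at (\<lambda>w. inverse (f w)) z"
proof -
  have "((\<lambda>w. inverse (f w)) has_derivative
      (\<lambda>v. \<Sum>i\<in>UNIV. v $ i * (- inverse (f z) * pderiv_at i f z * inverse (f z)))) (at z)"
    by (rule derivative_eq_intros cdiff_at_has_derivative assms refl)+
      (simp add: algebra_simps sum_distrib_left sum_negf)
  then show ?thesis by (rule cdiff_atI)
qed

lemma has_derivative_vec_componentI:
  fixes g :: "'b::real_normed_vector \<Rightarrow> complex ^ 'm::finite"
  assumes "\<And>i. ((\<lambda>z. g z $ i) has_derivative (\<lambda>v. G v $ i)) (at z)"
  shows "(g has_derivative G) (at z)"
proof (subst has_derivative_componentwise_within, intro ballI)
  fix b :: "complex ^ 'm" assume "b \<in> Basis"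
  then obtain i c where b: "b = axis i c" by (auto simp: Basis_vec_def)
  show "((\<lambda>x. g x \<bullet> b) has_derivative (\<lambda>x. G x \<bullet> b)) (at z)"
    unfolding b inner_axis by (rule has_derivative_inner_left[OF assms])
qed

lemma cdiff_at_compose:
  fixes f :: "complex ^ 'n::finite \<Rightarrow> complex" and g :: "complex ^ 'm::finite \<Rightarrow> complex ^ 'n"
  assumes "cdiff_at f (g z)" "\<And>i. cdiff_at (\<lambda>w. g w $ i) z"
  shows "cdiff_at (\<lambda>w. f (g w)) z"
proof -
  have "(g has_derivative (\<lambda>v. \<chi> j. \<Sum>i\<in>UNIV. v $ i * pderiv_at i (\<lambda>w. g w $ j) z)) (at z)"
    by (rule has_derivative_vec_componentI) (simp add: cdiff_at_has_derivative assms)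
  from has_derivative_compose[OF this cdiff_at_has_derivative[OF assms(1)]]
  show ?thesis
    unfolding cdiff_at_def
    by - (rule exI, rule conjI, assumption, simp add: sum_distrib_left[symmetric] mult.assoc)
qed

lemma cdiff_at_component [simp, intro]: "cdiff_at (\<lambda>w::complex ^ 'n::finite. w $ i) z"
  and pderiv_at_component: "pderiv_at j (\<lambda>w::complex ^ 'n::finite. w $ i) z = (if i = j then 1 else 0)"
proof -
  have "((\<lambda>w::complex ^ 'n. w $ i) has_derivative (\<lambda>v. \<Sum>j\<in>UNIV. v $ j * (if i = j then 1 else 0))) (at z)"
    by (simp add: if_distrib[of "\<lambda>x. _ * x"] bounded_linear_imp_has_derivative
        bounded_linear_vec_nth cong: if_cong)
  from cdiff_atI[OF this] show "cdiff_at (\<lambda>w::complex ^ 'n::finite. w $ i) z"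
    and "pderiv_at j (\<lambda>w::complex ^ 'n::finite. w $ i) z = (if i = j then 1 else 0)" by auto
qed

lemma bounded_linear_axis: "bounded_linear (axis i :: complex \<Rightarrow> complex ^ 'n::finite)"
  unfolding linear_conv_bounded_linear[symmetric]
  by (rule linearI) (auto simp: vec_eq_iff axis_def)

lemma continuous_on_axis:
  fixes g :: "'b::topological_space \<Rightarrow> complex"
  shows "continuous_on S g \<Longrightarrow> continuous_on S (\<lambda>x. axis i (g x) :: complex ^ 'n::finite)"
  by (rule bounded_linear.continuous_on[OF bounded_linear_axis])

lemma norm_axis_complex: "norm (axis i c :: complex ^ 'n::finite) = norm c"
proof -
  have "(\<Sum>j\<in>UNIV. (cmod (axis i c $ j))\<^sup>2) = (\<Sum>j\<in>UNIV. if i = j then (cmod c)\<^sup>2 else 0)"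
    by (rule sum.cong) (auto simp: axis_def)
  then show ?thesis by (simp add: norm_vec_def L2_set_def)
qed

lemma slice_has_field_derivative:
  fixes f :: "complex ^ 'n::finite \<Rightarrow> complex"
  assumes "cdiff_at f (z + axis i c)"
  shows "((\<lambda>c. f (z + axis i c)) has_field_derivative pderiv_at i f (z + axis i c)) (at c)"
proof -
  have "((\<lambda>c. z + axis i c) has_derivative axis i) (at c)"
    using has_derivative_add[OF has_derivative_const bounded_linear_imp_has_derivative[OF bounded_linear_axis]]
    by simp
  from has_derivative_compose[OF this cdiff_at_has_derivative[OF assms]]
  have "((\<lambda>c. f (z + axis i c)) has_derivative
      (\<lambda>d. \<Sum>j\<in>UNIV. axis i d $ j * pderiv_at j f (z + axis i c))) (at c)" .
  moreover have "(\<Sum>j\<in>UNIV. axis i d $ j * pderiv_at j f (z + axis i c)) = pderiv_at i f (z + axis i c) * d" for d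
    by (simp add: axis_def if_distrib[of "\<lambda>x. x * _"] cong: if_cong)
  ultimately show ?thesis by (simp add: has_field_derivative_def)
qed

text \<open>Cauchy's formula for the first derivative, over the circle \<open>c = r exp(2\<pi>is)\<close> in the direction
  of the \<open>i\<close>-th axis. The factor \<open>2\<pi>i\<close> cancels against \<open>dc = 2\<pi>i c ds\<close>, which leaves one power of \<open>c\<close>
  in the denominator.\<close>

lemma pderiv_at_Cauchy:
  fixes f :: "complex ^ 'n::finite \<Rightarrow> complex"
  assumes "r > 0" and "cholomorphic_on f (cball z r)"
  shows "pderiv_at i f z =
    integral (cbox 0 1) (\<lambda>s. f (z + axis i (of_real r * exp (2 * of_real pi * \<i> * of_real s)))
      / (of_real r * exp (2 * of_real pi * \<i> * of_real s)))"
proof -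
  let ?g = "\<lambda>c. f (z + axis i c)"
  have fd: "(?g has_field_derivative pderiv_at i f (z + axis i c)) (at c)" if "c \<in> cball 0 r" for c
    using assms that by (intro slice_has_field_derivative) (auto simp: cholomorphic_on_iff dist_norm norm_axis_complex)
  have cont: "continuous_on (cball 0 r) ?g"
    using fd by (meson DERIV_isCont continuous_at_imp_continuous_on)
  have hol: "?g holomorphic_on ball 0 r"
    using fd by (meson ball_subset_cball has_field_derivative_at_within holomorphic_onI field_differentiable_def subsetD)
  have "(?g has_field_derivative (1 / (2 * of_real pi * \<i>) * contour_integral (circlepath 0 r) (\<lambda>u. ?g u / (u-0)^2))) (at 0)"
    by (rule Cauchy_derivative_integral_circlepath(2)[OF cont hol]) (use assms in auto)
  moreover have "(?g has_field_derivative pderiv_at i f z) (at 0)"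
  proof -
    have "axis i (0::complex) = (0 :: complex ^ 'n)" by simp
    show ?thesis
      using fd[of 0] assms(1) unfolding \<open>axis i 0 = 0\<close> by simp
  qed
  ultimately have "pderiv_at i f z = 1 / (2 * of_real pi * \<i>) * contour_integral (circlepath 0 r) (\<lambda>u. ?g u / u^2)"
    using DERIV_unique by force
  also have "\<dots> = integral {0..1} (\<lambda>s. 1 / (2 * of_real pi * \<i>) * (?g (circlepath 0 r s) / (circlepath 0 r s)^2
      * vector_derivative (circlepath 0 r) (at s)))"
    by (subst integral_mult_right) (simp add: contour_integral_integral)
  also have "\<dots> = integral (cbox 0 1) (\<lambda>s. f (z + axis i (of_real r * exp (2 * of_real pi * \<i> * of_real s)))
      / (of_real r * exp (2 * of_real pi * \<i> * of_real s)))"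
    using assms(1) unfolding cbox_interval vector_derivative_at[OF has_vector_derivative_circlepath]
    unfolding circlepath
    by (intro integral_cong) (simp add: field_simps power2_eq_square)
  finally show ?thesis .
qed

text \<open>The Cauchy integral depends continuously on the point and on the parameter, which turns joint
  continuity of the family into joint continuity of its partial derivatives. Circles of radius \<open>r\<close>
  about points of the ball of radius \<open>r\<close> stay in the ball of radius \<open>2r\<close>.\<close>

lemma continuous_on_pderiv_at:
  fixes f :: "complex ^ 'n::finite \<Rightarrow> real \<Rightarrow> complex"
  assumes "r > 0" and cont: "continuous_on (cball a (2 * r) \<times> {0..1}) (\<lambda>(z, t). f z t)"
    and hol: "\<And>t. t \<in> {0..1} \<Longrightarrow> cholomorphic_on (\<lambda>z. f z t) (cball a (2 * r))"
  shows "continuous_on (cball a r \<times> {0..1}) (\<lambda>(z, t). pderiv_at i (\<lambda>z. f z t) z)"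
proof -
  let ?e = "\<lambda>s. complex_of_real r * exp (2 * of_real pi * \<i> * of_real s)"
  have ne: "norm (?e s) = r" for s using assms(1) by (simp add: norm_mult)
  have sub: "z + axis i (?e s) \<in> cball a (2 * r)" if "z \<in> cball a r" for z s
    using that norm_triangle_ineq[of "z - a" "axis i (?e s)"] ne[of s]
    by (simp add: dist_norm norm_minus_commute norm_axis_complex algebra_simps)
  have sub': "cball z r \<subseteq> cball a (2 * r)" if "z \<in> cball a r" for z
    using that by (simp add: cball_subset_cball_iff dist_commute)
  have eq: "pderiv_at i (\<lambda>z. f z t) z = integral (cbox 0 1) (\<lambda>s. f (z + axis i (?e s)) t / ?e s)"
    if "z \<in> cball a r" "t \<in> {0..1}" for z t
    using that hol[OF that(2)] sub'[OF that(1)] assms(1)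
    by (intro pderiv_at_Cauchy) (auto simp: cholomorphic_on_iff)
  have "continuous_on (cball a r \<times> {0..1})
    (\<lambda>p. integral (cbox 0 1) (\<lambda>s. f (fst p + axis i (?e s)) (snd p) / ?e s))"
  proof (rule integral_continuous_on_param)
    have "continuous_on ((cball a r \<times> {0..1}) \<times> cbox 0 1)
        (\<lambda>x. f (fst (fst x) + axis i (?e (snd x))) (snd (fst x)))"
      by (rule continuous_on_compose2[OF cont, of _ "\<lambda>x. (fst (fst x) + axis i (?e (snd x)), snd (fst x))", simplified])
        (use sub in \<open>auto intro!: continuous_intros continuous_on_axis\<close>)
    then show "continuous_on ((cball a r \<times> {0..1}) \<times> cbox 0 1)
        (\<lambda>(p, s). f (fst p + axis i (?e s)) (snd p) / ?e s)"
      using assms(1) unfolding split_def by (auto intro!: continuous_intros)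
  qed
  then show ?thesis
    by (rule continuous_on_eq) (auto simp: eq)
qed

text \<open>Differentiation under the integral sign; the joint continuity of the derivative
  is supplied by \<open>continuous_on_pderiv_at\<close>.\<close>

lemma integral_family_derivative:
  fixes f :: "complex ^ 'n::finite \<Rightarrow> real \<Rightarrow> complex"
  assumes "open U" "z \<in> U" and cont: "continuous_on (U \<times> {0..1}) (\<lambda>(z, t). f z t)"
    and hol: "\<And>t. t \<in> {0..1} \<Longrightarrow> cholomorphic_on (\<lambda>z. f z t) U"
  shows "cdiff_at (\<lambda>z. integral {0..1} (f z)) z"
    and "((\<lambda>t. pderiv_at i (\<lambda>z. f z t) z) has_integral pderiv_at i (\<lambda>z. integral {0..1} (f z)) z) {0..1}"
    and "continuous_on {0..1} (\<lambda>t. pderiv_at i (\<lambda>z. f z t) z)"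
proof -
  obtain r' where "r' > 0" "cball z r' \<subseteq> U"
    using assms(1,2) by (meson open_contains_cball)
  define r where "r = r' / 2"
  have r: "r > 0" "cball z (2 * r) \<subseteq> U" using \<open>r' > 0\<close> \<open>cball z r' \<subseteq> U\<close> by (auto simp: r_def)
  define P where "P = (\<lambda>i w t. pderiv_at i (\<lambda>z. f z t) w)"
  have contP: "continuous_on (cball z r \<times> {0..1}) (\<lambda>(w, t). P i w t)" for i
    unfolding P_def
  proof (rule continuous_on_pderiv_at[OF r(1)])
    show "continuous_on (cball z (2 * r) \<times> {0..1}) (\<lambda>(z, t). f z t)"
      by (rule continuous_on_subset[OF cont]) (use r(2) in \<open>simp add: Sigma_mono\<close>)
    show "cholomorphic_on (\<lambda>z. f z t) (cball z (2 * r))" if "t \<in> {0..1}" for t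
      using hol[OF that] r(2) unfolding cholomorphic_on_iff by blast
  qed
  have rU: "cball z r \<subseteq> U"
    using r subset_cball[of r "2 * r" z] by simp
  define L where "L = (\<lambda>w t v. \<Sum>i\<in>UNIV. v $ i * P i w t)"
  have blL: "bounded_linear (L w t)" for w t
    unfolding L_def by (intro bounded_linear_sum bounded_linear_mult_const bounded_linear_vec_nth)
  have contP': "continuous_on {0..1} (P i z)" for i
    using continuous_on_compose2[OF contP[of i], of "{0..1}" "\<lambda>t. (z, t)"] r
    by (simp add: continuous_on_Pair image_subset_iff)
  have D: "((\<lambda>w. f w t) has_derivative L w t) (at w)" if "w \<in> U" "t \<in> {0..1}" for w t
    using hol[OF that(2)] that(1) cdiff_at_has_derivative[of "\<lambda>z. f z t" w]
    unfolding cholomorphic_on_iff L_def P_def by blast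
  have "((\<lambda>w. integral (cbox 0 1) (f w)) has_derivative integral (cbox 0 1) (\<lambda>t. Blinfun (L z t)))
      (at z within ball z r)"
  proof (rule leibniz_rule)
    show "((\<lambda>w. f w t) has_derivative blinfun_apply (Blinfun (L w t))) (at w within ball z r)"
      if "w \<in> ball z r" "t \<in> cbox 0 1" for w t
    proof -
      have "w \<in> U" using that rU ball_subset_cball by blast
      then show ?thesis
        using that(2) has_derivative_at_withinI[OF D[of w t]]
        unfolding bounded_linear_Blinfun_apply[OF blL] by simp
    qed
    show "f w integrable_on cbox 0 1" if "w \<in> ball z r" for w
    proof -
      have "w \<in> U" using that rU ball_subset_cball by blast
      then show ?thesis
        using continuous_on_compose2[OF cont, of "{0..1}" "\<lambda>t. (w, t)"]
        by (intro integrable_continuous) (simp add: continuous_on_Pair image_subset_iff)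
    qed
    show "continuous_on (ball z r \<times> cbox 0 1) (\<lambda>(w, t). Blinfun (L w t))"
    proof (rule continuous_on_blinfun_componentwise)
      fix b :: "complex ^ 'n" assume "b \<in> Basis"
      have "continuous_on (ball z r \<times> cbox 0 1) (\<lambda>p. P i (fst p) (snd p))" for i
        using contP[of i] unfolding split_def cbox_interval
        by (rule continuous_on_subset) (simp add: Sigma_mono ball_subset_cball)
      then show "continuous_on (ball z r \<times> cbox 0 1) (\<lambda>p. blinfun_apply (case p of (w, t) \<Rightarrow> Blinfun (L w t)) b)"
        unfolding split_def bounded_linear_Blinfun_apply[OF blL]
        unfolding L_def by (intro continuous_on_sum continuous_on_mult continuous_on_const)
    qed
    show "z \<in> ball z r" using r(1) by simp
  qed (rule convex_ball)
  then have "((\<lambda>w. integral (cbox 0 1) (f w)) has_derivative integral (cbox 0 1) (\<lambda>t. Blinfun (L z t))) (at z)"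
    using r by (simp add: at_within_open[of z "ball z r"])
  moreover have "blinfun_apply (integral (cbox 0 1) (\<lambda>t. Blinfun (L z t)))
      = (\<lambda>v. \<Sum>i\<in>UNIV. v $ i * integral {0..1} (P i z))"
  proof
    fix v
    have cB: "continuous_on {0..1} (\<lambda>t. Blinfun (L z t))"
    proof (rule continuous_on_blinfun_componentwise)
      fix b :: "complex ^ 'n" assume "b \<in> Basis"
      show "continuous_on {0..1} (\<lambda>t. blinfun_apply (Blinfun (L z t)) b)"
        unfolding bounded_linear_Blinfun_apply[OF blL]
        unfolding L_def by (intro continuous_on_sum continuous_on_mult continuous_on_const contP')
    qed
    have "blinfun_apply (integral (cbox 0 1) (\<lambda>t. Blinfun (L z t))) v
        = integral {0..1} (\<lambda>t. blinfun_apply (Blinfun (L z t)) v)"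
      using integrable_continuous_real[OF cB]
      by (simp add: blinfun_apply_integral)
    also have "\<dots> = integral {0..1} (\<lambda>t. \<Sum>i\<in>UNIV. v $ i * P i z t)"
      unfolding bounded_linear_Blinfun_apply[OF blL] by (simp add: L_def)
    also have "\<dots> = (\<Sum>i\<in>UNIV. v $ i * integral {0..1} (P i z))"
      using contP' by (subst integral_sum) (simp_all add: integrable_continuous_real continuous_on_mult_left)
    finally show "blinfun_apply (integral (cbox 0 1) (\<lambda>t. Blinfun (L z t))) v
      = (\<Sum>i\<in>UNIV. v $ i * integral {0..1} (P i z))" .
  qed
  ultimately have *: "((\<lambda>w. integral {0..1} (f w)) has_derivative (\<lambda>v. \<Sum>i\<in>UNIV. v $ i * integral {0..1} (P i z))) (at z)"
    unfolding cbox_interval by (simp only:)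
  show "cdiff_at (\<lambda>z. integral {0..1} (f z)) z" by (rule cdiff_atI(1)[OF *])
  show "continuous_on {0..1} (\<lambda>t. pderiv_at i (\<lambda>z. f z t) z)"
    using contP'[of i] by (simp add: P_def[abs_def])
  show "((\<lambda>t. pderiv_at i (\<lambda>z. f z t) z) has_integral pderiv_at i (\<lambda>z. integral {0..1} (f z)) z) {0..1}"
    unfolding cdiff_atI(2)[OF *]
    using integrable_integral[OF integrable_continuous_real[OF contP'[of i]]]
    by (simp add: P_def[abs_def])
qed

lemma cholomorphic_on_continuous_on: "cholomorphic_on f S \<Longrightarrow> continuous_on S f"
  by (auto simp: cholomorphic_on_iff intro!: continuous_at_imp_continuous_on cdiff_at_isCont)

text \<open>By Cauchy's formula the partial derivative is locally an integral of holomorphic functions.\<close>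

lemma cholomorphic_on_pderiv_at:
  fixes f :: "complex ^ 'n::finite \<Rightarrow> complex"
  assumes "open S" "cholomorphic_on f S"
  shows "cholomorphic_on (pderiv_at i f) S"
  unfolding cholomorphic_on_iff
proof
  fix a assume "a \<in> S"
  obtain r' where "r' > 0" "cball a r' \<subseteq> S"
    using assms(1) \<open>a \<in> S\<close> by (meson open_contains_cball)
  define r where "r = r' / 2"
  have r: "r > 0" "cball a (2 * r) \<subseteq> S" using \<open>r' > 0\<close> \<open>cball a r' \<subseteq> S\<close> by (auto simp: r_def)
  let ?e = "\<lambda>s. complex_of_real r * exp (2 * of_real pi * \<i> * of_real s)"
  have ne: "norm (?e s) = r" for s using r(1) by (simp add: norm_mult)
  have sub: "z + axis i (?e s) \<in> S" if "z \<in> ball a r" for z s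
    using that r norm_triangle_ineq[of "z - a" "axis i (?e s)"] ne[of s]
    by (auto simp: dist_norm norm_minus_commute norm_axis_complex algebra_simps intro!: subsetD[OF r(2)])
  have sub': "cball z r \<subseteq> S" if "z \<in> ball a r" for z
    by (rule order_trans[OF _ r(2)]) (use that in \<open>simp add: cball_subset_cball_iff dist_commute\<close>)
  have eq: "pderiv_at i f z = integral {0..1} (\<lambda>s. f (z + axis i (?e s)) / ?e s)"
    if "z \<in> ball a r" for z
    using pderiv_at_Cauchy[OF r(1), of f z i] sub'[OF that] assms(2)
    unfolding cbox_interval cholomorphic_on_iff by blast
  have "cdiff_at (\<lambda>z. integral {0..1} (\<lambda>s. f (z + axis i (?e s)) / ?e s)) a"
  proof (rule integral_family_derivative(1)[OF open_ball])
    show "a \<in> ball a r" using r by simp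
    have "continuous_on (ball a r \<times> {0..1}) (\<lambda>x. f (fst x + axis i (?e (snd x))))"
      by (rule continuous_on_compose2[OF cholomorphic_on_continuous_on[OF assms(2)]])
        (use sub in \<open>auto intro!: continuous_intros continuous_on_axis\<close>)
    then show "continuous_on (ball a r \<times> {0..1}) (\<lambda>(z, s). f (z + axis i (?e s)) / ?e s)"
      using r(1) unfolding split_def by (auto intro!: continuous_intros)
    show "cholomorphic_on (\<lambda>z. f (z + axis i (?e s)) / ?e s) (ball a r)" for s
      unfolding cholomorphic_on_iff divide_inverse
    proof
      fix z assume z: "z \<in> ball a r"
      have "cdiff_at (\<lambda>z. f (z + axis i (?e s))) z"
      proof (rule cdiff_at_compose[of f "\<lambda>z. z + axis i (?e s)"])
        show "cdiff_at f (z + axis i (?e s))"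
          using sub[OF z] assms(2) unfolding cholomorphic_on_iff by blast
        show "cdiff_at (\<lambda>w. (w + axis i (?e s)) $ j) z" for j
          unfolding vector_add_component by (rule cdiff_at_add(1)[OF cdiff_at_component cdiff_at_const])
      qed
      then show "cdiff_at (\<lambda>z. f (z + axis i (?e s)) * inverse (?e s)) z"
        by (rule cdiff_at_mult(1)[OF _ cdiff_at_const])
    qed
  qed
  then show "cdiff_at (pderiv_at i f) a"
    by (rule cdiff_at_cong[OF open_ball[of a r], rotated 2])
      (use r eq in \<open>simp_all del: mem_ball add: centre_in_ball\<close>)
qed

lemma segment_in_ball: 
  fixes a z :: "complex ^ 'n::finite"
  assumes "z \<in> ball a r" "t \<in> {0..1}"
  shows "a + t *\<^sub>R (z - a) \<in> ball a r"
proof -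
  have "t * norm (z - a) \<le> norm (z - a)" using assms by (simp add: mult_left_le_one_le)
  then show ?thesis using assms by (simp add: dist_norm norm_minus_commute)
qed

lemma ray_has_vector_derivative:
  fixes f :: "complex ^ 'n::finite \<Rightarrow> complex"
  assumes "cdiff_at f (a + t *\<^sub>R h)"
  shows "((\<lambda>t. f (a + t *\<^sub>R h)) has_vector_derivative (\<Sum>i\<in>UNIV. h $ i * pderiv_at i f (a + t *\<^sub>R h)))
    (at t within S)"
proof -
  have "((\<lambda>t. a + t *\<^sub>R h) has_derivative (\<lambda>s. s *\<^sub>R h)) (at t)"
    by (auto intro!: derivative_eq_intros)
  from has_derivative_compose[OF this cdiff_at_has_derivative[OF assms]]
  have "((\<lambda>t. f (a + t *\<^sub>R h)) has_derivative (\<lambda>s. s *\<^sub>R (\<Sum>i\<in>UNIV. h $ i * pderiv_at i f (a + t *\<^sub>R h)))) (at t)"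
    by (simp add: scaleR_sum_right)
  then show ?thesis by (simp add: has_vector_derivative_def has_derivative_at_withinI)
qed

lemma cdiff_at_ray:
  fixes f :: "complex ^ 'n::finite \<Rightarrow> complex"
  assumes "cdiff_at f (a + t *\<^sub>R (z - a))"
  shows "cdiff_at (\<lambda>z. f (a + t *\<^sub>R (z - a))) z"
    and "pderiv_at i (\<lambda>z. f (a + t *\<^sub>R (z - a))) z = t *\<^sub>R pderiv_at i f (a + t *\<^sub>R (z - a))"
proof -
  have "((\<lambda>z. a + t *\<^sub>R (z - a)) has_derivative (\<lambda>v. t *\<^sub>R v)) (at z)"
    by (auto intro!: derivative_eq_intros)
  from has_derivative_compose[OF this cdiff_at_has_derivative[OF assms]]
  have *: "((\<lambda>z. f (a + t *\<^sub>R (z - a))) has_derivative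
      (\<lambda>v. \<Sum>i\<in>UNIV. v $ i * (t *\<^sub>R pderiv_at i f (a + t *\<^sub>R (z - a))))) (at z)"
    by simp
  from cdiff_atI[OF *] show "cdiff_at (\<lambda>z. f (a + t *\<^sub>R (z - a))) z"
    and "pderiv_at i (\<lambda>z. f (a + t *\<^sub>R (z - a))) z = t *\<^sub>R pderiv_at i f (a + t *\<^sub>R (z - a))" by auto
qed

lemma continuous_on_ray:
  fixes f :: "complex ^ 'n::finite \<Rightarrow> complex"
  assumes "cholomorphic_on f (ball a r)"
  shows "continuous_on (ball a r \<times> {0..1}) (\<lambda>x. f (a + snd x *\<^sub>R (fst x - a)))"
  by (rule continuous_on_compose2[OF cholomorphic_on_continuous_on[OF assms]])
    (auto intro!: continuous_intros segment_in_ball simp del: mem_ball)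

text \<open>Hadamard's lemma: the coefficients \<open>g i\<close> are the means of the partial derivatives of \<open>f\<close> over the
  segment from \<open>a\<close> to \<open>z\<close>.\<close>

lemma hadamard:
  fixes f :: "complex ^ 'n::finite \<Rightarrow> complex"
  assumes "cholomorphic_on f (ball a r)" "r > 0"
  obtains g where "\<And>i. cholomorphic_on (g i) (ball a r)"
    "\<And>z. z \<in> ball a r \<Longrightarrow> f z = f a + (\<Sum>i\<in>UNIV. (z $ i - a $ i) * g i z)"
    "\<And>i. g i a = pderiv_at i f a"
proof
  let ?g = "\<lambda>i z. integral {0..1} (\<lambda>t. pderiv_at i f (a + t *\<^sub>R (z - a)))"
  have hol: "cholomorphic_on (pderiv_at i f) (ball a r)" for i
    by (rule cholomorphic_on_pderiv_at[OF open_ball assms(1)])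
  show "cholomorphic_on (?g i) (ball a r)" for i
    unfolding cholomorphic_on_iff
  proof
    fix z assume "z \<in> ball a r"
    show "cdiff_at (?g i) z"
    proof (rule integral_family_derivative(1)[OF open_ball \<open>z \<in> ball a r\<close>])
      show "continuous_on (ball a r \<times> {0..1}) (\<lambda>(z, t). pderiv_at i f (a + t *\<^sub>R (z - a)))"
        using continuous_on_ray[OF hol[of i]] by (simp add: split_def)
      show "cholomorphic_on (\<lambda>z. pderiv_at i f (a + t *\<^sub>R (z - a))) (ball a r)" if "t \<in> {0..1}" for t
        using hol[of i] segment_in_ball[OF _ that] unfolding cholomorphic_on_iff
        by (blast intro: cdiff_at_ray(1))
    qed
  qed
  show "f z = f a + (\<Sum>i\<in>UNIV. (z $ i - a $ i) * ?g i z)" if z: "z \<in> ball a r" for z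
  proof -
    have int: "(\<lambda>t. pderiv_at i f (a + t *\<^sub>R (z - a))) integrable_on {0..1}" for i
      using continuous_on_compose2[OF continuous_on_ray[OF hol[of i]], of "{0..1}" "\<lambda>t. (z, t)"] z
      by (intro integrable_continuous_real) (simp add: continuous_on_Pair image_subset_iff)
    have "((\<lambda>t. \<Sum>i\<in>UNIV. (z - a) $ i * pderiv_at i f (a + t *\<^sub>R (z - a))) has_integral
        f (a + 1 *\<^sub>R (z - a)) - f (a + 0 *\<^sub>R (z - a))) {0..1}"
      by (rule fundamental_theorem_of_calculus)
        (use assms segment_in_ball[OF z] in \<open>simp_all add: cholomorphic_on_iff ray_has_vector_derivative
          del: vector_minus_component\<close>)
    then have "f z - f a = integral {0..1} (\<lambda>t. \<Sum>i\<in>UNIV. (z $ i - a $ i) * pderiv_at i f (a + t *\<^sub>R (z - a)))"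
      by (simp add: integral_unique)
    also have "\<dots> = (\<Sum>i\<in>UNIV. (z $ i - a $ i) * ?g i z)"
      using int by (subst integral_sum) (simp_all add: integrable_on_mult_right)
    finally show ?thesis by (simp add: algebra_simps)
  qed
  show "?g i a = pderiv_at i f a" for i by simp
qed

text \<open>The Poincare lemma on a ball. The primitive is the integral of the form along the segment from the
  centre; by closedness the \<open>j\<close>-th derivative of its integrand is \<open>d/dt (t b\<^sub>j(a + t(z - a)))\<close>.\<close>

lemma poincare:
  fixes b :: "'n::finite \<Rightarrow> complex ^ 'n \<Rightarrow> complex"
  assumes hol: "\<And>i. cholomorphic_on (b i) (ball a r)"
    and closed: "\<And>i j z. z \<in> ball a r \<Longrightarrow> pderiv_at i (b j) z = pderiv_at j (b i) z"
  obtains f where "cholomorphic_on f (ball a r)" "\<And>i z. z \<in> ball a r \<Longrightarrow> pderiv_at i f z = b i z"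
proof
  let ?h = "\<lambda>z t. \<Sum>i\<in>UNIV. (z $ i - a $ i) * b i (a + t *\<^sub>R (z - a))"
  let ?f = "\<lambda>z. integral {0..1} (?h z)"
  have cd: "cdiff_at (b i) (a + t *\<^sub>R (z - a))" if "z \<in> ball a r" "t \<in> {0..1}" for i z t
    using hol segment_in_ball[OF that] by (auto simp: cholomorphic_on_iff)
  have D: "((\<lambda>z. ?h z t) has_derivative (\<lambda>v. \<Sum>j\<in>UNIV. v $ j *
      (b j (a + t *\<^sub>R (z - a)) + (\<Sum>i\<in>UNIV. (z $ i - a $ i) * (t *\<^sub>R pderiv_at j (b i) (a + t *\<^sub>R (z - a))))))) (at z)"
    if "z \<in> ball a r" "t \<in> {0..1}" for z t
  proof -
    have 1: "((\<lambda>z. b i (a + t *\<^sub>R (z - a))) has_derivative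
        (\<lambda>v. \<Sum>j\<in>UNIV. v $ j * (t *\<^sub>R pderiv_at j (b i) (a + t *\<^sub>R (z - a))))) (at z)" for i
      using cdiff_at_has_derivative[OF cdiff_at_ray(1)[OF cd[OF that]]] cdiff_at_ray(2)[OF cd[OF that]]
      by simp
    have 2: "((\<lambda>z. (z $ i - a $ i)) has_derivative (\<lambda>v. v $ i)) (at z)" for i
      by (auto intro!: derivative_eq_intros bounded_linear_imp_has_derivative bounded_linear_vec_nth)
    have 3: "((\<lambda>z. ?h z t) has_derivative (\<lambda>v. \<Sum>i\<in>UNIV. (z $ i - a $ i) *
       (\<Sum>j\<in>UNIV. v $ j * (t *\<^sub>R pderiv_at j (b i) (a + t *\<^sub>R (z - a)))) + v $ i * b i (a + t *\<^sub>R (z - a)))) (at z)"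
      by (intro has_derivative_sum has_derivative_mult 1 2)
    have 4: "(\<Sum>i\<in>UNIV. (z $ i - a $ i) *
       (\<Sum>j\<in>UNIV. v $ j * (t *\<^sub>R pderiv_at j (b i) (a + t *\<^sub>R (z - a)))) + v $ i * b i (a + t *\<^sub>R (z - a)))
       = (\<Sum>j\<in>UNIV. v $ j *
      (b j (a + t *\<^sub>R (z - a)) + (\<Sum>i\<in>UNIV. (z $ i - a $ i) * (t *\<^sub>R pderiv_at j (b i) (a + t *\<^sub>R (z - a))))))" for v
      unfolding sum.distrib distrib_left sum_distrib_left
      by (subst sum.swap) (simp add: algebra_simps)
    show ?thesis using 3 unfolding 4 .
  qed
  have cont: "continuous_on (ball a r \<times> {0..1}) (\<lambda>(z, t). ?h z t)"
    unfolding split_def by (intro continuous_on_sum continuous_on_mult continuous_on_ray[OF hol] continuous_intros)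
  have holh: "cholomorphic_on (\<lambda>z. ?h z t) (ball a r)" if "t \<in> {0..1}" for t
    using cdiff_atI(1)[OF D[OF _ that]] by (auto simp: cholomorphic_on_iff)
  note L = integral_family_derivative[OF open_ball _ cont holh]
  show "cholomorphic_on ?f (ball a r)"
    using L(1) by (auto simp: cholomorphic_on_iff)
  show "pderiv_at j ?f z = b j z" if z: "z \<in> ball a r" for j z
  proof -
    have "((\<lambda>t. b j (a + t *\<^sub>R (z - a)) + (\<Sum>i\<in>UNIV. (z $ i - a $ i) * (t *\<^sub>R pderiv_at j (b i) (a + t *\<^sub>R (z - a)))))
        has_integral (1 *\<^sub>R b j (a + 1 *\<^sub>R (z - a)) - 0 *\<^sub>R b j (a + 0 *\<^sub>R (z - a)))) {0..1}"
    proof (rule fundamental_theorem_of_calculus)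
      fix t :: real assume t: "t \<in> {0..1}"
      have "((\<lambda>t. t *\<^sub>R b j (a + t *\<^sub>R (z - a))) has_vector_derivative
        t *\<^sub>R (\<Sum>i\<in>UNIV. (z - a) $ i * pderiv_at i (b j) (a + t *\<^sub>R (z - a))) + 1 *\<^sub>R b j (a + t *\<^sub>R (z - a)))
        (at t within {0..1})"
        by (intro has_vector_derivative_scaleR ray_has_vector_derivative cd z t DERIV_ident)
      moreover have "t *\<^sub>R (\<Sum>i\<in>UNIV. (z - a) $ i * pderiv_at i (b j) (a + t *\<^sub>R (z - a))) + 1 *\<^sub>R b j (a + t *\<^sub>R (z - a))
        = b j (a + t *\<^sub>R (z - a)) + (\<Sum>i\<in>UNIV. (z $ i - a $ i) * (t *\<^sub>R pderiv_at j (b i) (a + t *\<^sub>R (z - a))))"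
        using closed[OF segment_in_ball[OF z t], of _ j] by (simp add: scaleR_sum_right add.commute)
      ultimately show "((\<lambda>t. t *\<^sub>R b j (a + t *\<^sub>R (z - a))) has_vector_derivative
        b j (a + t *\<^sub>R (z - a)) + (\<Sum>i\<in>UNIV. (z $ i - a $ i) * (t *\<^sub>R pderiv_at j (b i) (a + t *\<^sub>R (z - a)))))
        (at t within {0..1})" by (simp only:)
    qed simp
    then have "((\<lambda>t. pderiv_at j (\<lambda>z. ?h z t) z) has_integral
        (1 *\<^sub>R b j (a + 1 *\<^sub>R (z - a)) - 0 *\<^sub>R b j (a + 0 *\<^sub>R (z - a)))) {0..1}"
      by (rule has_integral_eq[rotated]) (rule cdiff_atI(2)[OF D[OF z], symmetric])
    from has_integral_unique[OF L(2)[OF z] this] show ?thesis by simp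
  qed
qed


section \<open>Holomorphic functions on a complex manifold\<close>

locale complex_mfd =
  fixes M :: "('a, 'n::finite) cmanifold"
  assumes manifold: "complex_manifold M"
begin

lemma chart:
  assumes "(D, \<phi>) \<in> atlas M"
  shows chart_openin: "openin (mtop M) D" and chart_image_open: "open (\<phi> ` D)"
    and chart_homeo: "homeomorphic_map (subtopology (mtop M) D) (top_of_set (\<phi> ` D)) \<phi>"
    and chart_inj: "inj_on \<phi> D"
proof -
  have "\<forall>(D, \<phi>) \<in> atlas M. openin (mtop M) D \<and> open (\<phi> ` D) \<and>
       homeomorphic_map (subtopology (mtop M) D) (top_of_set (\<phi> ` D)) \<phi>"
    using manifold unfolding complex_manifold_def by (elim conjE) assumption
  from bspec[OF this assms] show "openin (mtop M) D" "open (\<phi> ` D)"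
    and h: "homeomorphic_map (subtopology (mtop M) D) (top_of_set (\<phi> ` D)) \<phi>"
    by simp_all
  then have "topspace (subtopology (mtop M) D) = D"
    by (intro topspace_subtopology_subset openin_subset)
  then show "inj_on \<phi> D" using homeomorphic_imp_injective_map[OF h] by simp
qed

lemma chart_inv [simp]: "(D, \<phi>) \<in> atlas M \<Longrightarrow> r \<in> D \<Longrightarrow> inv_into D \<phi> (\<phi> r) = r"
  using chart_inj by simp

lemma chart_image_open_sub:
  assumes "(D, \<phi>) \<in> atlas M" "openin (mtop M) U"
  shows "open (\<phi> ` (D \<inter> U))"
proof -
  have "openin (subtopology (mtop M) D) (D \<inter> U)"
    using assms(2) openin_subtopology_Int2 by blast
  then have "openin (top_of_set (\<phi> ` D)) (\<phi> ` (D \<inter> U))"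
    using homeomorphic_imp_open_map[OF chart_homeo[OF assms(1)]] by (auto simp: open_map_def)
  then show ?thesis using chart_image_open[OF assms(1)] openin_open_trans by blast
qed

lemma chart_preimage_openin:
  assumes "(D, \<phi>) \<in> atlas M" "open S"
  shows "openin (mtop M) {r \<in> D. \<phi> r \<in> S}"
proof -
  have top: "topspace (subtopology (mtop M) D) = D"
    using chart_openin[OF assms(1)] by (intro topspace_subtopology_subset openin_subset)
  have "openin (top_of_set (\<phi> ` D)) (\<phi> ` D \<inter> S)" using assms(2) by auto
  then have "openin (subtopology (mtop M) D) {r \<in> topspace (subtopology (mtop M) D). \<phi> r \<in> \<phi> ` D \<inter> S}"
    using homeomorphic_imp_continuous_map[OF chart_homeo[OF assms(1)]] openin_continuous_map_preimage by blast
  moreover have "{r \<in> topspace (subtopology (mtop M) D). \<phi> r \<in> \<phi> ` D \<inter> S} = {r \<in> D. \<phi> r \<in> S}"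
    unfolding top by auto
  ultimately show ?thesis using openin_trans_full[OF _ chart_openin[OF assms(1)]] by simp
qed

lemma chart_at:
  assumes "p \<in> topspace (mtop M)"
  obtains D \<phi> where "(D, \<phi>) \<in> atlas M" "p \<in> D"
proof -
  have "\<Union>(fst ` atlas M) = topspace (mtop M)"
    using manifold unfolding complex_manifold_def by (elim conjE) assumption
  with assms have "p \<in> \<Union>(fst ` atlas M)" by simp
  then show ?thesis using that by force
qed

text \<open>Holomorphy over a set is a condition on each of its points separately, which makes gluing and
  restriction immediate.\<close>

definition hol_at :: "'a \<Rightarrow> ('a \<Rightarrow> complex) \<Rightarrow> bool"
  where "hol_at p f \<longleftrightarrow> (\<forall>(D, \<phi>) \<in> atlas M. p \<in> D \<longrightarrow> cdiff_at (\<lambda>z. f (inv_into D \<phi> z)) (\<phi> p))"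

lemma hol_fun_iff: "hol_fun M U f \<longleftrightarrow> (\<forall>p\<in>U. hol_at p f)"
  unfolding hol_fun_def hol_at_def cholomorphic_on_iff by fast

lemma hol_at_const: "hol_at p (\<lambda>_. c)"
  by (simp add: hol_at_def split_beta)

lemma hol_at_add: "hol_at p f \<Longrightarrow> hol_at p g \<Longrightarrow> hol_at p (\<lambda>r. f r + g r)"
  unfolding hol_at_def by (auto intro!: cdiff_at_add(1))

lemma hol_at_mult: "hol_at p f \<Longrightarrow> hol_at p g \<Longrightarrow> hol_at p (\<lambda>r. f r * g r)"
  unfolding hol_at_def by (auto intro!: cdiff_at_mult(1))

lemma hol_at_sum: "(\<And>j. j \<in> J \<Longrightarrow> hol_at p (f j)) \<Longrightarrow> hol_at p (\<lambda>r. \<Sum>j\<in>J. f j r)"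
  by (induction J rule: infinite_finite_induct) (simp_all add: hol_at_const hol_at_add)

lemma hol_at_minus: "hol_at p f \<Longrightarrow> hol_at p (\<lambda>r. - f r)"
  using hol_at_mult[OF hol_at_const[of p "-1"], of f] by simp

lemma hol_at_diff: "hol_at p f \<Longrightarrow> hol_at p g \<Longrightarrow> hol_at p (\<lambda>r. f r - g r)"
  using hol_at_add[of p f "\<lambda>r. - g r"] hol_at_minus[of p g] by simp

lemma hol_at_inverse:
  assumes "hol_at p f" "f p \<noteq> 0"
  shows "hol_at p (\<lambda>r. inverse (f r))"
  unfolding hol_at_def
proof (safe)
  fix D \<phi> assume "(D, \<phi>) \<in> atlas M" "p \<in> D"
  then show "cdiff_at (\<lambda>z. inverse (f (inv_into D \<phi> z))) (\<phi> p)"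
    using assms by (intro cdiff_at_inverse) (auto simp: hol_at_def)
qed



lemma hol_at_cong:
  assumes "openin (mtop M) U" "p \<in> U" "\<And>r. r \<in> U \<Longrightarrow> f r = g r" "hol_at p f"
  shows "hol_at p g"
  unfolding hol_at_def
proof (safe)
  fix D \<phi> assume c: "(D, \<phi>) \<in> atlas M" "p \<in> D"
  show "cdiff_at (\<lambda>z. g (inv_into D \<phi> z)) (\<phi> p)"
  proof (rule cdiff_at_cong[OF chart_image_open_sub[OF c(1) assms(1)]])
    show "\<phi> p \<in> \<phi> ` (D \<inter> U)" using c assms by blast
    show "cdiff_at (\<lambda>z. f (inv_into D \<phi> z)) (\<phi> p)" using assms(4) c by (auto simp: hol_at_def)
  qed (use c assms(3) in auto)
qed

text \<open>One chart suffices, because the transition maps are holomorphic.\<close>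

lemma hol_at_chartI:
  assumes c: "(D, \<phi>) \<in> atlas M" "p \<in> D" and cd: "cdiff_at (\<lambda>z. f (inv_into D \<phi> z)) (\<phi> p)"
  shows "hol_at p f"
  unfolding hol_at_def
proof (safe)
  fix E \<psi> assume e: "(E, \<psi>) \<in> atlas M" "p \<in> E"
  let ?t = "\<lambda>z. \<phi> (inv_into E \<psi> z)"
  have "\<forall>(D, \<phi>) \<in> atlas M. \<forall>(E, \<psi>) \<in> atlas M. \<forall>i.
       cholomorphic_on (\<lambda>z. \<psi> (inv_into D \<phi> z) $ i) (\<phi> ` (D \<inter> E))"
    using manifold unfolding complex_manifold_def by (elim conjE) assumption
  from bspec[OF this e(1)] have tr: "cholomorphic_on (\<lambda>z. ?t z $ i) (\<psi> ` (E \<inter> D))" for i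
    using c(1) by auto
  have "cdiff_at (\<lambda>z. f (inv_into D \<phi> (?t z))) (\<psi> p)"
  proof (rule cdiff_at_compose[of "\<lambda>z. f (inv_into D \<phi> z)" ?t])
    show "cdiff_at (\<lambda>z. f (inv_into D \<phi> z)) (?t (\<psi> p))" using cd e by simp
    show "cdiff_at (\<lambda>w. ?t w $ i) (\<psi> p)" for i
      using tr[of i] c e by (auto simp: cholomorphic_on_iff)
  qed
  then show "cdiff_at (\<lambda>z. f (inv_into E \<psi> z)) (\<psi> p)"
    by (rule cdiff_at_cong[OF chart_image_open_sub[OF e(1) chart_openin[OF c(1)]], rotated 2])
      (use c e in auto)
qed

lemma hol_fun_chart:
  assumes "(D, \<phi>) \<in> atlas M" "U \<subseteq> D" "hol_fun M U f"
  shows "cholomorphic_on (\<lambda>z. f (inv_into D \<phi> z)) (\<phi> ` U)"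
  using assms unfolding hol_fun_iff hol_at_def cholomorphic_on_iff by fast

lemma hol_near_iff: "hol_near M p f \<longleftrightarrow> (\<exists>U. openin (mtop M) U \<and> p \<in> U \<and> (\<forall>r\<in>U. hol_at r f))"
  unfolding hol_near_def hol_fun_iff ..

lemma hol_nearI: "openin (mtop M) U \<Longrightarrow> p \<in> U \<Longrightarrow> hol_fun M U f \<Longrightarrow> hol_near M p f"
  unfolding hol_near_def by blast

lemma hol_near_at: "hol_near M p f \<Longrightarrow> hol_at p f"
  unfolding hol_near_iff by blast

lemma hol_near_cong:
  assumes "openin (mtop M) U" "p \<in> U" "\<And>r. r \<in> U \<Longrightarrow> f r = g r" "hol_near M p f"
  shows "hol_near M p g"
proof -
  obtain V where V: "openin (mtop M) V" "p \<in> V" "\<forall>r\<in>V. hol_at r f"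
    using assms(4) unfolding hol_near_iff by blast
  have "\<forall>r\<in>U \<inter> V. hol_at r g"
    using V assms hol_at_cong[of U] by blast
  then show ?thesis using V assms openin_Int unfolding hol_near_iff by blast
qed

lemma hol_near_add:
  assumes "hol_near M p f" "hol_near M p g" shows "hol_near M p (\<lambda>r. f r + g r)"
proof -
  from assms obtain U V where "openin (mtop M) U" "p \<in> U" "\<forall>r\<in>U. hol_at r f"
    "openin (mtop M) V" "p \<in> V" "\<forall>r\<in>V. hol_at r g" unfolding hol_near_iff by blast
  then show ?thesis unfolding hol_near_iff
    by (intro exI[of _ "U \<inter> V"]) (simp add: openin_Int hol_at_add)
qed

lemma hol_near_mult:
  assumes "hol_near M p f" "hol_near M p g" shows "hol_near M p (\<lambda>r. f r * g r)"
proof -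
  from assms obtain U V where "openin (mtop M) U" "p \<in> U" "\<forall>r\<in>U. hol_at r f"
    "openin (mtop M) V" "p \<in> V" "\<forall>r\<in>V. hol_at r g" unfolding hol_near_iff by blast
  then show ?thesis unfolding hol_near_iff
    by (intro exI[of _ "U \<inter> V"]) (simp add: openin_Int hol_at_mult)
qed

lemma hol_near_const: "p \<in> topspace (mtop M) \<Longrightarrow> hol_near M p (\<lambda>_. c)"
  unfolding hol_near_iff using hol_at_const by blast

lemma hol_near_sum:
  "p \<in> topspace (mtop M) \<Longrightarrow> (\<And>j. j \<in> J \<Longrightarrow> hol_near M p (f j)) \<Longrightarrow> hol_near M p (\<lambda>r. \<Sum>j\<in>J. f j r)"
  by (induction J rule: infinite_finite_induct) (simp_all add: hol_near_const hol_near_add)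

lemma hol_near_minus: "p \<in> topspace (mtop M) \<Longrightarrow> hol_near M p f \<Longrightarrow> hol_near M p (\<lambda>r. - f r)"
  using hol_near_mult[OF hol_near_const[of p "-1"], of f] by simp

lemma hol_near_topspace: "hol_near M p f \<Longrightarrow> p \<in> topspace (mtop M)"
  unfolding hol_near_iff using openin_subset by blast

lemma hol_near_diff: "hol_near M p f \<Longrightarrow> hol_near M p g \<Longrightarrow> hol_near M p (\<lambda>r. f r - g r)"
  using hol_near_add[of p f "\<lambda>r. - g r"] hol_near_minus[of p g] hol_near_topspace by simp

lemma nonzero_near:
  assumes "openin (mtop M) U" "p \<in> U" "hol_fun M U f" "f p \<noteq> 0"
  obtains V where "openin (mtop M) V" "p \<in> V" "V \<subseteq> U" "\<forall>r\<in>V. f r \<noteq> 0"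
proof -
  have "p \<in> topspace (mtop M)" using assms openin_subset by blast
  then obtain D \<phi> where c: "(D, \<phi>) \<in> atlas M" "p \<in> D" by (rule chart_at)
  let ?F = "\<lambda>z. f (inv_into D \<phi> z)" and ?S = "\<phi> ` (D \<inter> U)"
  have "cholomorphic_on ?F ?S"
    using assms(3) c unfolding hol_fun_def by blast
  then have "open {z \<in> ?S. ?F z \<in> - {0}}"
    using continuous_open_preimage[OF cholomorphic_on_continuous_on chart_image_open_sub[OF c(1) assms(1)], of ?F "- {0}"]
    by (simp add: vimage_def Int_def open_Compl)
  from chart_preimage_openin[OF c(1) this]
  have "openin (mtop M) {r \<in> D. \<phi> r \<in> {z \<in> ?S. ?F z \<in> - {0}}}" .
  moreover have "{r \<in> D. \<phi> r \<in> {z \<in> ?S. ?F z \<in> - {0}}} = {r \<in> D \<inter> U. f r \<noteq> 0}"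
  proof -
    have "\<phi> r \<in> ?S \<longleftrightarrow> r \<in> U" if "r \<in> D" for r
      using inj_on_image_mem_iff[OF chart_inj[OF c(1)] that Int_lower1, of U] that by simp
    then have "r \<in> D \<and> \<phi> r \<in> ?S \<and> ?F (\<phi> r) \<noteq> 0 \<longleftrightarrow> r \<in> D \<inter> U \<and> f r \<noteq> 0" for r
      using chart_inv[OF c(1), of r] by (cases "r \<in> D") simp_all
    then show ?thesis unfolding mem_Collect_eq Compl_iff singleton_iff by (rule Collect_cong)
  qed
  ultimately have "openin (mtop M) {r \<in> D \<inter> U. f r \<noteq> 0}" by (simp only:)
  then show ?thesis by (rule that) (use assms c in blast)+
qed


section \<open>Tangent vectors\<close>

lemma sum_fun_apply: "(\<Sum>i\<in>I. F i) x = (\<Sum>i\<in>I. F i x)" for F :: "'i \<Rightarrow> 'b \<Rightarrow> 'c::comm_monoid_add"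
  by (induction I rule: infinite_finite_induct) (simp_all add: zero_fun_apply plus_fun_apply)

lemma tscale_apply [simp]: "tscale c v f = c * v f"
  by (simp add: tscale_def)

lemma tvec_add:
  "u \<in> tangent_space M p \<Longrightarrow> hol_near M p f \<Longrightarrow> hol_near M p g \<Longrightarrow> u (\<lambda>r. f r + g r) = u f + u g"
  unfolding tangent_space_def by blast

lemma tvec_mult:
  "u \<in> tangent_space M p \<Longrightarrow> hol_near M p f \<Longrightarrow> hol_near M p g \<Longrightarrow>
    u (\<lambda>r. f r * g r) = f p * u g + g p * u f"
  unfolding tangent_space_def by blast

lemma tvec_zero: "u \<in> tangent_space M p \<Longrightarrow> \<not> hol_near M p f \<Longrightarrow> u f = 0"
  unfolding tangent_space_def by blast

lemma tvec_cmult: "u \<in> tangent_space M p \<Longrightarrow> hol_near M p f \<Longrightarrow> u (\<lambda>r. c * f r) = c * u f"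
  unfolding tangent_space_def by blast

text \<open>Functions with the same germ are either both holomorphic near \<open>p\<close> or, by the normalisation of
  derivations, both sent to zero.\<close>

lemma tvec_cong:
  assumes "u \<in> tangent_space M p" "openin (mtop M) U" "p \<in> U" "\<And>r. r \<in> U \<Longrightarrow> f r = g r"
  shows "u f = u g"
proof (cases "hol_near M p f")
  case True
  then obtain V where V: "openin (mtop M) V" "p \<in> V" "hol_fun M V f" unfolding hol_near_def by blast
  have "openin (mtop M) (U \<inter> V)" "p \<in> U \<inter> V" "hol_fun M (U \<inter> V) f" "\<forall>r\<in>U \<inter> V. g r = f r"
    using V assms by (auto simp: hol_fun_iff)
  with assms(1) have "u g = u f" unfolding tangent_space_def by blast
  then show ?thesis ..
next
  case False
  moreover have "\<not> hol_near M p g" using False hol_near_cong[of U p g f] assms by metis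
  ultimately show ?thesis using tvec_zero[OF assms(1)] by metis
qed

lemma tvec_const: 
  assumes "u \<in> tangent_space M p" shows "u (\<lambda>_. c) = 0"
proof (cases "p \<in> topspace (mtop M)")
  case True
  \<comment> \<open>The product rule for \<open>1 = 1 * 1\<close> gives \<open>u 1 = 2 * u 1\<close>.\<close>
  have "u (\<lambda>_. 1 * 1) = 1 * u (\<lambda>_. 1) + 1 * u (\<lambda>_. 1)"
    by (rule tvec_mult[OF assms hol_near_const[OF True] hol_near_const[OF True]])
  then have "u (\<lambda>_. 1) = 0" by simp
  moreover have "u (\<lambda>_. c * 1) = c * u (\<lambda>_. 1)"
    by (rule tvec_cmult[OF assms hol_near_const[OF True]])
  ultimately show ?thesis by simp
next
  case False
  then show ?thesis using tvec_zero[OF assms] hol_near_topspace by blast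
qed

lemma tvec_sum:
  assumes "u \<in> tangent_space M p" "\<And>j. j \<in> J \<Longrightarrow> hol_near M p (f j)"
  shows "u (\<lambda>r. \<Sum>j\<in>J. f j r) = (\<Sum>j\<in>J. u (f j))"
proof (cases "p \<in> topspace (mtop M)")
  case True
  show ?thesis using assms(2)
    by (induction J rule: infinite_finite_induct)
      (simp_all add: tvec_const[OF assms(1)] tvec_add[OF assms(1)] hol_near_sum[OF True])
next
  case False
  then have "u f = 0" for f using tvec_zero[OF assms(1)] hol_near_topspace by blast
  then show ?thesis by simp
qed

lemma tvec_diff:
  assumes "u \<in> tangent_space M p" "hol_near M p f" "hol_near M p g"
  shows "u (\<lambda>r. f r - g r) = u f - u g"
proof -
  have n: "hol_near M p (\<lambda>r. -1 * g r)"
    using hol_near_minus[OF hol_near_topspace] assms(3) by simp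
  have "u (\<lambda>r. f r + (-1) * g r) = u f + (-1) * u g"
    using tvec_add[OF assms(1,2) n] tvec_cmult[OF assms(1,3), of "-1"] by simp
  then show ?thesis by simp
qed

lemma tvec_plus:
  assumes "u \<in> tangent_space M p" "w \<in> tangent_space M p" shows "u + w \<in> tangent_space M p"
  using assms unfolding tangent_space_def
  by (auto simp: plus_fun_apply algebra_simps)

lemma tvec_scale:
  assumes "u \<in> tangent_space M p" shows "tscale c u \<in> tangent_space M p"
  using assms unfolding tangent_space_def
  by (auto simp: algebra_simps)

lemma tvec_null: "0 \<in> tangent_space M p"
  unfolding tangent_space_def by (auto simp: zero_fun_apply)

lemma tvec_lincomb:
  "(\<And>i. i \<in> I \<Longrightarrow> e i \<in> tangent_space M p) \<Longrightarrow> (\<Sum>i\<in>I. tscale (c i) (e i)) \<in> tangent_space M p"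
  by (induction I rule: infinite_finite_induct) (simp_all add: tvec_null tvec_plus tvec_scale)

lemma tvec_minus:
  assumes "u \<in> tangent_space M p" "w \<in> tangent_space M p" shows "u - w \<in> tangent_space M p"
proof -
  have "u - w = u + tscale (-1) w" by (auto simp: fun_eq_iff plus_fun_apply)
  then show ?thesis using tvec_plus[OF assms(1) tvec_scale[OF assms(2)]] by (simp only:)
qed

text \<open>Tangent vectors are normalised to vanish on functions that are not holomorphic near \<open>p\<close>.\<close>

definition coord_vec :: "'a set \<Rightarrow> ('a \<Rightarrow> complex ^ 'n) \<Rightarrow> 'n \<Rightarrow> 'a \<Rightarrow> 'a tvec"
  where "coord_vec D \<phi> i p =
    (\<lambda>f. if hol_near M p f then pderiv_at i (\<lambda>z. f (inv_into D \<phi> z)) (\<phi> p) else 0)"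

lemma coord_vec_tangent:
  assumes c: "(D, \<phi>) \<in> atlas M" "p \<in> D"
  shows "coord_vec D \<phi> i p \<in> tangent_space M p"
proof -
  have p: "p \<in> topspace (mtop M)" using c chart_openin openin_subset by blast
  have cd: "cdiff_at (\<lambda>z. f (inv_into D \<phi> z)) (\<phi> p)" if "hol_near M p f" for f
    using hol_near_at[OF that] c unfolding hol_at_def by blast
  have 1: "coord_vec D \<phi> i p g = coord_vec D \<phi> i p f"
    if "openin (mtop M) U" "p \<in> U" "hol_fun M U f" "\<forall>r\<in>U. g r = f r" for f g U
  proof -
    have f: "hol_near M p f" by (rule hol_nearI[OF that(1-3)])
    have g: "hol_near M p g" by (rule hol_near_cong[OF that(1,2) _ f]) (use that in auto)
    have "pderiv_at i (\<lambda>z. g (inv_into D \<phi> z)) (\<phi> p) = pderiv_at i (\<lambda>z. f (inv_into D \<phi> z)) (\<phi> p)"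
      by (rule pderiv_at_cong[OF chart_image_open_sub[OF c(1) that(1)]]) (use c that in auto)
    then show ?thesis using f g by (simp add: coord_vec_def)
  qed
  have 2: "coord_vec D \<phi> i p (\<lambda>r. k * f r) = k * coord_vec D \<phi> i p f" if "hol_near M p f" for k f
    using that hol_near_mult[OF hol_near_const[OF p] that]
      cdiff_at_mult(2)[OF cdiff_at_const cd[OF that]]
    by (simp add: coord_vec_def)
  have 3: "coord_vec D \<phi> i p (\<lambda>r. f r + g r) = coord_vec D \<phi> i p f + coord_vec D \<phi> i p g"
    "coord_vec D \<phi> i p (\<lambda>r. f r * g r) = f p * coord_vec D \<phi> i p g + g p * coord_vec D \<phi> i p f"
    if "hol_near M p f" "hol_near M p g" for f g
    using that hol_near_mult[OF that] hol_near_add[OF that] c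
      cdiff_at_mult(2)[OF cd[OF that(1)] cd[OF that(2)]]
      cdiff_at_add(2)[OF cd[OF that(1)] cd[OF that(2)]]
    by (simp_all add: coord_vec_def)
  show ?thesis
    unfolding tangent_space_def mem_Collect_eq
  proof (intro conjI allI impI)
    show "coord_vec D \<phi> i p f = 0" if "\<not> hol_near M p f" for f
      using that by (simp add: coord_vec_def)
    show "coord_vec D \<phi> i p g = coord_vec D \<phi> i p f"
      if "openin (mtop M) U \<and> p \<in> U \<and> hol_fun M U f \<and> (\<forall>r\<in>U. g r = f r)" for f g U
      using that by (elim conjE) (rule 1)
    show "coord_vec D \<phi> i p (\<lambda>r. f r + g r) = coord_vec D \<phi> i p f + coord_vec D \<phi> i p g"
      "coord_vec D \<phi> i p (\<lambda>r. f r * g r) = f p * coord_vec D \<phi> i p g + g p * coord_vec D \<phi> i p f"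
      if "hol_near M p f \<and> hol_near M p g" for f g
      using 3 that by blast+
    show "coord_vec D \<phi> i p (\<lambda>r. k * f r) = k * coord_vec D \<phi> i p f" if "hol_near M p f" for k f
      by (rule 2[OF that])
  qed
qed

lemma coord_fun_hol:
  assumes "(D, \<phi>) \<in> atlas M"
  shows "hol_fun M D (\<lambda>r. \<phi> r $ i)"
  unfolding hol_fun_iff
proof
  fix p assume p: "p \<in> D"
  have "cdiff_at (\<lambda>z. \<phi> (inv_into D \<phi> z) $ i) (\<phi> p)"
    by (rule cdiff_at_cong[OF chart_image_open[OF assms] imageI[OF p] _ cdiff_at_component[of i]])
      (simp add: f_inv_into_f[of _ \<phi> D])
  then show "hol_at p (\<lambda>r. \<phi> r $ i)" by (rule hol_at_chartI[OF assms p])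
qed

lemma coord_vec_coord_fun:
  assumes c: "(D, \<phi>) \<in> atlas M" "p \<in> D"
  shows "coord_vec D \<phi> i p (\<lambda>r. \<phi> r $ j) = (if j = i then 1 else 0)"
proof -
  have "pderiv_at i (\<lambda>z. \<phi> (inv_into D \<phi> z) $ j) (\<phi> p) = pderiv_at i (\<lambda>z. z $ j) (\<phi> p)"
    by (rule pderiv_at_cong[OF chart_image_open[OF c(1)] imageI[OF c(2)]]) (simp add: f_inv_into_f[of _ \<phi> D])
  then show ?thesis
    using hol_nearI[OF chart_openin[OF c(1)] c(2) coord_fun_hol[OF c(1), of j]]
    by (simp add: coord_vec_def pderiv_at_component)
qed

lemma coord_vec_field:
  assumes c: "(D, \<phi>) \<in> atlas M"
  shows "vector_field M D (coord_vec D \<phi> i)"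
  unfolding vector_field_def
proof (intro conjI ballI allI impI)
  fix V f assume V: "openin (mtop M) V \<and> V \<subseteq> D \<and> hol_fun M V f"
  show "hol_fun M V (\<lambda>p. coord_vec D \<phi> i p f)"
    unfolding hol_fun_iff
  proof
    fix p assume p: "p \<in> V"
    have D: "D \<inter> V = V" using V by blast
    have o: "open (\<phi> ` V)" using chart_image_open_sub[OF c, of V] V D by simp
    have "cholomorphic_on (pderiv_at i (\<lambda>z. f (inv_into D \<phi> z))) (\<phi> ` V)"
      by (rule cholomorphic_on_pderiv_at[OF o hol_fun_chart[OF c]]) (use V in auto)
    then have "cdiff_at (pderiv_at i (\<lambda>z. f (inv_into D \<phi> z))) (\<phi> p)"
      using p by (simp add: cholomorphic_on_iff)
    then have "cdiff_at (\<lambda>z. coord_vec D \<phi> i (inv_into D \<phi> z) f) (\<phi> p)"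
    proof (rule cdiff_at_cong[OF o, rotated 2])
      fix w assume "w \<in> \<phi> ` V"
      then obtain r where r: "r \<in> V" "w = \<phi> r" by blast
      then have "hol_near M r f" "r \<in> D" using V hol_nearI[of V r f] by auto
      then show "pderiv_at i (\<lambda>z. f (inv_into D \<phi> z)) w = coord_vec D \<phi> i (inv_into D \<phi> w) f"
        using c r by (simp add: coord_vec_def)
    qed (rule imageI[OF p])
    then show "hol_at p (\<lambda>p. coord_vec D \<phi> i p f)"
      using p V by (intro hol_at_chartI[OF c]) auto
  qed
qed (rule coord_vec_tangent[OF c])

text \<open>Being the preimage of a ball, the neighbourhood provided here is one over which \<open>hadamard\<close> and
  \<open>poincare\<close> apply in coordinates.\<close>

lemma ball_in_chart:
  assumes c: "(D, \<phi>) \<in> atlas M" and U: "openin (mtop M) U" "p \<in> D \<inter> U"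
  obtains r where "r > 0" "ball (\<phi> p) r \<subseteq> \<phi> ` (D \<inter> U)"
    "{s \<in> D. \<phi> s \<in> ball (\<phi> p) r} \<subseteq> D \<inter> U"
    "openin (mtop M) {s \<in> D. \<phi> s \<in> ball (\<phi> p) r}" "p \<in> {s \<in> D. \<phi> s \<in> ball (\<phi> p) r}"
proof -
  have "open (\<phi> ` (D \<inter> U))" by (rule chart_image_open_sub[OF c U(1)])
  then obtain r where r: "r > 0" "ball (\<phi> p) r \<subseteq> \<phi> ` (D \<inter> U)"
    using U(2) open_contains_ball by blast
  have "s \<in> U" if "s \<in> D" "\<phi> s \<in> \<phi> ` (D \<inter> U)" for s
    using that inj_on_image_mem_iff[OF chart_inj[OF c], of s "D \<inter> U"] by blast
  then have 1: "{s \<in> D. \<phi> s \<in> ball (\<phi> p) r} \<subseteq> D \<inter> U" using r(2) by (auto simp del: mem_ball)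
  have 2: "p \<in> {s \<in> D. \<phi> s \<in> ball (\<phi> p) r}" using U(2) r(1) by simp
  show ?thesis
    by (rule that[OF r 1 chart_preimage_openin[OF c open_ball] 2])
qed

text \<open>By Hadamard's lemma a germ at \<open>p\<close> is its value plus \<open>\<Sum>i. (\<phi>\<^sub>i - \<phi>\<^sub>i(p)) g\<^sub>i\<close> with
  \<open>g\<^sub>i(p)\<close> its \<open>i\<close>-th partial derivative; a derivation kills the constant and sees each product only
  through \<open>g\<^sub>i(p)\<close>, because the other factor vanishes at \<open>p\<close>.\<close>

lemma tvec_expansion:
  assumes c: "(D, \<phi>) \<in> atlas M" "p \<in> D" and u: "u \<in> tangent_space M p"
  shows "u = (\<Sum>i\<in>UNIV. tscale (u (\<lambda>r. \<phi> r $ i)) (coord_vec D \<phi> i p))"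
proof
  fix f
  have "u f = (\<Sum>i\<in>UNIV. u (\<lambda>r. \<phi> r $ i) * coord_vec D \<phi> i p f)"
  proof (cases "hol_near M p f")
    case False
    then show ?thesis by (simp add: tvec_zero[OF u] coord_vec_def)
  next
    case True
    then obtain U where U: "openin (mtop M) U" "p \<in> U" "hol_fun M U f" unfolding hol_near_def by blast
    have pD: "p \<in> D \<inter> U" using c U by blast
    obtain e where e: "e > 0" "ball (\<phi> p) e \<subseteq> \<phi> ` (D \<inter> U)"
      "openin (mtop M) {s \<in> D. \<phi> s \<in> ball (\<phi> p) e}" "p \<in> {s \<in> D. \<phi> s \<in> ball (\<phi> p) e}"
      by (rule ball_in_chart[OF c(1) U(1) pD])
    define V where "V = {s \<in> D. \<phi> s \<in> ball (\<phi> p) e}"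
    have V: "openin (mtop M) V" "p \<in> V" "V \<subseteq> D" using e by (auto simp: V_def)
    let ?F = "\<lambda>z. f (inv_into D \<phi> z)"
    have "cholomorphic_on ?F (ball (\<phi> p) e)"
      using U(3) c e(2) unfolding hol_fun_def cholomorphic_on_iff by blast
    then obtain g where g: "\<And>i. cholomorphic_on (g i) (ball (\<phi> p) e)"
      "\<And>z. z \<in> ball (\<phi> p) e \<Longrightarrow> ?F z = ?F (\<phi> p) + (\<Sum>i\<in>UNIV. (z $ i - \<phi> p $ i) * g i z)"
      "\<And>i. g i (\<phi> p) = pderiv_at i ?F (\<phi> p)"
      using hadamard e(1) by blast
    have hc: "hol_near M p (\<lambda>r. \<phi> r $ i)" for i
      by (rule hol_nearI[OF chart_openin[OF c(1)] c(2) coord_fun_hol[OF c(1)]])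
    have p: "p \<in> topspace (mtop M)" using hc hol_near_topspace by blast
    have hc': "hol_near M p (\<lambda>r. \<phi> r $ i - \<phi> p $ i)" for i
      by (rule hol_near_diff[OF hc hol_near_const[OF p]])
    have hg: "hol_near M p (\<lambda>r. g i (\<phi> r))" for i
    proof (rule hol_nearI[OF V(1,2)], unfold hol_fun_iff, rule)
      fix r assume r: "r \<in> V"
      have "cdiff_at (g i) (\<phi> r)" using g(1)[of i] r by (simp add: V_def cholomorphic_on_iff)
      then have "cdiff_at (\<lambda>z. g i (\<phi> (inv_into D \<phi> z))) (\<phi> r)"
        by (rule cdiff_at_cong[OF chart_image_open[OF c(1)], rotated 2])
          (use r V in \<open>auto simp: f_inv_into_f[of _ \<phi> D]\<close>)
      then show "hol_at r (\<lambda>r. g i (\<phi> r))"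
        using r V by (intro hol_at_chartI[OF c(1)]) auto
    qed
    have "u f = u (\<lambda>r. f p + (\<Sum>i\<in>UNIV. (\<phi> r $ i - \<phi> p $ i) * g i (\<phi> r)))"
    proof (rule tvec_cong[OF u V(1,2)])
      fix r assume "r \<in> V"
      then show "f r = f p + (\<Sum>i\<in>UNIV. (\<phi> r $ i - \<phi> p $ i) * g i (\<phi> r))"
        using g(2)[of "\<phi> r"] c by (auto simp: V_def)
    qed
    also have "\<dots> = (\<Sum>i\<in>UNIV. u (\<lambda>r. (\<phi> r $ i - \<phi> p $ i) * g i (\<phi> r)))"
      by (simp add: tvec_add[OF u] tvec_sum[OF u] tvec_const[OF u] hol_near_const[OF p]
          hol_near_sum[OF p] hol_near_mult hc' hg)
    also have "\<dots> = (\<Sum>i\<in>UNIV. u (\<lambda>r. \<phi> r $ i) * g i (\<phi> p))"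
    proof (rule sum.cong[OF refl])
      fix i
      show "u (\<lambda>r. (\<phi> r $ i - \<phi> p $ i) * g i (\<phi> r)) = u (\<lambda>r. \<phi> r $ i) * g i (\<phi> p)"
        using tvec_mult[OF u hc'[of i] hg[of i]]
          tvec_diff[OF u hc[of i] hol_near_const[OF p, of "\<phi> p $ i"]] tvec_const[OF u]
        by simp
    qed
    also have "\<dots> = (\<Sum>i\<in>UNIV. u (\<lambda>r. \<phi> r $ i) * coord_vec D \<phi> i p f)"
      using True by (simp add: coord_vec_def g(3))
    finally show ?thesis .
  qed
  then show "u f = (\<Sum>i\<in>UNIV. tscale (u (\<lambda>r. \<phi> r $ i)) (coord_vec D \<phi> i p)) f"
    by (simp add: sum_fun_apply)
qed


section \<open>Vector fields and one-forms\<close>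

lemma vector_field_tangent: "vector_field M U v \<Longrightarrow> p \<in> U \<Longrightarrow> v p \<in> tangent_space M p"
  unfolding vector_field_def by blast

lemma vector_field_hol:
  "vector_field M U v \<Longrightarrow> openin (mtop M) V \<Longrightarrow> V \<subseteq> U \<Longrightarrow> hol_fun M V f \<Longrightarrow> hol_fun M V (\<lambda>p. v p f)"
  unfolding vector_field_def by blast

lemma vector_field_subset: "vector_field M U v \<Longrightarrow> V \<subseteq> U \<Longrightarrow> vector_field M V v"
  unfolding vector_field_def by blast

lemma hol_fun_subset: "hol_fun M U f \<Longrightarrow> V \<subseteq> U \<Longrightarrow> hol_fun M V f"
  unfolding hol_fun_iff by blast

lemma vector_field_add:
  assumes "vector_field M U v" "vector_field M U w"
  shows "vector_field M U (\<lambda>p. v p + w p)"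
  using assms unfolding vector_field_def
  by (auto simp: tvec_plus plus_fun_apply hol_fun_iff hol_at_add)

lemma vector_field_scale:
  assumes "vector_field M U v" "hol_fun M U f"
  shows "vector_field M U (\<lambda>p. tscale (f p) (v p))"
  using assms unfolding vector_field_def
  by (auto simp: tvec_scale hol_fun_iff intro!: hol_at_mult)

lemma vector_field_zero: "vector_field M U (\<lambda>p. 0)"
  unfolding vector_field_def by (auto simp: tvec_null zero_fun_apply hol_fun_iff hol_at_const)

lemma vector_field_lincomb:
  "(\<And>i. i \<in> I \<Longrightarrow> vector_field M U (e i)) \<Longrightarrow> (\<And>i. i \<in> I \<Longrightarrow> hol_fun M U (c i)) \<Longrightarrow>
    vector_field M U (\<lambda>p. \<Sum>i\<in>I. tscale (c i p) (e i p))"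
  by (induction I rule: infinite_finite_induct)
    (simp_all add: vector_field_zero vector_field_add vector_field_scale)

lemma vector_field_minus:
  assumes "vector_field M U v" "vector_field M U w"
  shows "vector_field M U (\<lambda>p. v p - w p)"
proof -
  have "vector_field M U (\<lambda>p. v p + tscale (-1) (w p))"
    by (intro vector_field_add vector_field_scale assms) (simp add: hol_fun_iff hol_at_const)
  moreover have "(\<lambda>p. v p + tscale (-1) (w p)) = (\<lambda>p. v p - w p)"
    by (auto simp: fun_eq_iff plus_fun_apply)
  ultimately show ?thesis by simp
qed

text \<open>The extension has constant coefficients in a chart.\<close>

lemma vector_extension:
  assumes "openin (mtop M) U" "p \<in> U" "u \<in> tangent_space M p"
  obtains V v where "openin (mtop M) V" "p \<in> V" "V \<subseteq> U" "vector_field M V v" "v p = u"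
proof -
  have "p \<in> topspace (mtop M)" using assms openin_subset by blast
  then obtain D \<phi> where c: "(D, \<phi>) \<in> atlas M" "p \<in> D" by (rule chart_at)
  let ?v = "\<lambda>s. \<Sum>i\<in>UNIV. tscale (u (\<lambda>r. \<phi> r $ i)) (coord_vec D \<phi> i s)"
  have "vector_field M D ?v"
    by (intro vector_field_lincomb coord_vec_field c) (simp add: hol_fun_iff hol_at_const)
  then have "vector_field M (D \<inter> U) ?v" by (rule vector_field_subset) blast
  moreover have "?v p = u" using tvec_expansion[OF c assms(3)] by simp
  ultimately show ?thesis
    using that[of "D \<inter> U" ?v] assms c chart_openin by blast
qed

lemma lie_bracket_apply: "hol_near M p f \<Longrightarrow> lie_bracket M v w p f = v p (\<lambda>r. w r f) - w p (\<lambda>r. v r f)"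
  by (simp add: lie_bracket_def)

text \<open>In the product rule for \<open>[v,w]\<close> the mixed terms \<open>v f * w g + w f * v g\<close> are symmetric in \<open>v\<close>
  and \<open>w\<close> and cancel.\<close>

lemma lie_bracket_field:
  assumes U: "openin (mtop M) U" and v: "vector_field M U v" and w: "vector_field M U w"
  shows "vector_field M U (lie_bracket M v w)"
  unfolding vector_field_def
proof (intro conjI ballI allI impI)
  fix V f assume V: "openin (mtop M) V \<and> V \<subseteq> U \<and> hol_fun M V f"
  have "hol_fun M V (\<lambda>p. v p (\<lambda>r. w r f))" "hol_fun M V (\<lambda>p. w p (\<lambda>r. v r f))"
    using vector_field_hol[OF w, of V f] vector_field_hol[OF v, of V f]
      vector_field_hol[OF v, of V "\<lambda>r. w r f"] vector_field_hol[OF w, of V "\<lambda>r. v r f"] V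
    by simp_all
  moreover have "lie_bracket M v w p f = v p (\<lambda>r. w r f) - w p (\<lambda>r. v r f)" if "p \<in> V" for p
    using hol_nearI[of V p f] V that by (intro lie_bracket_apply) blast
  ultimately have "hol_at p (\<lambda>p. lie_bracket M v w p f)" if "p \<in> V" for p
  proof -
    assume h: "hol_fun M V (\<lambda>p. v p (\<lambda>r. w r f))" "hol_fun M V (\<lambda>p. w p (\<lambda>r. v r f))"
      and eq: "\<And>p. p \<in> V \<Longrightarrow> lie_bracket M v w p f = v p (\<lambda>r. w r f) - w p (\<lambda>r. v r f)"
    have "hol_at p (\<lambda>p. v p (\<lambda>r. w r f) - w p (\<lambda>r. v r f))"
      by (rule hol_at_diff) (use h that in \<open>simp_all add: hol_fun_iff\<close>)
    then show ?thesis
      by (rule hol_at_cong[OF conjunct1[OF V] that, rotated]) (simp add: eq)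
  qed
  then show "hol_fun M V (\<lambda>p. lie_bracket M v w p f)" unfolding hol_fun_iff by (rule ballI)
next
  fix p assume p: "p \<in> U"
  have ptop: "p \<in> topspace (mtop M)" using p U openin_subset by blast
  have tv: "v p \<in> tangent_space M p" "w p \<in> tangent_space M p"
    using v w p vector_field_tangent by blast+
  have near: "hol_near M p (\<lambda>r. x r f)" if x: "vector_field M U x" and f: "hol_near M p f" for x f
  proof -
    obtain V where V: "openin (mtop M) V" "p \<in> V" "hol_fun M V f" using f unfolding hol_near_def by blast
    have "hol_fun M (U \<inter> V) (\<lambda>r. x r f)"
      by (rule vector_field_hol[OF x openin_Int[OF U V(1)] Int_lower1 hol_fun_subset[OF V(3) Int_lower2]])
    then show ?thesis
      by (rule hol_nearI[OF openin_Int[OF U V(1)] IntI[OF p V(2)]])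
  qed
  have evq: "\<exists>W. openin (mtop M) W \<and> p \<in> W \<and> W \<subseteq> U \<and> (\<forall>r\<in>W. hol_near M r f)" if f: "hol_near M p f" for f
  proof -
    obtain V where V: "openin (mtop M) V" "p \<in> V" "hol_fun M V f"
      using f unfolding hol_near_def by blast
    have "\<forall>r\<in>U \<inter> V. hol_near M r f" using hol_nearI[OF V(1) _ V(3)] by simp
    then show ?thesis using openin_Int[OF U V(1)] p V(2) by (intro exI[of _ "U \<inter> V"]) simp
  qed
  have plus: "x p (\<lambda>r. y r (\<lambda>s. f s + g s)) = x p (\<lambda>r. y r f) + x p (\<lambda>r. y r g)"
    and mult: "x p (\<lambda>r. y r (\<lambda>s. f s * g s)) =
      f p * x p (\<lambda>r. y r g) + y p g * x p f + (g p * x p (\<lambda>r. y r f) + y p f * x p g)"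
    if x: "vector_field M U x" and y: "vector_field M U y" and f: "hol_near M p f" and g: "hol_near M p g" for x y f g
  proof -
    obtain W1 where W1: "openin (mtop M) W1" "p \<in> W1" "W1 \<subseteq> U" "\<forall>r\<in>W1. hol_near M r f" using evq[OF f] by blast
    obtain W2 where W2: "openin (mtop M) W2" "p \<in> W2" "W2 \<subseteq> U" "\<forall>r\<in>W2. hol_near M r g" using evq[OF g] by blast
    have W: "openin (mtop M) (W1 \<inter> W2)" "p \<in> W1 \<inter> W2" using W1 W2 by auto
    have t: "y r \<in> tangent_space M r" if "r \<in> W1" for r using y W1 that vector_field_tangent by blast
    have xp: "x p \<in> tangent_space M p" using x p vector_field_tangent by blast
    have "x p (\<lambda>r. y r (\<lambda>s. f s + g s)) = x p (\<lambda>r. y r f + y r g)"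
      by (rule tvec_cong[OF xp W]) (use W1 W2 in \<open>auto intro!: tvec_add[OF t]\<close>)
    then show "x p (\<lambda>r. y r (\<lambda>s. f s + g s)) = x p (\<lambda>r. y r f) + x p (\<lambda>r. y r g)"
      using tvec_add[OF xp near[OF y f] near[OF y g]] by simp
    have "x p (\<lambda>r. y r (\<lambda>s. f s * g s)) = x p (\<lambda>r. f r * y r g + g r * y r f)"
      by (rule tvec_cong[OF xp W]) (use W1 W2 in \<open>auto intro!: tvec_mult[OF t]\<close>)
    then show "x p (\<lambda>r. y r (\<lambda>s. f s * g s)) =
      f p * x p (\<lambda>r. y r g) + y p g * x p f + (g p * x p (\<lambda>r. y r f) + y p f * x p g)"
      using tvec_add[OF xp hol_near_mult[OF f near[OF y g]] hol_near_mult[OF g near[OF y f]]]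
        tvec_mult[OF xp f near[OF y g]] tvec_mult[OF xp g near[OF y f]]
      by simp
  qed
  have cm: "x p (\<lambda>r. y r (\<lambda>s. k * f s)) = k * x p (\<lambda>r. y r f)"
    if x: "vector_field M U x" and y: "vector_field M U y" and f: "hol_near M p f" for x y f k
  proof -
    obtain W1 where W1: "openin (mtop M) W1" "p \<in> W1" "W1 \<subseteq> U" "\<forall>r\<in>W1. hol_near M r f" using evq[OF f] by blast
    have "x p (\<lambda>r. y r (\<lambda>s. k * f s)) = x p (\<lambda>r. k * y r f)"
    proof (rule tvec_cong[OF vector_field_tangent[OF x p] W1(1,2)])
      fix r assume r: "r \<in> W1"
      have "r \<in> U" using r W1(3) by blast
      from tvec_cmult[OF vector_field_tangent[OF y this]] show "y r (\<lambda>s. k * f s) = k * y r f"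
        using W1(4) r by blast
    qed
    then show ?thesis using tvec_cmult[OF vector_field_tangent[OF x p] near[OF y f]] by simp
  qed
  show "lie_bracket M v w p \<in> tangent_space M p"
    unfolding tangent_space_def mem_Collect_eq
  proof (intro conjI allI impI)
    fix f g V assume a: "openin (mtop M) V \<and> p \<in> V \<and> hol_fun M V f \<and> (\<forall>r\<in>V. g r = f r)"
    have f: "hol_near M p f" using a hol_nearI[of V p f] by simp
    have g: "hol_near M p g" using a f hol_near_cong[of V p f g] by simp
    have "x p (\<lambda>r. y r g) = x p (\<lambda>r. y r f)" if x: "vector_field M U x" and y: "vector_field M U y" for x y
    proof (rule tvec_cong[OF vector_field_tangent[OF x p], of "U \<inter> V"])
      fix r assume r: "r \<in> U \<inter> V"
      show "y r g = y r f"
        using tvec_cong[OF vector_field_tangent[OF y], of r V g f] a r by simp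
    qed (use U a p in \<open>simp_all add: openin_Int\<close>)
    from this[OF v w] this[OF w v] show "lie_bracket M v w p g = lie_bracket M v w p f"
      unfolding lie_bracket_apply[OF f] lie_bracket_apply[OF g] by simp
  next
    fix f g assume a: "hol_near M p f \<and> hol_near M p g"
    then have f: "hol_near M p f" and g: "hol_near M p g" by simp_all
    show "lie_bracket M v w p (\<lambda>r. f r + g r) = lie_bracket M v w p f + lie_bracket M v w p g"
      using plus[OF v w f g] plus[OF w v f g]
      unfolding lie_bracket_apply[OF f] lie_bracket_apply[OF g] lie_bracket_apply[OF hol_near_add[OF f g]]
      by simp
    show "lie_bracket M v w p (\<lambda>r. f r * g r) = f p * lie_bracket M v w p g + g p * lie_bracket M v w p f"
      using mult[OF v w f g] mult[OF w v f g]
      unfolding lie_bracket_apply[OF f] lie_bracket_apply[OF g] lie_bracket_apply[OF hol_near_mult[OF f g]]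
      by (simp add: algebra_simps)
  next
    fix k f assume f: "hol_near M p f"
    show "lie_bracket M v w p (\<lambda>r. k * f r) = k * lie_bracket M v w p f"
      using cm[OF v w f, of k] cm[OF w v f, of k]
      unfolding lie_bracket_apply[OF f] lie_bracket_apply[OF hol_near_mult[OF hol_near_const[OF ptop] f]]
      by (simp add: algebra_simps)
  qed (simp add: lie_bracket_def)
qed

lemma covector_add: "covector M p a \<Longrightarrow> u \<in> tangent_space M p \<Longrightarrow> w \<in> tangent_space M p \<Longrightarrow> a (u + w) = a u + a w"
  unfolding covector_def by blast

lemma covector_scale: "covector M p a \<Longrightarrow> u \<in> tangent_space M p \<Longrightarrow> a (tscale c u) = c * a u"
  unfolding covector_def by blast

lemma covector_zero: "covector M p a \<Longrightarrow> a 0 = 0"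
  using covector_scale[OF _ tvec_null, of p a 0] by (simp add: tscale_def zero_fun_def)

lemma covector_minus:
  assumes "covector M p a" "u \<in> tangent_space M p" "w \<in> tangent_space M p"
  shows "a (u - w) = a u - a w"
proof -
  have "u - w = u + tscale (-1) w" by (auto simp: fun_eq_iff plus_fun_apply)
  then have "a (u - w) = a (u + tscale (-1) w)" by (simp only:)
  then show ?thesis
    using covector_add[OF assms(1,2) tvec_scale[OF assms(3)]] covector_scale[OF assms(1,3)] by simp
qed

lemma covector_lincomb:
  assumes "covector M p a" "\<And>i. i \<in> I \<Longrightarrow> e i \<in> tangent_space M p"
  shows "a (\<Sum>i\<in>I. tscale (c i) (e i)) = (\<Sum>i\<in>I. c i * a (e i))"
  using assms(2)
  by (induction I rule: infinite_finite_induct)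
    (simp_all add: covector_zero[OF assms(1)] covector_add[OF assms(1)] covector_scale[OF assms(1)] tvec_lincomb tvec_scale)

lemma one_form_covector: "one_form M U \<alpha> \<Longrightarrow> p \<in> U \<Longrightarrow> covector M p (\<alpha> p)"
  unfolding one_form_def by blast

lemma one_form_hol:
  "one_form M U \<alpha> \<Longrightarrow> openin (mtop M) V \<Longrightarrow> V \<subseteq> U \<Longrightarrow> vector_field M V v \<Longrightarrow> hol_fun M V (\<lambda>p. \<alpha> p (v p))"
  unfolding one_form_def by blast

lemma one_form_subset: "one_form M U \<alpha> \<Longrightarrow> V \<subseteq> U \<Longrightarrow> one_form M V \<alpha>"
  unfolding one_form_def by blast

text \<open>Gauss elimination, one form at a time: given fields dual to the first \<open>q\<close> forms, independence
  yields a vector on which the next form, corrected by its part in the span of the others, does not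
  vanish. The correction and the normalisation of an extension of that vector use only division by a
  function that has no zeros nearby.\<close>

lemma independent_dual_frame:
  assumes "openin (mtop M) U" "p \<in> U"
    and "\<And>i. i < q \<Longrightarrow> one_form M U (\<theta> i)"
    and "covectors_independent M q p (\<lambda>i. \<theta> i p)"
  shows "\<exists>V X. openin (mtop M) V \<and> p \<in> V \<and> V \<subseteq> U \<and> (\<forall>j<q. vector_field M V (X j)) \<and>
    (\<forall>r\<in>V. \<forall>i<q. \<forall>j<q. \<theta> i r (X j r) = (if i = j then 1 else 0))"
  using assms(3,4)
proof (induction q)
  case 0
  then show ?case using assms(1,2) by auto
next
  case (Suc q)
  have "covectors_independent M q p (\<lambda>i. \<theta> i p)"
    unfolding covectors_independent_def
  proof (intro allI impI)
    fix c i assume c: "\<forall>u\<in>tangent_space M p. (\<Sum>i<q. c i * \<theta> i p u) = 0" and i: "i < q"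
    have "\<forall>u\<in>tangent_space M p. (\<Sum>i<Suc q. (c(q := 0)) i * \<theta> i p u) = 0" using c by simp
    then have "\<forall>i<Suc q. (c(q := 0)) i = 0"
      using Suc.prems(2) unfolding covectors_independent_def by blast
    then show "c i = 0" using i by (metis fun_upd_other less_SucI less_irrefl)
  qed
  with Suc obtain V X where V: "openin (mtop M) V" "p \<in> V" "V \<subseteq> U"
    and X: "\<And>j. j < q \<Longrightarrow> vector_field M V (X j)"
    and dual: "\<And>r i j. r \<in> V \<Longrightarrow> i < q \<Longrightarrow> j < q \<Longrightarrow> \<theta> i r (X j r) = (if i = j then 1 else 0)"
    by force
  have form: "one_form M V (\<theta> i)" if "i < Suc q" for i
    using Suc.prems(1)[OF that] V one_form_subset by blast
  have cov: "covector M r (\<theta> i r)" if "i < Suc q" "r \<in> V" for i r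
    using form[OF that(1)] that(2) one_form_covector by blast
  \<comment> \<open>The last form minus its part in the span of the others does not vanish at \<open>p\<close>.\<close>
  have "\<exists>u\<in>tangent_space M p. \<theta> q p u - (\<Sum>i<q. \<theta> q p (X i p) * \<theta> i p u) \<noteq> 0"
  proof (rule ccontr)
    assume "\<not> ?thesis"
    then have "\<forall>u\<in>tangent_space M p. (\<Sum>i<Suc q. (if i = q then 1 else - \<theta> q p (X i p)) * \<theta> i p u) = 0"
      by (simp add: sum_negf)
    with spec[OF Suc.prems(2)[unfolded covectors_independent_def],
        of "\<lambda>i. if i = q then 1 else - \<theta> q p (X i p)"]
    have "\<forall>i<Suc q. (if i = q then 1 else - \<theta> q p (X i p)) = 0" by (rule mp)
    from spec[OF this, of q] show False by simp
  qed
  then obtain u where u: "u \<in> tangent_space M p" "\<theta> q p u - (\<Sum>i<q. \<theta> q p (X i p) * \<theta> i p u) \<noteq> 0" by blast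
  obtain W Y where W: "openin (mtop M) W" "p \<in> W" "W \<subseteq> V" and Y: "vector_field M W Y" "Y p = u"
    using vector_extension[OF V(1,2) u(1)] by blast
  have XW: "vector_field M W (X j)" if "j < q" for j using X[OF that] W vector_field_subset by blast
  have formW: "one_form M W (\<theta> i)" if "i < Suc q" for i using form[OF that] W one_form_subset by blast
  define Z where "Z = (\<lambda>r. Y r - (\<Sum>i<q. tscale (\<theta> i r (Y r)) (X i r)))"
  have Z: "vector_field M W Z"
    unfolding Z_def
    by (intro vector_field_minus Y vector_field_lincomb XW one_form_hol[OF formW W(1)]) auto
  have \<theta>Z: "\<theta> i r (Z r) = \<theta> i r (Y r) - (\<Sum>j<q. \<theta> j r (Y r) * \<theta> i r (X j r))" if "i < Suc q" "r \<in> W" for i r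
  proof -
    have c: "covector M r (\<theta> i r)" using cov that W by blast
    have X: "X j r \<in> tangent_space M r" if "j \<in> {..<q}" for j
      using vector_field_tangent[OF XW \<open>r \<in> W\<close>] that by simp
    have t: "(\<Sum>j<q. tscale (\<theta> j r (Y r)) (X j r)) \<in> tangent_space M r"
      by (rule tvec_lincomb) (rule X)
    have "\<theta> i r (\<Sum>j<q. tscale (\<theta> j r (Y r)) (X j r)) = (\<Sum>j<q. \<theta> j r (Y r) * \<theta> i r (X j r))"
      by (rule covector_lincomb[OF c]) (rule X)
    then show ?thesis
      using covector_minus[OF c vector_field_tangent[OF Y(1) that(2)] t] by (simp only: Z_def)
  qed
  have \<theta>Z0: "\<theta> i r (Z r) = 0" if "i < q" "r \<in> W" for i r
  proof -
    have "(\<Sum>j<q. \<theta> j r (Y r) * \<theta> i r (X j r)) = (\<Sum>j<q. if i = j then \<theta> j r (Y r) else 0)"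
      by (rule sum.cong) (use that W dual in auto)
    also have "\<dots> = \<theta> i r (Y r)" using that by simp
    finally show ?thesis using \<theta>Z[of i r] that by simp
  qed
  have hol: "hol_fun M W (\<lambda>r. \<theta> q r (Z r))"
    by (rule one_form_hol[OF formW W(1) _ Z]) auto
  have "\<theta> q p (Z p) \<noteq> 0" using u(2) \<theta>Z[of q p] W Y by (simp add: mult.commute)
  then obtain N where N: "openin (mtop M) N" "p \<in> N" "N \<subseteq> W" "\<forall>r\<in>N. \<theta> q r (Z r) \<noteq> 0"
    using nonzero_near[OF W(1,2) hol] by blast
  define A where "A = (\<lambda>r. tscale (inverse (\<theta> q r (Z r))) (Z r))"
  have A: "vector_field M N A"
    unfolding A_def
    by (intro vector_field_scale vector_field_subset[OF Z]) (use N hol in \<open>auto simp: hol_fun_iff intro!: hol_at_inverse\<close>)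
  define X' where "X' = (\<lambda>j r. if j = q then A r else X j r - tscale (\<theta> q r (X j r)) (A r))"
  have XN: "vector_field M N (X j)" if "j < q" for j using XW[OF that] N vector_field_subset by blast
  have formN: "one_form M N (\<theta> i)" if "i < Suc q" for i using formW[OF that] N one_form_subset by blast
  have "vector_field M N (X' j)" if "j < Suc q" for j
  proof (cases "j = q")
    case True
    then show ?thesis using A by (simp add: X'_def)
  next
    case False
    then have "j < q" using that by simp
    then have "vector_field M N (\<lambda>r. X j r - tscale (\<theta> q r (X j r)) (A r))"
      by (intro vector_field_minus vector_field_scale A XN one_form_hol[OF formN N(1)]) auto
    then show ?thesis using False by (simp add: X'_def[abs_def])
  qed
  moreover have "\<theta> i r (X' j r) = (if i = j then 1 else 0)" if r: "r \<in> N" and i: "i < Suc q" and j: "j < Suc q" for i j r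
  proof -
    have rW: "r \<in> W" "r \<in> V" using r N W by auto
    have c: "covector M r (\<theta> i r)" using cov i rW by blast
    have tA: "A r \<in> tangent_space M r" using vector_field_tangent[OF A r] .
    have \<theta>A: "\<theta> i r (A r) = (if i = q then 1 else 0)"
      unfolding A_def using covector_scale[OF c vector_field_tangent[OF Z rW(1)]] \<theta>Z0[of i r] N r i rW
      by (auto simp: less_Suc_eq)
    show ?thesis
    proof (cases "j = q")
      case True
      then show ?thesis using \<theta>A by (simp add: X'_def)
    next
      case False
      then have jq: "j < q" using j by simp
      have "\<theta> i r (X' j r) = \<theta> i r (X j r) - \<theta> q r (X j r) * \<theta> i r (A r)"
        using False covector_minus[OF c vector_field_tangent[OF XN[OF jq] r] tvec_scale[OF tA]]
          covector_scale[OF c tA] by (simp add: X'_def)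
      then show ?thesis using \<theta>A dual[OF rW(2) _ jq, of i] i jq by (auto simp: less_Suc_eq)
    qed
  qed
  ultimately show ?case
    using N W V by (intro exI[of _ N] exI[of _ X']) auto
qed

text \<open>The bracket is a derivation, hence determined by its values on the coordinates, and these are
  derivatives of constants. The symmetry of second partial derivatives is thereby a consequence of
  \<open>tvec_expansion\<close>.\<close>

lemma coord_vec_bracket:
  assumes c: "(D, \<phi>) \<in> atlas M" "p \<in> D"
  shows "lie_bracket M (coord_vec D \<phi> i) (coord_vec D \<phi> j) p = 0"
proof -
  let ?b = "lie_bracket M (coord_vec D \<phi> i) (coord_vec D \<phi> j) p"
  have t: "?b \<in> tangent_space M p"
    using vector_field_tangent[OF lie_bracket_field[OF chart_openin[OF c(1)] coord_vec_field[OF c(1)] coord_vec_field[OF c(1)]]] c by blast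
  have "?b (\<lambda>r. \<phi> r $ k) = 0" for k
  proof -
    have h: "hol_near M p (\<lambda>r. \<phi> r $ k)"
      by (rule hol_nearI[OF chart_openin[OF c(1)] c(2) coord_fun_hol[OF c(1)]])
    have "coord_vec D \<phi> a p (\<lambda>r. coord_vec D \<phi> b r (\<lambda>r. \<phi> r $ k)) = 0" for a b
    proof -
      have "coord_vec D \<phi> a p (\<lambda>r. coord_vec D \<phi> b r (\<lambda>r. \<phi> r $ k))
          = coord_vec D \<phi> a p (\<lambda>_. if k = b then 1 else 0)"
        by (rule tvec_cong[OF coord_vec_tangent[OF c] chart_openin[OF c(1)] c(2)])
          (rule coord_vec_coord_fun[OF c(1)])
      then show ?thesis using tvec_const[OF coord_vec_tangent[OF c]] by simp
    qed
    then show ?thesis by (simp add: lie_bracket_apply[OF h])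
  qed
  then show ?thesis
    using tvec_expansion[OF c t] by (simp add: tscale_def zero_fun_def sum_fun_apply fun_eq_iff)
qed

text \<open>Evaluating \<open>d\<theta> = 0\<close> on commuting coordinate fields gives the symmetry that \<open>poincare\<close>
  asks for.\<close>

lemma closed_form_exact:
  assumes c: "(D, \<phi>) \<in> atlas M" and V: "V = {s \<in> D. \<phi> s \<in> ball a r}" "ball a r \<subseteq> \<phi> ` D"
    and \<theta>: "one_form M V \<theta>" "closed_form M V \<theta>"
  obtains f where "hol_fun M V f" "\<And>p u. p \<in> V \<Longrightarrow> u \<in> tangent_space M p \<Longrightarrow> u f = \<theta> p u"
proof -
  have Vop: "openin (mtop M) V" "V \<subseteq> D" unfolding V using chart_preimage_openin[OF c open_ball] by auto
  have im: "\<phi> ` V = ball a r" using V by blast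
  define E where "E = coord_vec D \<phi>"
  have E: "vector_field M V (E i)" for i
    unfolding E_def using coord_vec_field[OF c] Vop(2) by (rule vector_field_subset)
  have near: "hol_near M p f" if "hol_fun M V f" "p \<in> V" for p f using hol_nearI[OF Vop(1)] that by blast
  have pd: "E i p f = pderiv_at i (\<lambda>z. f (inv_into D \<phi> z)) (\<phi> p)" if "hol_fun M V f" "p \<in> V" for i p f
    using near[OF that] by (simp add: E_def coord_vec_def)
  define b where "b = (\<lambda>i z. \<theta> (inv_into D \<phi> z) (E i (inv_into D \<phi> z)))"
  have bh: "hol_fun M V (\<lambda>p. \<theta> p (E i p))" for i
    by (rule one_form_hol[OF \<theta>(1) Vop(1) _ E]) simp
  have holb: "cholomorphic_on (b i) (ball a r)" for i
    using hol_fun_chart[OF c Vop(2) bh[of i]] im by (simp add: b_def)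
  have closed: "pderiv_at i (b j) z = pderiv_at j (b i) z" if z: "z \<in> ball a r" for i j z
  proof -
    obtain p where p: "p \<in> V" "z = \<phi> p" using z im by blast
    have "ext_d M \<theta> (E i) (E j) p = 0"
      using \<theta>(2) Vop E p unfolding closed_form_def biform_eq_def by blast
    moreover have "\<theta> p (lie_bracket M (E i) (E j) p) = 0"
      unfolding E_def using coord_vec_bracket[OF c, of p] p Vop covector_zero[OF one_form_covector[OF \<theta>(1)]]
      by auto
    ultimately have "E i p (\<lambda>r. \<theta> r (E j r)) = E j p (\<lambda>r. \<theta> r (E i r))"
      by (simp add: ext_d_def)
    then show ?thesis using pd[OF bh p(1)] p(2) by (simp add: b_def)
  qed
  obtain F where F: "cholomorphic_on F (ball a r)" "\<And>i z. z \<in> ball a r \<Longrightarrow> pderiv_at i F z = b i z"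
    using poincare[OF holb closed] by blast
  have loc: "F (\<phi> (inv_into D \<phi> z)) = F z" if "z \<in> ball a r" for z
    using that V(2) by (metis f_inv_into_f subsetD)
  have hf: "hol_fun M V (\<lambda>p. F (\<phi> p))"
    unfolding hol_fun_iff
  proof
    fix p assume p: "p \<in> V"
    have "cdiff_at F (\<phi> p)" using F(1) p im by (auto simp: cholomorphic_on_iff)
    then have "cdiff_at (\<lambda>z. F (\<phi> (inv_into D \<phi> z))) (\<phi> p)"
      by (rule cdiff_at_cong[OF open_ball[of a r], rotated 2]) (use p im loc in auto)
    then show "hol_at p (\<lambda>p. F (\<phi> p))" using p Vop by (intro hol_at_chartI[OF c]) auto
  qed
  show ?thesis
  proof (rule that[OF hf])
    fix p u assume p: "p \<in> V" and u: "u \<in> tangent_space M p"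
    have pD: "p \<in> D" using p Vop by blast
    have e: "E i p (\<lambda>p. F (\<phi> p)) = \<theta> p (E i p)" for i
    proof -
      have pa: "\<phi> p \<in> ball a r" using p im by blast
      have "E i p (\<lambda>p. F (\<phi> p)) = pderiv_at i (\<lambda>z. F (\<phi> (inv_into D \<phi> z))) (\<phi> p)"
        by (rule pd[OF hf p])
      also have "\<dots> = pderiv_at i F (\<phi> p)"
        by (rule pderiv_at_cong[OF open_ball pa loc])
      finally show ?thesis using F(2)[OF pa] c pD by (simp add: b_def)
    qed
    have x: "u = (\<Sum>i\<in>UNIV. tscale (u (\<lambda>r. \<phi> r $ i)) (E i p))"
      unfolding E_def by (rule tvec_expansion[OF c pD u])
    have "\<theta> p u = (\<Sum>i\<in>UNIV. u (\<lambda>r. \<phi> r $ i) * \<theta> p (E i p))"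
      by (subst x, rule covector_lincomb[OF one_form_covector[OF \<theta>(1) p]])
        (use vector_field_tangent[OF E p] in blast)
    also have "\<dots> = (\<Sum>i\<in>UNIV. u (\<lambda>r. \<phi> r $ i) * E i p (\<lambda>p. F (\<phi> p)))" by (simp add: e)
    also have "\<dots> = u (\<lambda>p. F (\<phi> p))"
      by (subst (2) x) (simp add: sum_fun_apply)
    finally show "u (\<lambda>p. F (\<phi> p)) = \<theta> p u" ..
  qed
qed

end


section \<open>The normal bundle of a foliation\<close>

lemma vector_space_tscale: "vector_space tscale"
  by unfold_locales (auto simp: tscale_def plus_fun_apply algebra_simps)

text \<open>The functional is prescribed on a basis of \<open>S\<close> enlarged by \<open>u\<close> and extended linearly to the
  space of all operators.\<close>

lemma exists_annihilating_functional:
  assumes sub: "module.subspace tscale S" and u: "u \<notin> S"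
  obtains a :: "'a tvec \<Rightarrow> complex" where "\<And>v w. a (v + w) = a v + a w" "\<And>c v. a (tscale c v) = c * a v"
    "\<And>v. v \<in> S \<Longrightarrow> a v = 0" "a u = 1"
proof -
  interpret V: vector_space "tscale :: complex \<Rightarrow> 'a tvec \<Rightarrow> 'a tvec" by (rule vector_space_tscale)
  interpret C: vector_space "(*) :: complex \<Rightarrow> complex \<Rightarrow> complex"
    by unfold_locales (simp_all add: algebra_simps)
  interpret P: vector_space_pair "tscale :: complex \<Rightarrow> 'a tvec \<Rightarrow> 'a tvec" "(*) :: complex \<Rightarrow> complex \<Rightarrow> complex" ..
  obtain B where B: "B \<subseteq> S" "V.independent B" "S \<subseteq> V.span B"
    using V.maximal_independent_subset by blast
  have "V.span B \<subseteq> S" using V.span_minimal[OF B(1) sub] .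
  then have uB: "u \<notin> V.span B" using u by blast
  then have "V.independent (insert u B)" using B(2) V.independent_insertI by blast
  from P.linear_independent_extend[OF this, of "\<lambda>x. if x = u then 1 else 0"]
  obtain g where g: "Vector_Spaces.linear tscale (*) g" "\<forall>x\<in>insert u B. g x = (if x = u then 1 else 0)" by blast
  interpret g: Vector_Spaces.linear "tscale :: complex \<Rightarrow> 'a tvec \<Rightarrow> 'a tvec" "(*)" g by (rule g(1))
  have "u \<notin> B" using uB V.span_base by blast
  then have gB: "g x = 0" if "x \<in> B" for x using g(2) that by auto
  have "g v = 0" if "v \<in> S" for v
  proof -
    have "v \<in> V.span B" using that B(3) by blast
    then show ?thesis using P.linear_eq_0_on_span[OF g(1) gB] by blast
  qed
  then show ?thesis using that[of g] g.add g.scale g(2) by simp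
qed

locale foliated_mfd = complex_mfd M for M :: "('a, 'n::finite) cmanifold" +
  fixes q :: nat and T :: "'a \<Rightarrow> 'a tvec set"
  assumes foliation: "regular_foliation M q T"
begin

lemma T_fibre:
  assumes "p \<in> topspace (mtop M)"
  shows "\<exists>(k::nat) e. (\<forall>i<k. e i \<in> tangent_space M p) \<and> T p = {\<Sum>i<k. tscale (c i) (e i) | c. True}"
proof -
  obtain k where "holomorphic_subbundle M k T"
    using foliation unfolding regular_foliation_def by blast
  from bspec[OF this[unfolded holomorphic_subbundle_def] assms]
  obtain U e where e: "openin (mtop M) U \<and> p \<in> U \<and> (\<forall>i<k. vector_field M U (e i)) \<and>
       (\<forall>r\<in>U. T r = {\<Sum>i<k. tscale (c i) (e i r) | c. True} \<and>
         (\<forall>c. (\<Sum>i<k. tscale (c i) (e i r)) = 0 \<longrightarrow> (\<forall>i<k. c i = 0)))"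
    by (elim exE)
  show ?thesis
  proof (rule exI[of _ k], rule exI[of _ "\<lambda>i. e i p"], intro conjI allI impI)
    show "e i p \<in> tangent_space M p" if "i < k" for i
      by (rule vector_field_tangent[of U]) (use e that in simp_all)
    show "T p = {\<Sum>i<k. tscale (c i) (e i p) | c. True}" using e by blast
  qed
qed

lemma T_tangent: "p \<in> topspace (mtop M) \<Longrightarrow> u \<in> T p \<Longrightarrow> u \<in> tangent_space M p"
proof -
  assume p: "p \<in> topspace (mtop M)" and u: "u \<in> T p"
  obtain k :: nat and e where
    e: "(\<forall>i<k. e i \<in> tangent_space M p) \<and> T p = {\<Sum>i<k. tscale (c i) (e i) | c. True}"
    using T_fibre[OF p] by (elim exE)
  have "u \<in> {\<Sum>i<k. tscale (c i) (e i) | c. True}" using u e by simp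
  then obtain c where "u = (\<Sum>i<k. tscale (c i) (e i))" by blast
  then show "u \<in> tangent_space M p" using tvec_lincomb[of "{..<k}" e p c] e by simp
qed

lemma T_subspace:
  assumes p: "p \<in> topspace (mtop M)"
  shows "module.subspace tscale (T p)"
proof -
  interpret V: vector_space "tscale :: complex \<Rightarrow> 'a tvec \<Rightarrow> 'a tvec" by (rule vector_space_tscale)
  obtain k :: nat and e where
    "(\<forall>i<k. e i \<in> tangent_space M p) \<and> T p = {\<Sum>i<k. tscale (c i) (e i) | c. True}"
    using T_fibre[OF p] by (elim exE)
  then have e: "T p = {\<Sum>i<k. tscale (c i) (e i) | c. True}" by (rule conjunct2)
  have mem: "(\<Sum>i<k. tscale (c i) (e i)) \<in> T p" for c unfolding e by blast
  show ?thesis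
    unfolding V.subspace_def
  proof (intro conjI ballI allI)
    show "0 \<in> T p" using mem[of "\<lambda>_. 0"] by simp
  next
    fix x y assume "x \<in> T p" "y \<in> T p"
    then obtain c d where "x = (\<Sum>i<k. tscale (c i) (e i))" "y = (\<Sum>i<k. tscale (d i) (e i))"
      unfolding e by blast
    then show "x + y \<in> T p"
      using mem[of "\<lambda>i. c i + d i"] by (simp add: sum.distrib V.scale_left_distrib)
  next
    fix c x assume "x \<in> T p"
    then obtain d where "x = (\<Sum>i<k. tscale (d i) (e i))" unfolding e by blast
    then show "tscale c x \<in> T p"
      using mem[of "\<lambda>i. c * d i"] by (simp add: V.scale_sum_right)
  qed
qed

lemma T_zero: "p \<in> topspace (mtop M) \<Longrightarrow> 0 \<in> T p"
  and T_add: "p \<in> topspace (mtop M) \<Longrightarrow> u \<in> T p \<Longrightarrow> w \<in> T p \<Longrightarrow> u + w \<in> T p"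
  and T_scale: "p \<in> topspace (mtop M) \<Longrightarrow> u \<in> T p \<Longrightarrow> tscale c u \<in> T p"
  and T_diff: "p \<in> topspace (mtop M) \<Longrightarrow> u \<in> T p \<Longrightarrow> w \<in> T p \<Longrightarrow> u - w \<in> T p"
proof -
  interpret V: vector_space "tscale :: complex \<Rightarrow> 'a tvec \<Rightarrow> 'a tvec" by (rule vector_space_tscale)
  show "p \<in> topspace (mtop M) \<Longrightarrow> 0 \<in> T p"
    "p \<in> topspace (mtop M) \<Longrightarrow> u \<in> T p \<Longrightarrow> w \<in> T p \<Longrightarrow> u + w \<in> T p"
    "p \<in> topspace (mtop M) \<Longrightarrow> u \<in> T p \<Longrightarrow> tscale c u \<in> T p"
    "p \<in> topspace (mtop M) \<Longrightarrow> u \<in> T p \<Longrightarrow> w \<in> T p \<Longrightarrow> u - w \<in> T p"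
    using T_subspace V.subspace_0 V.subspace_add V.subspace_scale V.subspace_diff by blast+
qed

lemma coset_eq_iff:
  assumes p: "p \<in> topspace (mtop M)"
  shows "w +o T p = w' +o T p \<longleftrightarrow> w - w' \<in> T p"
proof
  assume "w +o T p = w' +o T p"
  moreover have "w \<in> w +o T p" using T_zero[OF p] unfolding elt_set_plus_def by force
  ultimately obtain t where "t \<in> T p" "w = w' + t" unfolding elt_set_plus_def by blast
  then show "w - w' \<in> T p" by simp
next
  have sub: "a +o T p \<subseteq> b +o T p" if "a - b \<in> T p" for a b
  proof
    fix x assume "x \<in> a +o T p"
    then obtain t where t: "t \<in> T p" "x = a + t" unfolding elt_set_plus_def by blast
    then have "x = b + ((a - b) + t)" by simp
    then show "x \<in> b +o T p" using T_add[OF p that t(1)] unfolding elt_set_plus_def by blast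
  qed
  assume "w - w' \<in> T p"
  moreover from this have "w' - w \<in> T p" using T_diff[OF p T_zero[OF p]] by fastforce
  ultimately show "w +o T p = w' +o T p" using sub by blast
qed

lemma coset_add:
  assumes p: "p \<in> topspace (mtop M)"
  shows "(w +o T p) + (w' +o T p) = (w + w') +o T p"
proof -
  have "T p + T p = T p"
  proof
    show "T p + T p \<subseteq> T p" using T_add[OF p] by (auto elim!: set_plus_elim)
    show "T p \<subseteq> T p + T p"
    proof
      fix t assume "t \<in> T p"
      then have "0 + t \<in> T p + T p" using T_zero[OF p] by (rule set_plus_intro[rotated])
      then show "t \<in> T p + T p" by simp
    qed
  qed
  then show ?thesis by (simp add: set_plus_rearrange)
qed

lemma nscale_coset:
  assumes p: "p \<in> topspace (mtop M)"
  shows "nscale T p c (w +o T p) = tscale c w +o T p"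
proof
  interpret V: vector_space "tscale :: complex \<Rightarrow> 'a tvec \<Rightarrow> 'a tvec" by (rule vector_space_tscale)
  show "nscale T p c (w +o T p) \<subseteq> tscale c w +o T p"
  proof
    fix x assume "x \<in> nscale T p c (w +o T p)"
    then obtain t t' where t: "t \<in> T p" "t' \<in> T p" "x = tscale c (w + t) + t'"
      unfolding nscale_def set_plus_def elt_set_plus_def by blast
    then have "x = tscale c w + (tscale c t + t')" by (simp add: V.scale_right_distrib add.assoc)
    then show "x \<in> tscale c w +o T p"
      using T_add[OF p T_scale[OF p t(1)] t(2)] unfolding elt_set_plus_def by blast
  qed
  show "tscale c w +o T p \<subseteq> nscale T p c (w +o T p)"
  proof
    fix x assume "x \<in> tscale c w +o T p"
    then obtain t where t: "t \<in> T p" "x = tscale c w + t" unfolding elt_set_plus_def by blast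
    moreover have "tscale c w \<in> tscale c ` (w +o T p)"
      using T_zero[OF p] unfolding elt_set_plus_def by force
    ultimately show "x \<in> nscale T p c (w +o T p)" unfolding nscale_def set_plus_def by blast
  qed
qed

lemma pairing_coset:
  assumes p: "p \<in> topspace (mtop M)" and a: "a \<in> conormal_space M T p" and w: "w \<in> tangent_space M p"
  shows "pairing a (w +o T p) = a w"
proof -
  have "a x = a w" if x: "x \<in> w +o T p" for x
  proof -
    obtain t where t: "t \<in> T p" "x = w + t" using x unfolding elt_set_plus_def by blast
    then show ?thesis
      using a covector_add[of p a w t] T_tangent[OF p] w by (simp add: conormal_space_def)
  qed
  moreover have "w \<in> w +o T p" using T_zero[OF p] unfolding elt_set_plus_def by force
  ultimately have "a ` (w +o T p) = {a w}" by blast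
  then show ?thesis by (simp add: pairing_def)
qed

lemma normal_spaceE:
  assumes "A \<in> normal_space M T p"
  obtains w where "w \<in> tangent_space M p" "A = w +o T p"
  using assms unfolding normal_space_def by blast

lemma normal_spaceI: "w \<in> tangent_space M p \<Longrightarrow> w +o T p \<in> normal_space M T p"
  unfolding normal_space_def by blast

lemma normal_space_add:
  assumes p: "p \<in> topspace (mtop M)" and "A \<in> normal_space M T p" "B \<in> normal_space M T p"
  shows "A + B \<in> normal_space M T p"
    and "a \<in> conormal_space M T p \<Longrightarrow> pairing a (A + B) = pairing a A + pairing a B"
proof -
  obtain v where v: "v \<in> tangent_space M p" "A = v +o T p" using assms(2) by (rule normal_spaceE)
  obtain w where w: "w \<in> tangent_space M p" "B = w +o T p" using assms(3) by (rule normal_spaceE)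
  have AB: "A + B = (v + w) +o T p" using v w coset_add[OF p] by simp
  then show "A + B \<in> normal_space M T p" using normal_spaceI[OF tvec_plus[OF v(1) w(1)]] by simp
  assume a: "a \<in> conormal_space M T p"
  then have "a (v + w) = a v + a w" using covector_add v w unfolding conormal_space_def by blast
  then show "pairing a (A + B) = pairing a A + pairing a B"
    unfolding AB using v w by (simp add: pairing_coset[OF p a] tvec_plus)
qed

lemma normal_space_scale:
  assumes p: "p \<in> topspace (mtop M)" and "A \<in> normal_space M T p"
  shows "nscale T p c A \<in> normal_space M T p"
    and "a \<in> conormal_space M T p \<Longrightarrow> pairing a (nscale T p c A) = c * pairing a A"
proof -
  obtain v where v: "v \<in> tangent_space M p" "A = v +o T p" using assms(2) by (rule normal_spaceE)
  have c: "nscale T p c A = tscale c v +o T p" using v nscale_coset[OF p] by simp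
  then show "nscale T p c A \<in> normal_space M T p" using normal_spaceI[OF tvec_scale[OF v(1)]] by simp
  assume a: "a \<in> conormal_space M T p"
  then have "a (tscale c v) = c * a v" using covector_scale v unfolding conormal_space_def by blast
  then show "pairing a (nscale T p c A) = c * pairing a A"
    unfolding c using v by (simp add: pairing_coset[OF p a] tvec_scale)
qed

lemma normal_section_space:
  assumes "normal_section M T V s" "p \<in> V"
  shows "s p \<in> normal_space M T p"
proof -
  obtain V' w where "openin (mtop M) V' \<and> p \<in> V' \<and> V' \<subseteq> V \<and> vector_field M V' w \<and>
      (\<forall>r\<in>V'. s r = normal_class T w r)"
    using bspec[OF assms(1)[unfolded normal_section_def] assms(2)] by (elim exE)
  then have V': "p \<in> V'" "vector_field M V' w" "\<forall>r\<in>V'. s r = normal_class T w r" by simp_all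
  then have "s p = w p +o T p" by (simp add: normal_class_def)
  then show ?thesis using normal_spaceI[OF vector_field_tangent[OF V'(2,1)]] by simp
qed

lemma normal_section_class:
  assumes "openin (mtop M) V" "vector_field M V w"
  shows "normal_section M T V (normal_class T w)"
  unfolding normal_section_def using assms by blast

lemma normal_section_subset:
  assumes "openin (mtop M) V'" "V' \<subseteq> V" "normal_section M T V s"
  shows "normal_section M T V' s"
  unfolding normal_section_def
proof
  fix p assume p: "p \<in> V'"
  obtain W w where "openin (mtop M) W \<and> p \<in> W \<and> W \<subseteq> V \<and> vector_field M W w \<and>
      (\<forall>r\<in>W. s r = normal_class T w r)"
    using bspec[OF assms(3)[unfolded normal_section_def] subsetD[OF assms(2) p]] by (elim exE)
  then have W: "openin (mtop M) W" "p \<in> W" "vector_field M W w" "\<forall>r\<in>W. s r = normal_class T w r"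
    by simp_all
  have "openin (mtop M) (V' \<inter> W)" "p \<in> V' \<inter> W" "V' \<inter> W \<subseteq> V'" "vector_field M (V' \<inter> W) w"
    "\<forall>r\<in>V' \<inter> W. s r = normal_class T w r"
    using W p assms(1) vector_field_subset[OF W(3), of "V' \<inter> W"] by (simp_all add: openin_Int)
  then show "\<exists>V w. openin (mtop M) V \<and> p \<in> V \<and> V \<subseteq> V' \<and> vector_field M V w \<and> (\<forall>r\<in>V. s r = normal_class T w r)"
    by blast
qed

text \<open>Locally the section is the class of a vector field \<open>w\<close>, and the pairing is the function
  \<open>\<theta>(w)\<close>.\<close>

lemma pairing_hol:
  assumes V: "openin (mtop M) V" and \<theta>: "one_form M V \<theta>" "\<And>p. p \<in> V \<Longrightarrow> \<theta> p \<in> conormal_space M T p"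
    and s: "normal_section M T V s"
  shows "hol_fun M V (\<lambda>r. pairing (\<theta> r) (s r))"
  unfolding hol_fun_iff
proof
  fix p assume p: "p \<in> V"
  obtain W w where "openin (mtop M) W \<and> p \<in> W \<and> W \<subseteq> V \<and> vector_field M W w \<and>
      (\<forall>r\<in>W. s r = normal_class T w r)"
    using bspec[OF s[unfolded normal_section_def] p] by (elim exE)
  then have W: "openin (mtop M) W" "p \<in> W" "W \<subseteq> V" "vector_field M W w" "\<forall>r\<in>W. s r = normal_class T w r"
    by simp_all
  have "hol_fun M W (\<lambda>r. \<theta> r (w r))" by (rule one_form_hol[OF \<theta>(1) W(1,3,4)])
  then have h: "hol_at p (\<lambda>r. \<theta> r (w r))" using W(2) by (simp add: hol_fun_iff)
  have eq: "\<theta> r (w r) = pairing (\<theta> r) (s r)" if r: "r \<in> W" for r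
  proof -
    have rt: "r \<in> topspace (mtop M)" using r openin_subset[OF W(1)] by (rule subsetD[rotated])
    have "pairing (\<theta> r) (w r +o T r) = \<theta> r (w r)"
      by (rule pairing_coset[OF rt \<theta>(2)[OF subsetD[OF W(3) r]] vector_field_tangent[OF W(4) r]])
    then show ?thesis using W(5) r by (simp add: normal_class_def)
  qed
  show "hol_at p (\<lambda>r. pairing (\<theta> r) (s r))"
    by (rule hol_at_cong[OF W(1,2) eq h])
qed

lemma zero_conormal: "(\<lambda>_. 0) \<in> conormal_space M T p"
  by (simp add: conormal_space_def covector_def)

lemma first_integrals_subset: "first_integrals M q T U f \<Longrightarrow> V \<subseteq> U \<Longrightarrow> first_integrals M q T V f"
  unfolding first_integrals_def hol_fun_iff by blast

lemma differential_one_form: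
  assumes "openin (mtop M) U" "hol_fun M U f"
  shows "one_form M U (differential f)"
  unfolding one_form_def differential_def
proof (intro conjI ballI allI impI)
  show "covector M p (\<lambda>u. u f)" for p
    by (simp add: covector_def plus_fun_apply)
  fix V v assume "openin (mtop M) V \<and> V \<subseteq> U \<and> vector_field M V v"
  then show "hol_fun M V (\<lambda>p. v p f)"
    using vector_field_hol[of V v V f] hol_fun_subset[OF assms(2), of V] by simp
qed

end

section \<open>The connection defined by first integrals\<close>

text \<open>First integrals together with vector fields dual to their differentials trivialise the
  normal bundle; the connection below is the trivial one in this trivialisation.\<close>

locale first_integral_frame = foliated_mfd M q T
  for M :: "('a, 'n::finite) cmanifold" and q T +
  fixes U :: "'a set" and f :: "nat \<Rightarrow> 'a \<Rightarrow> complex" and X :: "nat \<Rightarrow> 'a \<Rightarrow> 'a tvec"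
  assumes U: "openin (mtop M) U"
    and integrals: "first_integrals M q T U f"
    and X: "\<And>j. j < q \<Longrightarrow> vector_field M U (X j)"
    and X_dual: "\<And>r i j. r \<in> U \<Longrightarrow> i < q \<Longrightarrow> j < q \<Longrightarrow> X j r (f i) = (if i = j then 1 else 0)"
begin

lemma U_top: "p \<in> U \<Longrightarrow> p \<in> topspace (mtop M)"
  using U openin_subset by blast

lemma f_hol: "i < q \<Longrightarrow> hol_fun M U (f i)"
  using integrals unfolding first_integrals_def by blast

lemma f_near: "i < q \<Longrightarrow> p \<in> U \<Longrightarrow> hol_near M p (f i)"
  using hol_nearI[OF U] f_hol by blast

lemma T_iff: "p \<in> U \<Longrightarrow> u \<in> T p \<longleftrightarrow> u \<in> tangent_space M p \<and> (\<forall>i<q. u (f i) = 0)"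
proof -
  assume "p \<in> U"
  then have "T p = {u \<in> tangent_space M p. \<forall>i<q. differential (f i) p u = 0}"
    using integrals unfolding first_integrals_def by blast
  then show ?thesis by (simp add: differential_def)
qed

lemma df_form: "i < q \<Longrightarrow> one_form M U (differential (f i))"
  using differential_one_form[OF U] f_hol by blast

lemma df_conormal: "i < q \<Longrightarrow> p \<in> U \<Longrightarrow> differential (f i) p \<in> conormal_space M T p"
  using one_form_covector[OF df_form] T_iff[of p]
  by (simp add: conormal_space_def differential_def)

definition lift :: "(nat \<Rightarrow> complex) \<Rightarrow> 'a \<Rightarrow> 'a tvec"
  where "lift c p = (\<Sum>j<q. tscale (c j) (X j p))"

lemma lift_tangent: "p \<in> U \<Longrightarrow> lift c p \<in> tangent_space M p"
  unfolding lift_def by (rule tvec_lincomb) (simp add: vector_field_tangent[OF X])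

lemma lift_f:
  assumes "p \<in> U" "i < q"
  shows "lift c p (f i) = c i"
proof -
  have "lift c p (f i) = (\<Sum>j<q. c j * X j p (f i))" by (simp add: lift_def sum_fun_apply)
  also have "\<dots> = (\<Sum>j<q. if i = j then c j else 0)"
    by (rule sum.cong) (use X_dual assms in auto)
  finally show ?thesis using assms by simp
qed

lemma pairing_class: "i < q \<Longrightarrow> p \<in> U \<Longrightarrow> w \<in> tangent_space M p \<Longrightarrow>
    pairing (differential (f i) p) (w +o T p) = w (f i)"
  using pairing_coset[OF U_top df_conormal] by (simp add: differential_def)

text \<open>Every identity for the connection is proved through this criterion, which reduces it to an
  identity between derivatives of functions.\<close>

lemma normal_eqI:
  assumes p: "p \<in> U" and A: "A \<in> normal_space M T p" and B: "B \<in> normal_space M T p"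
    and eq: "\<And>i. i < q \<Longrightarrow> pairing (differential (f i) p) A = pairing (differential (f i) p) B"
  shows "A = B"
proof -
  obtain v where v: "v \<in> tangent_space M p" "A = v +o T p" using A by (rule normal_spaceE)
  obtain w where w: "w \<in> tangent_space M p" "B = w +o T p" using B by (rule normal_spaceE)
  have "v (f i) = w (f i)" if "i < q" for i
    using eq[OF that] v w pairing_class[OF that p] by simp
  then have "v - w \<in> T p" using T_iff[OF p] tvec_minus[OF v(1) w(1)] by simp
  then show ?thesis using coset_eq_iff[OF U_top[OF p]] v w by simp
qed

definition frame_coord :: "nat \<Rightarrow> ('a \<Rightarrow> 'a tvec set) \<Rightarrow> 'a \<Rightarrow> complex"
  where "frame_coord i s r = pairing (differential (f i) r) (s r)"

definition frame_conn :: "'a conn"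
  where "frame_conn s p u = lift (\<lambda>j. u (frame_coord j s)) p +o T p"

lemma frame_conn_normal: "p \<in> U \<Longrightarrow> frame_conn s p u \<in> normal_space M T p"
  unfolding frame_conn_def by (rule normal_spaceI[OF lift_tangent])

lemma frame_conn_pairing: "i < q \<Longrightarrow> p \<in> U \<Longrightarrow> pairing (differential (f i) p) (frame_conn s p u) = u (frame_coord i s)"
  unfolding frame_conn_def using pairing_class[OF _ _ lift_tangent] lift_f by simp

lemma frame_coord_conn: "i < q \<Longrightarrow> p \<in> U \<Longrightarrow> frame_coord i (\<lambda>r. frame_conn s r (w r)) p = w p (frame_coord i s)"
  unfolding frame_coord_def[of i "\<lambda>r. frame_conn s r (w r)"] by (rule frame_conn_pairing)

lemma frame_coord_class: "i < q \<Longrightarrow> vector_field M V w \<Longrightarrow> V \<subseteq> U \<Longrightarrow> p \<in> V \<Longrightarrow> frame_coord i (normal_class T w) p = w p (f i)"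
  unfolding frame_coord_def normal_class_def using pairing_class[of i p "w p"] vector_field_tangent by blast

lemma frame_coord_hol:
  assumes "openin (mtop M) V" "V \<subseteq> U" "normal_section M T V s" "i < q"
  shows "hol_fun M V (frame_coord i s)"
proof -
  have "hol_fun M V (\<lambda>r. pairing (differential (f i) r) (s r))"
    by (rule pairing_hol[OF assms(1) one_form_subset[OF df_form[OF assms(4)] assms(2)] _ assms(3)])
      (use df_conormal[OF assms(4)] assms(2) in blast)
  then show ?thesis by (simp add: frame_coord_def[abs_def])
qed

lemma lift_field:
  assumes "V \<subseteq> U" "\<And>j. j < q \<Longrightarrow> hol_fun M V (c j)"
  shows "vector_field M V (\<lambda>p. lift (\<lambda>j. c j p) p)"
  unfolding lift_def
  by (rule vector_field_lincomb) (use vector_field_subset[OF X assms(1)] assms(2) in simp_all)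

lemma frame_conn_section:
  assumes V: "openin (mtop M) V" "V \<subseteq> U" and s: "normal_section M T V s" and v: "vector_field M V v"
  shows "normal_section M T V (\<lambda>p. frame_conn s p (v p))"
proof -
  have "vector_field M V (\<lambda>p. lift (\<lambda>j. v p (frame_coord j s)) p)"
    by (rule lift_field[OF V(2)]) (rule vector_field_hol[OF v V(1) subset_refl frame_coord_hol[OF V s]])
  from normal_section_class[OF V(1) this]
  show ?thesis by (simp add: frame_conn_def normal_class_def[abs_def])
qed

lemma frame_conn_connection: "connection M T U frame_conn"
  unfolding connection_def
proof (intro allI impI)
  fix V s assume as: "openin (mtop M) V \<and> V \<subseteq> U \<and> normal_section M T V s"
  then have V: "openin (mtop M) V" "V \<subseteq> U" and s: "normal_section M T V s" by auto
  have near: "hol_near M p (frame_coord i t)" if "p \<in> V" "i < q" "normal_section M T V t" for p i t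
    by (rule hol_nearI[OF V(1) that(1) frame_coord_hol[OF V that(3,2)]])
  have loc: "frame_conn s' p u = frame_conn s p u" if "\<forall>p\<in>V. s' p = s p" "p \<in> V" "u \<in> tangent_space M p" for s' p u
  proof (rule normal_eqI)
    show pU: "p \<in> U" using that V by blast
    show "frame_conn s' p u \<in> normal_space M T p" "frame_conn s p u \<in> normal_space M T p" using frame_conn_normal[OF pU] by auto
    fix i assume i: "i < q"
    have "u (frame_coord i s') = u (frame_coord i s)"
      by (rule tvec_cong[OF that(3) V(1) that(2)]) (use that(1) in \<open>simp add: frame_coord_def\<close>)
    then show "pairing (differential (f i) p) (frame_conn s' p u) = pairing (differential (f i) p) (frame_conn s p u)"
      using frame_conn_pairing[OF i pU] by simp
  qed
  have form: "normal_valued_form M T V (frame_conn s)"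
    unfolding normal_valued_form_def
  proof (intro conjI ballI allI impI)
    fix p u assume p: "p \<in> V" and u: "u \<in> tangent_space M p"
    have pU: "p \<in> U" using p V by blast
    note pt = U_top[OF pU]
    show "frame_conn s p u \<in> normal_space M T p" by (rule frame_conn_normal[OF pU])
    show "frame_conn s p (u + w) = frame_conn s p u + frame_conn s p w" if "w \<in> tangent_space M p" for w
      by (rule normal_eqI[OF pU]) (simp_all add: frame_conn_normal[OF pU] normal_space_add[OF pt] df_conormal[OF _ pU]
          frame_conn_pairing[OF _ pU] plus_fun_apply)
    show "frame_conn s p (tscale c u) = nscale T p c (frame_conn s p u)" for c
      by (rule normal_eqI[OF pU]) (simp_all add: frame_conn_normal[OF pU] normal_space_scale[OF pt] df_conormal[OF _ pU]
          frame_conn_pairing[OF _ pU])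
  next
    fix V' v assume "openin (mtop M) V' \<and> V' \<subseteq> V \<and> vector_field M V' v"
    then have V': "openin (mtop M) V'" "V' \<subseteq> V" "vector_field M V' v" by auto
    show "normal_section M T V' (\<lambda>p. frame_conn s p (v p))"
      by (rule frame_conn_section[OF V'(1) order_trans[OF V'(2) V(2)] normal_section_subset[OF V'(1,2) s] V'(3)])
  qed
  have add: "frame_conn (\<lambda>r. s r + t r) p u = frame_conn s p u + frame_conn t p u"
    if t: "normal_section M T V t" and p: "p \<in> V" and u: "u \<in> tangent_space M p" for t p u
  proof (rule normal_eqI)
    show pU: "p \<in> U" using p V by blast
    note pt = U_top[OF pU]
    show "frame_conn (\<lambda>r. s r + t r) p u \<in> normal_space M T p" by (rule frame_conn_normal[OF pU])
    show "frame_conn s p u + frame_conn t p u \<in> normal_space M T p"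
      by (intro normal_space_add(1)[OF pt] frame_conn_normal[OF pU])
    fix i assume i: "i < q"
    have "u (frame_coord i (\<lambda>r. s r + t r)) = u (\<lambda>r. frame_coord i s r + frame_coord i t r)"
    proof (rule tvec_cong[OF u V(1) p])
      fix r assume r: "r \<in> V"
      then have rU: "r \<in> U" using V by blast
      show "frame_coord i (\<lambda>r. s r + t r) r = frame_coord i s r + frame_coord i t r"
        unfolding frame_coord_def
        by (rule normal_space_add(2)[OF U_top[OF rU] normal_section_space[OF s r]
            normal_section_space[OF t r] df_conormal[OF i rU]])
    qed
    also have "\<dots> = u (frame_coord i s) + u (frame_coord i t)"
      by (rule tvec_add[OF u near[OF p i s] near[OF p i t]])
    finally show "pairing (differential (f i) p) (frame_conn (\<lambda>r. s r + t r) p u) =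
        pairing (differential (f i) p) (frame_conn s p u + frame_conn t p u)"
      by (simp add: frame_conn_pairing[OF i pU] normal_space_add(2)[OF pt frame_conn_normal[OF pU] frame_conn_normal[OF pU] df_conormal[OF i pU]])
  qed
  have leib: "frame_conn (\<lambda>r. nscale T r (g r) (s r)) p u =
      nscale T p (g p) (frame_conn s p u) + nscale T p (differential g p u) (s p)"
    if g: "hol_fun M V g" and p: "p \<in> V" and u: "u \<in> tangent_space M p" for g p u
  proof (rule normal_eqI)
    show pU: "p \<in> U" using p V by blast
    note pt = U_top[OF pU]
    note sp = normal_section_space[OF s p]
    show "frame_conn (\<lambda>r. nscale T r (g r) (s r)) p u \<in> normal_space M T p" by (rule frame_conn_normal[OF pU])
    show "nscale T p (g p) (frame_conn s p u) + nscale T p (differential g p u) (s p) \<in> normal_space M T p"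
      by (intro normal_space_add(1)[OF pt] normal_space_scale(1)[OF pt] frame_conn_normal[OF pU] sp)
    fix i assume i: "i < q"
    have "u (frame_coord i (\<lambda>r. nscale T r (g r) (s r))) = u (\<lambda>r. g r * frame_coord i s r)"
    proof (rule tvec_cong[OF u V(1) p])
      fix r assume r: "r \<in> V"
      then have rU: "r \<in> U" using V by blast
      show "frame_coord i (\<lambda>r. nscale T r (g r) (s r)) r = g r * frame_coord i s r"
        unfolding frame_coord_def
        by (rule normal_space_scale(2)[OF U_top[OF rU] normal_section_space[OF s r] df_conormal[OF i rU]])
    qed
    also have "\<dots> = g p * u (frame_coord i s) + frame_coord i s p * u g"
      by (rule tvec_mult[OF u hol_nearI[OF V(1) p g] near[OF p i s]])
    finally show "pairing (differential (f i) p) (frame_conn (\<lambda>r. nscale T r (g r) (s r)) p u) =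
        pairing (differential (f i) p) (nscale T p (g p) (frame_conn s p u) + nscale T p (differential g p u) (s p))"
      using frame_conn_pairing[OF i pU] df_conormal[OF i pU]
      by (simp add: normal_space_add(2)[OF pt] normal_space_scale[OF pt] frame_conn_normal[OF pU] sp
          differential_def[of g] frame_coord_def[of i s p])
  qed
  show "(\<forall>s'. (\<forall>p\<in>V. s' p = s p) \<longrightarrow> (\<forall>p\<in>V. \<forall>u\<in>tangent_space M p. frame_conn s' p u = frame_conn s p u)) \<and>
       normal_valued_form M T V (frame_conn s) \<and>
       (\<forall>t. normal_section M T V t \<longrightarrow>
          (\<forall>p\<in>V. \<forall>u\<in>tangent_space M p. frame_conn (\<lambda>r. s r + t r) p u = frame_conn s p u + frame_conn t p u)) \<and>
       (\<forall>f. hol_fun M V f \<longrightarrow>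
          (\<forall>p\<in>V. \<forall>u\<in>tangent_space M p. frame_conn (\<lambda>r. nscale T r (f r) (s r)) p u =
             nscale T p (f p) (frame_conn s p u) + nscale T p (differential f p u) (s p)))"
    by (intro conjI allI impI ballI) (rule loc form add leib; assumption)+
qed

text \<open>In coordinates the curvature is \<open>v(w(s\<^sub>i)) - w(v(s\<^sub>i)) - [v,w](s\<^sub>i)\<close>.\<close>

lemma frame_conn_flat: "flat_connection M T U frame_conn"
  unfolding flat_connection_def
proof (intro conjI allI impI ballI)
  show "connection M T U frame_conn" by (rule frame_conn_connection)
  fix V v w s p
  assume as: "openin (mtop M) V \<and> V \<subseteq> U \<and> vector_field M V v \<and> vector_field M V w \<and> normal_section M T V s"
    and p: "p \<in> V"
  then have V: "openin (mtop M) V" "V \<subseteq> U" and vw: "vector_field M V v" "vector_field M V w"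
    and s: "normal_section M T V s" by auto
  have pU: "p \<in> U" using p V by blast
  note pt = U_top[OF pU]
  show "frame_conn (\<lambda>r. frame_conn s r (w r)) p (v p) = frame_conn (\<lambda>r. frame_conn s r (v r)) p (w p) + frame_conn s p (lie_bracket M v w p)"
  proof (rule normal_eqI[OF pU])
    show "frame_conn (\<lambda>r. frame_conn s r (v r)) p (w p) + frame_conn s p (lie_bracket M v w p) \<in> normal_space M T p"
      by (intro normal_space_add(1)[OF pt] frame_conn_normal[OF pU])
    fix i assume i: "i < q"
    have swap: "x p (frame_coord i (\<lambda>r. frame_conn s r (y r))) = x p (\<lambda>r. y r (frame_coord i s))" if "vector_field M V x" for x y
      by (rule tvec_cong[OF vector_field_tangent[OF that p] V(1) p]) (use frame_coord_conn[OF i] V in blast)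
    have "hol_near M p (frame_coord i s)" by (rule hol_nearI[OF V(1) p frame_coord_hol[OF V s i]])
    then have "v p (frame_coord i (\<lambda>r. frame_conn s r (w r))) =
        w p (frame_coord i (\<lambda>r. frame_conn s r (v r))) + lie_bracket M v w p (frame_coord i s)"
      by (simp add: lie_bracket_apply swap[OF vw(1)] swap[OF vw(2)])
    then show "pairing (differential (f i) p) (frame_conn (\<lambda>r. frame_conn s r (w r)) p (v p)) =
        pairing (differential (f i) p) (frame_conn (\<lambda>r. frame_conn s r (v r)) p (w p) + frame_conn s p (lie_bracket M v w p))"
      by (simp add: frame_conn_pairing[OF i pU]
          normal_space_add(2)[OF pt frame_conn_normal[OF pU] frame_conn_normal[OF pU] df_conormal[OF i pU]])
  qed (rule frame_conn_normal[OF pU])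
qed

text \<open>The \<open>i\<close>-th coordinate of \<open>[v,w]\<close> is \<open>v(w(f\<^sup>i)) - w(v(f\<^sup>i))\<close>, and \<open>v(f\<^sup>i)\<close> vanishes
  identically for \<open>v\<close> tangent to the foliation.\<close>

lemma frame_conn_bott: "restricts_to_bott M T U frame_conn"
  unfolding restricts_to_bott_def
proof (intro allI impI ballI)
  fix V v w p
  assume as: "openin (mtop M) V \<and> V \<subseteq> U \<and> tangent_field M T V v \<and> vector_field M V w" and p: "p \<in> V"
  then have V: "openin (mtop M) V" "V \<subseteq> U" and v: "vector_field M V v" "\<And>r. r \<in> V \<Longrightarrow> v r \<in> T r"
    and w: "vector_field M V w" by (auto simp: tangent_field_def)
  have pU: "p \<in> U" using p V by blast
  have b: "lie_bracket M v w p \<in> tangent_space M p"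
    by (rule vector_field_tangent[OF lie_bracket_field[OF V(1) v(1) w] p])
  show "frame_conn (normal_class T w) p (v p) = bott M T v w p"
    unfolding bott_def normal_class_def[of T "lie_bracket M v w"]
  proof (rule normal_eqI[OF pU frame_conn_normal[OF pU] normal_spaceI[OF b]])
    fix i assume i: "i < q"
    have "v p (frame_coord i (normal_class T w)) = v p (\<lambda>r. w r (f i))"
      by (rule tvec_cong[OF vector_field_tangent[OF v(1) p] V(1) p]) (rule frame_coord_class[OF i w V(2)])
    moreover have "w p (\<lambda>r. v r (f i)) = w p (\<lambda>_. 0)"
      by (rule tvec_cong[OF vector_field_tangent[OF w p] V(1) p]) (use v(2) T_iff i V(2) in blast)
    ultimately show "pairing (differential (f i) p) (frame_conn (normal_class T w) p (v p)) =
        pairing (differential (f i) p) (lie_bracket M v w p +o T p)"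
      using tvec_const[OF vector_field_tangent[OF w p]]
      by (simp add: frame_conn_pairing[OF i pU] pairing_class[OF i pU b] lie_bracket_apply[OF f_near[OF i pU]])
  qed
qed

text \<open>The differentials span the conormal space at \<open>p\<close>, since a tangent vector differs from the
  combination of the \<open>X j p\<close> with the same coordinates by an element of \<open>T p\<close>.\<close>

lemma differentials_parallel_frame: "closed_parallel_frame M q T U frame_conn (\<lambda>i. differential (f i))"
  unfolding closed_parallel_frame_def conormal_frame_def
proof (intro conjI allI impI ballI)
  fix i assume i: "i < q"
  show "one_form M U (differential (f i))" by (rule df_form[OF i])
  show "differential (f i) p \<in> conormal_space M T p" if "p \<in> U" for p by (rule df_conormal[OF i that])
  show "closed_form M U (differential (f i))"
    unfolding closed_form_def biform_eq_def
  proof (intro allI impI ballI)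
    fix V v w p assume "openin (mtop M) V \<and> V \<subseteq> U \<and> vector_field M V v \<and> vector_field M V w" "p \<in> V"
    then have "hol_near M p (f i)" using f_near[OF i] by blast
    then show "ext_d M (differential (f i)) v w p = 0"
      by (simp add: ext_d_def differential_def lie_bracket_apply)
  qed
  show "parallel M T U frame_conn (differential (f i))"
    unfolding parallel_def dual_connection_eq_def
  proof (intro allI impI ballI)
    fix V s p u
    assume as: "openin (mtop M) V \<and> V \<subseteq> U \<and> normal_section M T V s" and p: "p \<in> V" and u: "u \<in> tangent_space M p"
    then have pU: "p \<in> U" and sp: "s p \<in> normal_space M T p"
      using normal_section_space[of V s p] by auto
    obtain w where w: "w \<in> tangent_space M p" "s p = w +o T p" using sp by (rule normal_spaceE)
    have "dual_derivative frame_conn (differential (f i)) p u s = 0"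
      using frame_conn_pairing[OF i pU, of s u]
      unfolding dual_derivative_def differential_def[of "\<lambda>r. pairing (differential (f i) r) (s r)"] frame_coord_def[abs_def]
      by simp
    also have "\<dots> = pairing (\<lambda>w. 0) (s p)"
      using w pairing_coset[OF U_top[OF pU] zero_conormal w(1)] by simp
    finally show "dual_derivative frame_conn (differential (f i)) p u s = pairing (\<lambda>w. 0) (s p)" .
  qed
next
  fix p assume p: "p \<in> U"
  then show "covectors_independent M q p (\<lambda>i. differential (f i) p)"
    using integrals unfolding first_integrals_def by blast
  fix a assume a: "a \<in> conormal_space M T p"
  then have cov: "covector M p a" and aT: "\<And>u. u \<in> T p \<Longrightarrow> a u = 0" by (auto simp: conormal_space_def)
  have "a u = (\<Sum>i<q. a (X i p) * differential (f i) p u)" if u: "u \<in> tangent_space M p" for u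
  proof -
    let ?l = "lift (\<lambda>i. u (f i)) p"
    have l: "?l \<in> tangent_space M p" by (rule lift_tangent[OF p])
    have "u - ?l \<in> T p" using T_iff[OF p] tvec_minus[OF u l] lift_f[OF p] by simp
    then have "a u = a ?l" using aT covector_minus[OF cov u l] by simp
    also have "\<dots> = (\<Sum>i<q. u (f i) * a (X i p))"
      unfolding lift_def by (rule covector_lincomb[OF cov]) (simp add: vector_field_tangent[OF X p])
    finally show ?thesis by (simp add: differential_def mult.commute)
  qed
  then show "\<exists>c. \<forall>u\<in>tangent_space M p. a u = (\<Sum>i<q. c i * differential (f i) p u)"
    by - (rule exI[of _ "\<lambda>i. a (X i p)"], rule ballI)
qed

end

context foliated_mfd
begin

text \<open>The neighbourhood shrinks so that fields dual to the differentials exist on it.\<close>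

lemma first_integrals_imp_connection:
  assumes U: "openin (mtop M) U" "x \<in> U" and f: "first_integrals M q T U f"
  obtains V nabla \<theta> where "openin (mtop M) V" "x \<in> V" "V \<subseteq> U" "first_integrals M q T V f"
    "flat_connection M T V nabla" "restricts_to_bott M T V nabla" "closed_parallel_frame M q T V nabla \<theta>"
proof -
  have form: "one_form M U (differential (f i))" if "i < q" for i
    using differential_one_form[OF U(1), of "f i"] f that unfolding first_integrals_def by simp
  have ind: "covectors_independent M q x (\<lambda>i. differential (f i) x)"
    using f U(2) unfolding first_integrals_def by simp
  have "\<exists>V X. openin (mtop M) V \<and> x \<in> V \<and> V \<subseteq> U \<and> (\<forall>j<q. vector_field M V (X j)) \<and>
      (\<forall>r\<in>V. \<forall>i<q. \<forall>j<q. differential (f i) r (X j r) = (if i = j then 1 else 0))"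
    by (rule independent_dual_frame[where \<theta> = "\<lambda>i. differential (f i)", OF U _ ind]) (rule form)
  then obtain V X where VX: "openin (mtop M) V \<and> x \<in> V \<and> V \<subseteq> U \<and> (\<forall>j<q. vector_field M V (X j)) \<and>
      (\<forall>r\<in>V. \<forall>i<q. \<forall>j<q. differential (f i) r (X j r) = (if i = j then 1 else 0))"
    by (elim exE)
  then have V: "openin (mtop M) V" "x \<in> V" "V \<subseteq> U"
    and X: "\<forall>j<q. vector_field M V (X j)"
      "\<forall>r\<in>V. \<forall>i<q. \<forall>j<q. differential (f i) r (X j r) = (if i = j then 1 else 0)"
    by simp_all
  have fV: "first_integrals M q T V f" by (rule first_integrals_subset[OF f V(3)])
  interpret F: first_integral_frame M q T V f X
    by unfold_locales (use V(1) fV X in \<open>simp_all add: differential_def\<close>)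
  show ?thesis
    by (rule that[OF V fV F.frame_conn_flat F.frame_conn_bott F.differentials_parallel_frame])
qed

text \<open>The first integrals are primitives of the frame over a ball in a chart.\<close>

lemma closed_conormal_frame_imp_first_integrals:
  assumes U: "openin (mtop M) U" "x \<in> U" and fr: "conormal_frame M q T U \<theta>"
    and cl: "\<And>i. i < q \<Longrightarrow> closed_form M U (\<theta> i)"
  obtains V f where "openin (mtop M) V" "x \<in> V" "V \<subseteq> U" "first_integrals M q T V f"
proof -
  have "x \<in> topspace (mtop M)" using U openin_subset by blast
  then obtain D \<phi> where c: "(D, \<phi>) \<in> atlas M" "x \<in> D" by (rule chart_at)
  obtain r where r: "r > 0" "ball (\<phi> x) r \<subseteq> \<phi> ` (D \<inter> U)" "{s \<in> D. \<phi> s \<in> ball (\<phi> x) r} \<subseteq> D \<inter> U"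
    "openin (mtop M) {s \<in> D. \<phi> s \<in> ball (\<phi> x) r}" "x \<in> {s \<in> D. \<phi> s \<in> ball (\<phi> x) r}"
    by (rule ball_in_chart[OF c(1) U(1) IntI[OF c(2) U(2)]])
  define V where "V = {s \<in> D. \<phi> s \<in> ball (\<phi> x) r}"
  have V: "openin (mtop M) V" "x \<in> V" "V \<subseteq> U" using r unfolding V_def by blast+
  have form: "one_form M V (\<theta> i)" "closed_form M V (\<theta> i)" if "i < q" for i
  proof -
    show "one_form M V (\<theta> i)" using fr that V(3) one_form_subset unfolding conormal_frame_def by blast
    show "closed_form M V (\<theta> i)"
      using cl[OF that] V(3) unfolding closed_form_def biform_eq_def by (meson order_trans)
  qed
  have "\<exists>f. hol_fun M V f \<and> (\<forall>p\<in>V. \<forall>u\<in>tangent_space M p. u f = \<theta> i p u)" if i: "i < q" for i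
  proof -
    have "ball (\<phi> x) r \<subseteq> \<phi> ` D" using r(2) by blast
    then obtain g where g: "hol_fun M V g" "\<And>p u. p \<in> V \<Longrightarrow> u \<in> tangent_space M p \<Longrightarrow> u g = \<theta> i p u"
      using closed_form_exact[OF c(1) V_def _ form[OF i]] by metis
    show ?thesis using g by (intro exI[of _ g]) simp
  qed
  then have "\<forall>i. \<exists>f. i < q \<longrightarrow> hol_fun M V f \<and> (\<forall>p\<in>V. \<forall>u\<in>tangent_space M p. u f = \<theta> i p u)"
    by blast
  from choice[OF this] obtain f where
    "\<forall>i. i < q \<longrightarrow> hol_fun M V (f i) \<and> (\<forall>p\<in>V. \<forall>u\<in>tangent_space M p. u (f i) = \<theta> i p u)"
    by (elim exE)
  then have f: "\<And>i. i < q \<Longrightarrow> hol_fun M V (f i)"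
    "\<And>i p u. i < q \<Longrightarrow> p \<in> V \<Longrightarrow> u \<in> tangent_space M p \<Longrightarrow> u (f i) = \<theta> i p u"
    by simp_all
  have "first_integrals M q T V f"
    unfolding first_integrals_def
  proof (intro conjI allI impI ballI)
    show "hol_fun M V (f i)" if "i < q" for i by (rule f(1)[OF that])
    fix p assume p: "p \<in> V"
    then have pt: "p \<in> topspace (mtop M)" using V(1) openin_subset by blast
    have ind: "covectors_independent M q p (\<lambda>i. \<theta> i p)"
      and span: "\<And>a. a \<in> conormal_space M T p \<Longrightarrow> \<exists>c. \<forall>u\<in>tangent_space M p. a u = (\<Sum>i<q. c i * \<theta> i p u)"
      and con: "\<And>i. i < q \<Longrightarrow> \<theta> i p \<in> conormal_space M T p"
      using fr p V(3) unfolding conormal_frame_def by blast+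
    have eq: "differential (f i) p u = \<theta> i p u" if "i < q" "u \<in> tangent_space M p" for i u
      using f(2)[OF that(1) p that(2)] by (simp add: differential_def)
    show "covectors_independent M q p (\<lambda>i. differential (f i) p)"
      using ind eq unfolding covectors_independent_def by simp
    show "T p = {u \<in> tangent_space M p. \<forall>i<q. differential (f i) p u = 0}"
    proof (intro set_eqI iffI)
      fix u assume u: "u \<in> T p"
      then show "u \<in> {u \<in> tangent_space M p. \<forall>i<q. differential (f i) p u = 0}"
        using eq T_tangent[OF pt u] con by (simp add: conormal_space_def)
    next
      fix u assume "u \<in> {u \<in> tangent_space M p. \<forall>i<q. differential (f i) p u = 0}"
      then have u: "u \<in> tangent_space M p" "\<And>i. i < q \<Longrightarrow> \<theta> i p u = 0" using eq by auto
      show "u \<in> T p"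
      proof (rule ccontr)
        assume "u \<notin> T p"
        then obtain a :: "'a covec" where a: "\<And>v w. a (v + w) = a v + a w" "\<And>c v. a (tscale c v) = c * a v"
          "\<And>v. v \<in> T p \<Longrightarrow> a v = 0" "a u = 1"
          using exists_annihilating_functional[OF T_subspace[OF pt]] by blast
        then have "a \<in> conormal_space M T p" by (simp add: conormal_space_def covector_def)
        then obtain c where "\<forall>u\<in>tangent_space M p. a u = (\<Sum>i<q. c i * \<theta> i p u)" using span by blast
        then show False using u a(4) by simp
      qed
    qed
  qed
  then show ?thesis using that[OF V] by blast
qed

end


section \<open>The connection matrix in an arbitrary conormal frame\<close>

context foliated_mfd
begin

lemma conormal_frameD:
  assumes "conormal_frame M q T V \<omega>"
  shows "i < q \<Longrightarrow> one_form M V (\<omega> i)"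
    and "i < q \<Longrightarrow> p \<in> V \<Longrightarrow> \<omega> i p \<in> conormal_space M T p"
    and "p \<in> V \<Longrightarrow> covectors_independent M q p (\<lambda>i. \<omega> i p)"
    and "p \<in> V \<Longrightarrow> a \<in> conormal_space M T p \<Longrightarrow> \<exists>c. \<forall>u\<in>tangent_space M p. a u = (\<Sum>i<q. c i * \<omega> i p u)"
  using assms unfolding conormal_frame_def by simp_all

lemma conormal_frame_subset:
  assumes "conormal_frame M q T U \<omega>" "V \<subseteq> U"
  shows "conormal_frame M q T V \<omega>"
  using assms one_form_subset[OF _ assms(2)] unfolding conormal_frame_def by (simp add: subset_iff)

text \<open>The coefficients exist pointwise because \<open>\<theta>\<close> is a frame. They are holomorphic because they are
  the values of \<open>\<omega>\<close> on the local fields dual to \<open>\<theta>\<close>.\<close>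

lemma frame_change:
  assumes V: "openin (mtop M) V" and \<theta>: "conormal_frame M q T V \<theta>" and \<omega>: "conormal_frame M q T V \<omega>"
  shows "\<exists>g. (\<forall>i<q. \<forall>j<q. hol_fun M V (g i j)) \<and>
    (\<forall>j<q. \<forall>p\<in>V. \<forall>u\<in>tangent_space M p. \<omega> j p u = (\<Sum>i<q. g i j p * \<theta> i p u))"
proof -
  \<comment> \<open>The choice is made separately at each point; uniqueness of the coefficients will make it
    holomorphic.\<close>
  define g where "g = (\<lambda>i j p. (SOME c. \<forall>u\<in>tangent_space M p. \<omega> j p u = (\<Sum>i<q. c i * \<theta> i p u)) i)"
  have g: "\<forall>u\<in>tangent_space M p. \<omega> j p u = (\<Sum>i<q. g i j p * \<theta> i p u)" if "j < q" "p \<in> V" for j p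
    unfolding g_def
    by (rule someI_ex[of "\<lambda>c. \<forall>u\<in>tangent_space M p. \<omega> j p u = (\<Sum>i<q. c i * \<theta> i p u)"])
      (rule conormal_frameD(4)[OF \<theta> that(2) conormal_frameD(2)[OF \<omega> that]])
  have "hol_fun M V (g i j)" if i: "i < q" and j: "j < q" for i j
    unfolding hol_fun_iff
  proof
    fix p assume p: "p \<in> V"
    have "\<exists>W X. openin (mtop M) W \<and> p \<in> W \<and> W \<subseteq> V \<and> (\<forall>j<q. vector_field M W (X j)) \<and>
        (\<forall>r\<in>W. \<forall>i<q. \<forall>j<q. \<theta> i r (X j r) = (if i = j then 1 else 0))"
      by (rule independent_dual_frame[where \<theta> = \<theta>, OF V p _ conormal_frameD(3)[OF \<theta> p]])
        (rule conormal_frameD(1)[OF \<theta>])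
    then obtain W X where WX: "openin (mtop M) W \<and> p \<in> W \<and> W \<subseteq> V \<and> (\<forall>j<q. vector_field M W (X j)) \<and>
        (\<forall>r\<in>W. \<forall>i<q. \<forall>j<q. \<theta> i r (X j r) = (if i = j then 1 else 0))"
      by (elim exE)
    then have W: "openin (mtop M) W" "p \<in> W" "W \<subseteq> V" and X: "vector_field M W (X i)"
      and dual: "\<And>r k. r \<in> W \<Longrightarrow> k < q \<Longrightarrow> \<theta> k r (X i r) = (if k = i then 1 else 0)"
      using i by simp_all
    have h: "hol_at p (\<lambda>r. \<omega> j r (X i r))"
      using one_form_hol[OF conormal_frameD(1)[OF \<omega> j] W(1,3) X] W(2) by (simp add: hol_fun_iff)
    have eq: "\<omega> j r (X i r) = g i j r" if r: "r \<in> W" for r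
    proof -
      have "\<omega> j r (X i r) = (\<Sum>k<q. g k j r * \<theta> k r (X i r))"
        using g[OF j subsetD[OF W(3) r]] vector_field_tangent[OF X r] by simp
      also have "\<dots> = (\<Sum>k<q. if k = i then g k j r else 0)"
        by (rule sum.cong) (simp_all add: dual[OF r])
      also have "\<dots> = g i j r" using i by simp
      finally show ?thesis .
    qed
    show "hol_at p (g i j)" by (rule hol_at_cong[OF W(1,2) eq h])
  qed
  then show ?thesis using g by (intro exI[of _ g]) simp
qed

text \<open>Substituting one base change into the other expresses \<open>\<omega>\<close> through itself, and coefficients with
  respect to independent covectors are unique.\<close>

lemma frame_change_inverse:
  assumes ind: "covectors_independent M q p (\<lambda>i. \<omega> i p)"
    and g: "\<And>j u. j < q \<Longrightarrow> u \<in> tangent_space M p \<Longrightarrow> \<omega> j p u = (\<Sum>k<q. g k j * \<theta> k p u)"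
    and h: "\<And>k u. k < q \<Longrightarrow> u \<in> tangent_space M p \<Longrightarrow> \<theta> k p u = (\<Sum>i<q. h i k * \<omega> i p u)"
    and ij: "i < q" "j < q"
  shows "(\<Sum>k<q. h i k * g k j) = (if i = j then 1 else 0)"
proof -
  let ?c = "\<lambda>i. (\<Sum>k<q. h i k * g k j) - (if i = j then 1 else 0)"
  have "(\<Sum>i<q. ?c i * \<omega> i p u) = 0" if u: "u \<in> tangent_space M p" for u
  proof -
    have "\<omega> j p u = (\<Sum>k<q. g k j * (\<Sum>i<q. h i k * \<omega> i p u))"
      unfolding g[OF ij(2) u] by (rule sum.cong) (simp_all add: h[OF _ u])
    also have "\<dots> = (\<Sum>k<q. \<Sum>i<q. h i k * g k j * \<omega> i p u)"
      by (simp add: sum_distrib_left mult_ac)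
    also have "\<dots> = (\<Sum>i<q. (\<Sum>k<q. h i k * g k j) * \<omega> i p u)"
      by (subst sum.swap) (simp add: sum_distrib_right)
    finally have "\<omega> j p u = (\<Sum>i<q. (\<Sum>k<q. h i k * g k j) * \<omega> i p u)" .
    moreover have "\<omega> j p u = (\<Sum>i<q. (if i = j then 1 else 0) * \<omega> i p u)"
      using ij(2) by (simp add: if_distrib[of "\<lambda>x. x * _"] cong: if_cong)
    ultimately show ?thesis by (simp add: left_diff_distrib sum_subtractf)
  qed
  with spec[OF ind[unfolded covectors_independent_def], of ?c] have "\<forall>i<q. ?c i = 0" by blast
  from spec[OF this, of i] ij(1) show ?thesis by simp
qed

end

text \<open>Here \<open>\<omega> = \<theta> g\<close> and \<open>\<theta> = \<omega> h\<close> for row vectors, so \<open>h\<close> is the inverse matrix of \<open>g\<close>.\<close>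

locale conormal_frame_change = foliated_mfd M q T
  for M :: "('a, 'n::finite) cmanifold" and q T +
  fixes V :: "'a set" and \<theta> \<omega> :: "nat \<Rightarrow> 'a \<Rightarrow> 'a covec" and g h :: "nat \<Rightarrow> nat \<Rightarrow> 'a \<Rightarrow> complex"
  assumes V: "openin (mtop M) V"
    and \<theta>: "conormal_frame M q T V \<theta>" and \<omega>: "conormal_frame M q T V \<omega>"
    and g_hol: "\<And>i j. i < q \<Longrightarrow> j < q \<Longrightarrow> hol_fun M V (g i j)"
    and h_hol: "\<And>i j. i < q \<Longrightarrow> j < q \<Longrightarrow> hol_fun M V (h i j)"
    and g: "\<And>j p u. j < q \<Longrightarrow> p \<in> V \<Longrightarrow> u \<in> tangent_space M p \<Longrightarrow> \<omega> j p u = (\<Sum>i<q. g i j p * \<theta> i p u)"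
    and h: "\<And>j p u. j < q \<Longrightarrow> p \<in> V \<Longrightarrow> u \<in> tangent_space M p \<Longrightarrow> \<theta> j p u = (\<Sum>i<q. h i j p * \<omega> i p u)"
begin

lemma hg: "p \<in> V \<Longrightarrow> i < q \<Longrightarrow> j < q \<Longrightarrow> (\<Sum>k<q. h i k p * g k j p) = (if i = j then 1 else 0)"
  by (rule frame_change_inverse[where p = p and g = "\<lambda>i j. g i j p" and h = "\<lambda>i j. h i j p"
        and \<omega> = \<omega> and \<theta> = \<theta>]) (rule conormal_frameD(3)[OF \<omega>] g h; assumption)+

lemma gh: "p \<in> V \<Longrightarrow> i < q \<Longrightarrow> j < q \<Longrightarrow> (\<Sum>k<q. g i k p * h k j p) = (if i = j then 1 else 0)"
  by (rule frame_change_inverse[where p = p and g = "\<lambda>i j. h i j p" and h = "\<lambda>i j. g i j p"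
        and \<omega> = \<theta> and \<theta> = \<omega>]) (rule conormal_frameD(3)[OF \<theta>] g h; assumption)+



lemma g_near: "p \<in> V \<Longrightarrow> i < q \<Longrightarrow> j < q \<Longrightarrow> hol_near M p (g i j)"
  and h_near: "p \<in> V \<Longrightarrow> i < q \<Longrightarrow> j < q \<Longrightarrow> hol_near M p (h i j)"
  by (rule hol_nearI[OF V _ g_hol], assumption+) (rule hol_nearI[OF V _ h_hol], assumption+)

text \<open>The matrix \<open>g\<^sup>-\<^sup>1 dg\<close>.\<close>

definition eta :: "nat \<Rightarrow> nat \<Rightarrow> 'a \<Rightarrow> 'a covec"
  where "eta i j p u = (\<Sum>k<q. h i k p * u (g k j))"

lemma eta_form:
  assumes ij: "i < q" "j < q"
  shows "one_form M V (eta i j)"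
  unfolding one_form_def
proof (intro conjI ballI allI impI)
  fix p
  show "covector M p (eta i j p)"
    by (simp add: covector_def eta_def plus_fun_apply distrib_left sum.distrib sum_distrib_left mult_ac)
next
  fix W v assume "openin (mtop M) W \<and> W \<subseteq> V \<and> vector_field M W v"
  then have W: "openin (mtop M) W" "W \<subseteq> V" and v: "vector_field M W v" by auto
  have gv: "hol_fun M W (\<lambda>p. v p (g k j))" if "k < q" for k
    by (rule vector_field_hol[OF v W(1) subset_refl hol_fun_subset[OF g_hol[OF that ij(2)] W(2)]])
  have hW: "hol_fun M W (h i k)" if "k < q" for k
    by (rule hol_fun_subset[OF h_hol[OF ij(1) that] W(2)])
  show "hol_fun M W (\<lambda>p. eta i j p (v p))"
    unfolding hol_fun_iff eta_def
    by (intro ballI hol_at_sum hol_at_mult) (use gv hW in \<open>simp_all add: hol_fun_iff\<close>)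
qed

text \<open>This is \<open>\<omega> \<eta> = \<theta> dg\<close> in the two arguments \<open>u\<close> and \<open>w\<close>; antisymmetrising it yields
  \<open>\<omega> \<and> \<eta> = \<theta> \<and> dg\<close>.\<close>

lemma omega_eta:
  assumes "p \<in> V" "j < q" "u \<in> tangent_space M p"
  shows "(\<Sum>i<q. \<omega> i p u * eta i j p w) = (\<Sum>k<q. \<theta> k p u * w (g k j))"
proof -
  have "(\<Sum>i<q. \<omega> i p u * eta i j p w) = (\<Sum>k<q. \<Sum>i<q. h i k p * \<omega> i p u * w (g k j))"
    unfolding eta_def sum_distrib_left by (subst sum.swap) (simp add: mult_ac)
  also have "\<dots> = (\<Sum>k<q. \<theta> k p u * w (g k j))"
    by (rule sum.cong) (simp_all add: h[OF _ assms(1,3)] sum_distrib_right)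
  finally show ?thesis .
qed

text \<open>\<open>d(\<theta> g) = - \<theta> \<and> dg\<close>, as \<open>\<theta>\<close> is closed.\<close>

lemma ext_d_omega:
  assumes cl: "\<And>i. i < q \<Longrightarrow> closed_form M V (\<theta> i)" and j: "j < q"
  shows "biform_eq M V (ext_d M (\<omega> j)) (\<lambda>v w p. - (\<Sum>i<q. wedge (\<omega> i) (eta i j) v w p))"
  unfolding biform_eq_def
proof (intro allI impI ballI)
  fix W v w p assume as: "openin (mtop M) W \<and> W \<subseteq> V \<and> vector_field M W v \<and> vector_field M W w" and p: "p \<in> W"
  then have W: "openin (mtop M) W" "W \<subseteq> V" and vw: "vector_field M W v" "vector_field M W w" by auto
  have pV: "p \<in> V" using p W by blast
  have tv: "v p \<in> tangent_space M p" "w p \<in> tangent_space M p"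
    using vector_field_tangent[OF vw(1) p] vector_field_tangent[OF vw(2) p] .
  have tb: "lie_bracket M v w p \<in> tangent_space M p"
    by (rule vector_field_tangent[OF lie_bracket_field[OF W(1) vw] p])
  have D: "a p (\<lambda>r. \<omega> j r (b r)) = (\<Sum>k<q. g k j p * a p (\<lambda>r. \<theta> k r (b r)) + \<theta> k p (b p) * a p (g k j))"
    if a: "vector_field M W a" and b: "vector_field M W b" for a b
  proof -
    note ta = vector_field_tangent[OF a p]
    have n: "hol_near M p (\<lambda>r. \<theta> k r (b r))" if "k < q" for k
      by (rule hol_nearI[OF W(1) p one_form_hol[OF conormal_frameD(1)[OF \<theta> that] W b]])
    have "a p (\<lambda>r. \<omega> j r (b r)) = a p (\<lambda>r. \<Sum>k<q. g k j r * \<theta> k r (b r))"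
      by (rule tvec_cong[OF ta W(1) p]) (rule g[OF j subsetD[OF W(2)] vector_field_tangent[OF b]])
    also have "\<dots> = (\<Sum>k<q. a p (\<lambda>r. g k j r * \<theta> k r (b r)))"
      by (rule tvec_sum[OF ta]) (simp add: hol_near_mult g_near[OF pV _ j] n)
    also have "\<dots> = (\<Sum>k<q. g k j p * a p (\<lambda>r. \<theta> k r (b r)) + \<theta> k p (b p) * a p (g k j))"
      by (rule sum.cong) (simp_all add: tvec_mult[OF ta g_near[OF pV _ j] n])
    finally show ?thesis .
  qed
  have cl': "v p (\<lambda>r. \<theta> k r (w r)) - w p (\<lambda>r. \<theta> k r (v r)) - \<theta> k p (lie_bracket M v w p) = 0" if "k < q" for k
    using cl[OF that] as p unfolding closed_form_def biform_eq_def ext_d_def by blast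
  have "ext_d M (\<omega> j) v w p =
     (\<Sum>k<q. g k j p * (v p (\<lambda>r. \<theta> k r (w r)) - w p (\<lambda>r. \<theta> k r (v r)) - \<theta> k p (lie_bracket M v w p)))
     + (\<Sum>k<q. \<theta> k p (w p) * v p (g k j)) - (\<Sum>k<q. \<theta> k p (v p) * w p (g k j))"
    unfolding ext_d_def D[OF vw] D[OF vw(2,1)] g[OF j pV tb]
    by (simp add: sum.distrib sum_subtractf right_diff_distrib)
  also have "\<dots> = (\<Sum>k<q. \<theta> k p (w p) * v p (g k j)) - (\<Sum>k<q. \<theta> k p (v p) * w p (g k j))"
    by (simp add: cl')
  also have "\<dots> = - (\<Sum>i<q. wedge (\<omega> i) (eta i j) v w p)"
    unfolding wedge_def by (simp add: sum_subtractf omega_eta[OF pV j] tv)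
  finally show "ext_d M (\<omega> j) v w p = - (\<Sum>i<q. wedge (\<omega> i) (eta i j) v w p)" .
qed

text \<open>\<open>\<nabla>\<^sup>*(\<theta> g) = \<theta> dg\<close>, as \<open>\<theta>\<close> is parallel.\<close>

lemma dual_connection_omega:
  assumes conn: "connection M T V nabla" and par: "\<And>i. i < q \<Longrightarrow> parallel M T V nabla (\<theta> i)" and j: "j < q"
  shows "dual_connection_eq M T V nabla (\<omega> j) (\<lambda>p u w. \<Sum>i<q. \<omega> i p w * eta i j p u)"
  unfolding dual_connection_eq_def
proof (intro allI impI ballI)
  fix W s p u
  assume as: "openin (mtop M) W \<and> W \<subseteq> V \<and> normal_section M T W s" and p: "p \<in> W" and u: "u \<in> tangent_space M p"
  then have W: "openin (mtop M) W" "W \<subseteq> V" and s: "normal_section M T W s" by auto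
  have pV: "p \<in> V" using p W by blast
  have top: "r \<in> topspace (mtop M)" if "r \<in> W" for r using that openin_subset[OF W(1)] by blast
  have \<theta>c: "\<theta> k r \<in> conormal_space M T r" and \<omega>c: "\<omega> k r \<in> conormal_space M T r" if "k < q" "r \<in> W" for k r
    using conormal_frameD(2)[OF \<theta> that(1)] conormal_frameD(2)[OF \<omega> that(1)] that(2) W(2) by blast+
  have pair: "pairing (\<omega> j r) A = (\<Sum>k<q. g k j r * pairing (\<theta> k r) A)"
    if r: "r \<in> W" and A: "A \<in> normal_space M T r" for r A
  proof -
    obtain a where a: "a \<in> tangent_space M r" "A = a +o T r" using A by (rule normal_spaceE)
    have "pairing (\<theta> k r) A = \<theta> k r a" if "k < q" for k
      unfolding a(2) by (rule pairing_coset[OF top[OF r] \<theta>c[OF that r] a(1)])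
    moreover have "pairing (\<omega> j r) A = \<omega> j r a"
      unfolding a(2) by (rule pairing_coset[OF top[OF r] \<omega>c[OF j r] a(1)])
    ultimately show ?thesis using g[OF j subsetD[OF W(2) r] a(1)] by simp
  qed
  have sr: "s r \<in> normal_space M T r" if "r \<in> W" for r by (rule normal_section_space[OF s that])
  obtain w where w: "w \<in> tangent_space M p" "s p = w +o T p" using sr[OF p] by (rule normal_spaceE)
  have "normal_valued_form M T W (nabla s)"
    using conn W s unfolding connection_def by blast
  then have ns: "nabla s p u \<in> normal_space M T p"
    using p u unfolding normal_valued_form_def by blast
  have z: "pairing (\<lambda>w. 0) (s p) = 0"
    unfolding w(2) by (rule pairing_coset[OF top[OF p] zero_conormal w(1)])
  have par': "u (\<lambda>r. pairing (\<theta> k r) (s r)) = pairing (\<theta> k p) (nabla s p u)" if "k < q" for k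
  proof -
    have "dual_derivative nabla (\<theta> k) p u s = pairing (\<lambda>w. 0) (s p)"
      using par[OF that] as p u unfolding parallel_def dual_connection_eq_def by blast
    then show ?thesis by (simp add: z dual_derivative_def differential_def)
  qed
  have n: "hol_near M p (\<lambda>r. pairing (\<theta> k r) (s r))" if "k < q" for k
  proof (rule hol_nearI[OF W(1) p pairing_hol[OF W(1) _ _ s]])
    show "one_form M W (\<theta> k)" by (rule one_form_subset[OF conormal_frameD(1)[OF \<theta> that] W(2)])
  qed (rule \<theta>c[OF that])
  have \<theta>s: "pairing (\<theta> k p) (s p) = \<theta> k p w" if "k < q" for k
    unfolding w(2) by (rule pairing_coset[OF top[OF p] \<theta>c[OF that p] w(1)])
  have "u (\<lambda>r. pairing (\<omega> j r) (s r)) = u (\<lambda>r. \<Sum>k<q. g k j r * pairing (\<theta> k r) (s r))"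
    by (rule tvec_cong[OF u W(1) p]) (rule pair[OF _ sr])
  also have "\<dots> = (\<Sum>k<q. u (\<lambda>r. g k j r * pairing (\<theta> k r) (s r)))"
    by (rule tvec_sum[OF u]) (simp add: hol_near_mult g_near[OF pV _ j] n)
  also have "\<dots> = (\<Sum>k<q. g k j p * pairing (\<theta> k p) (nabla s p u) + \<theta> k p w * u (g k j))"
    by (rule sum.cong) (simp_all add: tvec_mult[OF u g_near[OF pV _ j] n] par' \<theta>s)
  finally have "dual_derivative nabla (\<omega> j) p u s = (\<Sum>k<q. \<theta> k p w * u (g k j))"
    by (simp add: dual_derivative_def differential_def pair[OF p ns] sum.distrib)
  also have "\<dots> = (\<Sum>i<q. \<omega> i p w * eta i j p u)" by (rule omega_eta[OF pV j w(1), symmetric])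
  also have "\<dots> = pairing (\<lambda>w. \<Sum>i<q. \<omega> i p w * eta i j p u) (s p)"
  proof -
    have cov: "covector M p (\<omega> i p)" if "i < q" for i
      using \<omega>c[OF that p] unfolding conormal_space_def by simp
    have "(\<lambda>w. \<Sum>i<q. \<omega> i p w * eta i j p u) \<in> conormal_space M T p"
      using \<omega>c[OF _ p] unfolding conormal_space_def covector_def
      by (simp add: distrib_right sum.distrib sum_distrib_left mult.assoc)
    from pairing_coset[OF top[OF p] this w(1)] show ?thesis unfolding w(2) by simp
  qed
  finally show "dual_derivative nabla (\<omega> j) p u s = pairing (\<lambda>w. \<Sum>i<q. \<omega> i p w * eta i j p u) (s p)" .
qed

text \<open>Differentiating \<open>h g = 1\<close> gives \<open>h dg = - dh g\<close>.\<close>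

lemma eta_Leibniz:
  assumes p: "p \<in> V" and ij: "i < q" "j < q" and a: "a \<in> tangent_space M p"
  shows "eta i j p a = - (\<Sum>l<q. a (h i l) * g l j p)"
proof -
  have "0 = a (\<lambda>r. if i = j then 1 else 0)" using tvec_const[OF a] by simp
  also have "\<dots> = a (\<lambda>r. \<Sum>l<q. h i l r * g l j r)"
    by (rule tvec_cong[OF a V p]) (simp add: hg ij)
  also have "\<dots> = (\<Sum>l<q. a (\<lambda>r. h i l r * g l j r))"
    by (rule tvec_sum[OF a]) (simp add: hol_near_mult g_near[OF p _ ij(2)] h_near[OF p ij(1)])
  also have "\<dots> = (\<Sum>l<q. h i l p * a (g l j) + g l j p * a (h i l))"
    by (rule sum.cong) (simp_all add: tvec_mult[OF a h_near[OF p ij(1)] g_near[OF p _ ij(2)]])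
  finally show ?thesis by (simp add: eta_def sum.distrib mult.commute add_eq_0_iff2)
qed

text \<open>\<open>\<eta> \<eta> = (- dh g) (h dg) = - dh dg\<close>. The wedge product is the antisymmetrisation of this
  identity in the two arguments \<open>a\<close> and \<open>b\<close>.\<close>

lemma eta_eta:
  assumes p: "p \<in> V" and ij: "i < q" "j < q" and a: "a \<in> tangent_space M p"
  shows "(\<Sum>k<q. eta i k p a * eta k j p b) = - (\<Sum>l<q. a (h i l) * b (g l j))"
proof -
  have "(\<Sum>k<q. eta i k p a * eta k j p b)
      = - (\<Sum>k<q. \<Sum>l<q. \<Sum>m<q. a (h i l) * (g l k p * h k m p * b (g m j)))"
    by (simp add: eta_Leibniz[OF p ij(1) _ a] eta_def[of _ j] sum_product sum_negf mult_ac)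
  also have "(\<Sum>k<q. \<Sum>l<q. \<Sum>m<q. a (h i l) * (g l k p * h k m p * b (g m j)))
      = (\<Sum>l<q. \<Sum>m<q. a (h i l) * b (g m j) * (\<Sum>k<q. g l k p * h k m p))"
    by (subst sum.swap, rule sum.cong[OF refl], subst sum.swap) (simp add: sum_distrib_left mult_ac)
  also have "\<dots> = (\<Sum>l<q. \<Sum>m<q. if l = m then a (h i l) * b (g m j) else 0)"
    by (intro sum.cong refl) (simp add: gh[OF p])
  also have "\<dots> = (\<Sum>l<q. a (h i l) * b (g l j))" by simp
  finally show ?thesis .
qed

text \<open>\<open>d(h dg) = dh \<and> dg\<close>, which \<open>\<eta> \<and> \<eta>\<close> cancels.\<close>

lemma eta_flat:
  assumes ij: "i < q" "j < q"
  shows "biform_eq M V (\<lambda>v w p. ext_d M (eta i j) v w p + (\<Sum>k<q. wedge (eta i k) (eta k j) v w p)) (\<lambda>v w p. 0)"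
  unfolding biform_eq_def
proof (intro allI impI ballI)
  fix W v w p assume as: "openin (mtop M) W \<and> W \<subseteq> V \<and> vector_field M W v \<and> vector_field M W w" and p: "p \<in> W"
  then have W: "openin (mtop M) W" "W \<subseteq> V" and vw: "vector_field M W v" "vector_field M W w" by auto
  have pV: "p \<in> V" using p W by blast
  have tv: "v p \<in> tangent_space M p" "w p \<in> tangent_space M p"
    using vector_field_tangent[OF vw(1) p] vector_field_tangent[OF vw(2) p] .
  have D: "a p (\<lambda>r. eta i j r (b r)) = (\<Sum>k<q. h i k p * a p (\<lambda>r. b r (g k j)) + b p (g k j) * a p (h i k))"
    if a: "vector_field M W a" and b: "vector_field M W b" for a b
  proof -
    note ta = vector_field_tangent[OF a p]
    have n: "hol_near M p (\<lambda>r. b r (g k j))" if "k < q" for k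
      by (rule hol_nearI[OF W(1) p vector_field_hol[OF b W(1) subset_refl hol_fun_subset[OF g_hol[OF that ij(2)] W(2)]]])
    have "a p (\<lambda>r. eta i j r (b r)) = (\<Sum>k<q. a p (\<lambda>r. h i k r * b r (g k j)))"
      unfolding eta_def by (rule tvec_sum[OF ta]) (simp add: hol_near_mult h_near[OF pV ij(1)] n)
    also have "\<dots> = (\<Sum>k<q. h i k p * a p (\<lambda>r. b r (g k j)) + b p (g k j) * a p (h i k))"
      by (rule sum.cong) (simp_all add: tvec_mult[OF ta h_near[OF pV ij(1)] n])
    finally show ?thesis .
  qed
  have b: "eta i j p (lie_bracket M v w p) =
      (\<Sum>k<q. h i k p * (v p (\<lambda>r. w r (g k j)) - w p (\<lambda>r. v r (g k j))))"
    unfolding eta_def by (rule sum.cong) (simp_all add: lie_bracket_apply[OF g_near[OF pV _ ij(2)]])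
  have "ext_d M (eta i j) v w p = (\<Sum>k<q. v p (h i k) * w p (g k j)) - (\<Sum>k<q. w p (h i k) * v p (g k j))"
    unfolding ext_d_def D[OF vw] D[OF vw(2,1)] b
    by (simp add: sum.distrib sum_subtractf right_diff_distrib mult.commute)
  moreover have "(\<Sum>k<q. wedge (eta i k) (eta k j) v w p)
      = - (\<Sum>k<q. v p (h i k) * w p (g k j)) + (\<Sum>k<q. w p (h i k) * v p (g k j))"
    unfolding wedge_def
    using eta_eta[OF pV ij tv(1), of "w p"] eta_eta[OF pV ij tv(2), of "v p"]
    by (simp add: sum_subtractf)
  ultimately show "ext_d M (eta i j) v w p + (\<Sum>k<q. wedge (eta i k) (eta k j) v w p) = 0" by simp
qed

end

context foliated_mfd
begin

lemma connection_subset: "connection M T U nabla \<Longrightarrow> V \<subseteq> U \<Longrightarrow> connection M T V nabla"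
  unfolding connection_def by (meson order_trans)

lemma parallel_subset: "parallel M T U nabla \<alpha> \<Longrightarrow> V \<subseteq> U \<Longrightarrow> parallel M T V nabla \<alpha>"
  unfolding parallel_def dual_connection_eq_def by (meson order_trans)

lemma closed_form_subset: "closed_form M U \<alpha> \<Longrightarrow> V \<subseteq> U \<Longrightarrow> closed_form M V \<alpha>"
  unfolding closed_form_def biform_eq_def by (meson order_trans)

lemma connection_matrix:
  assumes U: "V \<subseteq> U" and V: "openin (mtop M) V" and conn: "connection M T U nabla"
    and fr: "closed_parallel_frame M q T U nabla \<theta>" and \<omega>: "conormal_frame M q T V \<omega>"
  shows "\<exists>\<eta>. (\<forall>i<q. \<forall>j<q. one_form M V (\<eta> i j)) \<and>
          (\<forall>j<q. biform_eq M V (ext_d M (\<omega> j))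
             (\<lambda>v w p. - (\<Sum>i<q. wedge (\<omega> i) (\<eta> i j) v w p))) \<and>
          (\<forall>j<q. dual_connection_eq M T V nabla (\<omega> j)
             (\<lambda>p u w. \<Sum>i<q. \<omega> i p w * \<eta> i j p u)) \<and>
          (\<forall>i<q. \<forall>j<q. biform_eq M V
             (\<lambda>v w p. ext_d M (\<eta> i j) v w p + (\<Sum>k<q. wedge (\<eta> i k) (\<eta> k j) v w p))
             (\<lambda>v w p. 0))"
proof -
  have \<theta>: "conormal_frame M q T V \<theta>"
    using fr conormal_frame_subset[OF _ U] unfolding closed_parallel_frame_def by blast
  have cl: "closed_form M V (\<theta> i)" and par: "parallel M T V nabla (\<theta> i)" if "i < q" for i
  proof -
    have "closed_form M U (\<theta> i)" "parallel M T U nabla (\<theta> i)"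
      using fr that unfolding closed_parallel_frame_def by simp_all
    then show "closed_form M V (\<theta> i)" "parallel M T V nabla (\<theta> i)"
      using closed_form_subset[OF _ U] parallel_subset[OF _ U] by simp_all
  qed
  obtain g where g: "(\<forall>i<q. \<forall>j<q. hol_fun M V (g i j)) \<and>
    (\<forall>j<q. \<forall>p\<in>V. \<forall>u\<in>tangent_space M p. \<omega> j p u = (\<Sum>i<q. g i j p * \<theta> i p u))"
    using frame_change[OF V \<theta> \<omega>] by (elim exE)
  obtain h where h: "(\<forall>i<q. \<forall>j<q. hol_fun M V (h i j)) \<and>
    (\<forall>j<q. \<forall>p\<in>V. \<forall>u\<in>tangent_space M p. \<theta> j p u = (\<Sum>i<q. h i j p * \<omega> i p u))"
    using frame_change[OF V \<omega> \<theta>] by (elim exE)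
  interpret C: conormal_frame_change M q T V \<theta> \<omega> g h
    by unfold_locales (use V \<theta> \<omega> g h in simp_all)
  show ?thesis
    using C.eta_form C.ext_d_omega[OF cl] C.dual_connection_omega[OF connection_subset[OF conn U] par] C.eta_flat
    by (intro exI[of _ C.eta]) simp
qed

end

theorem proposition8p4:
  fixes M :: "('a, 'n::finite) cmanifold" and q :: nat and T :: "'a \<Rightarrow> 'a tvec set" and x :: 'a
  assumes "complex_manifold M"
    and "regular_foliation M q T"
    and "x \<in> topspace (mtop M)"
  shows "(\<forall>W. openin (mtop M) W \<and> x \<in> W \<longrightarrow>
      (\<exists>U. openin (mtop M) U \<and> x \<in> U \<and> U \<subseteq> W \<and>
        ((\<exists>f. first_integrals M q T U f) \<longleftrightarrow>
         (\<exists>nabla. flat_connection M T U nabla \<and> restricts_to_bott M T U nabla \<and>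
            (\<exists>\<theta>. closed_parallel_frame M q T U nabla \<theta>))))) \<and>
    (\<forall>U nabla. openin (mtop M) U \<and> flat_connection M T U nabla \<and> restricts_to_bott M T U nabla \<and>
        (\<exists>\<theta>. closed_parallel_frame M q T U nabla \<theta>) \<longrightarrow>
      (\<forall>V \<omega>. openin (mtop M) V \<and> V \<subseteq> U \<and> conormal_frame M q T V \<omega> \<longrightarrow>
        (\<exists>\<eta>. (\<forall>i<q. \<forall>j<q. one_form M V (\<eta> i j)) \<and>
          (\<forall>j<q. biform_eq M V (ext_d M (\<omega> j))
             (\<lambda>v w p. - (\<Sum>i<q. wedge (\<omega> i) (\<eta> i j) v w p))) \<and>
          (\<forall>j<q. dual_connection_eq M T V nabla (\<omega> j)
             (\<lambda>p u w. \<Sum>i<q. \<omega> i p w * \<eta> i j p u)) \<and>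
          (\<forall>i<q. \<forall>j<q. biform_eq M V
             (\<lambda>v w p. ext_d M (\<eta> i j) v w p + (\<Sum>k<q. wedge (\<eta> i k) (\<eta> k j) v w p))
             (\<lambda>v w p. 0)))))"
proof -
  interpret foliated_mfd M q T by unfold_locales (use assms in simp_all)
  show ?thesis
  proof (intro conjI allI impI)
    fix W assume W: "openin (mtop M) W \<and> x \<in> W"
    let ?c = "\<lambda>U nabla. flat_connection M T U nabla \<and> restricts_to_bott M T U nabla \<and>
            (\<exists>\<theta>. closed_parallel_frame M q T U nabla \<theta>)"
    show "\<exists>U. openin (mtop M) U \<and> x \<in> U \<and> U \<subseteq> W \<and>
        ((\<exists>f. first_integrals M q T U f) \<longleftrightarrow> (\<exists>nabla. ?c U nabla))"
    \<comment> \<open>In the first case \<open>U\<close> is so small that both sides hold; in the second \<open>U = W\<close> and both fail.\<close>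
    proof (cases "\<exists>U f. openin (mtop M) U \<and> x \<in> U \<and> U \<subseteq> W \<and> first_integrals M q T U f")
      case True
      then obtain U f where U: "openin (mtop M) U" "x \<in> U" "U \<subseteq> W" "first_integrals M q T U f"
        by (elim exE conjE)
      obtain V nabla \<theta> where V: "openin (mtop M) V" "x \<in> V" "V \<subseteq> U" "first_integrals M q T V f"
        "flat_connection M T V nabla" "restricts_to_bott M T V nabla" "closed_parallel_frame M q T V nabla \<theta>"
        by (rule first_integrals_imp_connection[OF U(1,2,4)])
      have "\<exists>f. first_integrals M q T V f" using V(4) by (rule exI[of _ f])
      moreover have "\<exists>nabla. ?c V nabla" by (intro exI[of _ nabla] conjI exI[of _ \<theta>] V)
      ultimately show ?thesis
        using V(1-3) U(3) by (intro exI[of _ V]) simp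
    next
      case False
      have "\<not> (\<exists>nabla. ?c W nabla)"
      proof
        assume "\<exists>nabla. ?c W nabla"
        then obtain nabla \<theta> where fr: "closed_parallel_frame M q T W nabla \<theta>" by (elim exE conjE)
        have c: "conormal_frame M q T W \<theta>" and cl: "\<And>i. i < q \<Longrightarrow> closed_form M W (\<theta> i)"
          using fr unfolding closed_parallel_frame_def by simp_all
        obtain V f where "openin (mtop M) V" "x \<in> V" "V \<subseteq> W" "first_integrals M q T V f"
          by (rule closed_conormal_frame_imp_first_integrals[OF conjunct1[OF W] conjunct2[OF W] c cl])
        then show False using False by simp
      qed
      moreover have "\<not> (\<exists>f. first_integrals M q T W f)" using False W by simp
      ultimately show ?thesis using W by (intro exI[of _ W]) simp
    qed
  next
    fix U nabla V \<omega>
    assume a: "openin (mtop M) U \<and> flat_connection M T U nabla \<and> restricts_to_bott M T U nabla \<and>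
        (\<exists>\<theta>. closed_parallel_frame M q T U nabla \<theta>)"
      and b: "openin (mtop M) V \<and> V \<subseteq> U \<and> conormal_frame M q T V \<omega>"
    from a obtain \<theta> where fr: "closed_parallel_frame M q T U nabla \<theta>" by (elim exE conjE)
    have conn: "connection M T U nabla" using a unfolding flat_connection_def by simp
    from b have b': "V \<subseteq> U" "openin (mtop M) V" "conormal_frame M q T V \<omega>" by simp_all
    show "\<exists>\<eta>. (\<forall>i<q. \<forall>j<q. one_form M V (\<eta> i j)) \<and>
          (\<forall>j<q. biform_eq M V (ext_d M (\<omega> j))
             (\<lambda>v w p. - (\<Sum>i<q. wedge (\<omega> i) (\<eta> i j) v w p))) \<and>
          (\<forall>j<q. dual_connection_eq M T V nabla (\<omega> j)
             (\<lambda>p u w. \<Sum>i<q. \<omega> i p w * \<eta> i j p u)) \<and>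
          (\<forall>i<q. \<forall>j<q. biform_eq M V
             (\<lambda>v w p. ext_d M (\<eta> i j) v w p + (\<Sum>k<q. wedge (\<eta> i k) (\<eta> k j) v w p))
             (\<lambda>v w p. 0))"
      by (rule connection_matrix[OF b'(1,2) conn fr b'(3)])
  qed
qed

end
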